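(* Let $k$ be a field and let $M$ be a finite regular monoid such that for every $\mathcal{D}$-class $D$ of $M$ the group algebra $k[G_D]$ of the Schutzenberger group $G_D$ of $D$ is a cell algebra with $(\Lambda_D)_0=\Lambda_D$. Then $A=k[M]$ is quasi-hereditary.
   Context: A monoid $M$ is regular if for every $x\in M$ there is $y\in M$ with $x=xyx$. Green's relations: $x\mathcal{L}y$ iff $Mx=My$; $x\mathcal{R}y$ iff $xM=yM$; $\mathcal{H}=\mathcal{L}\cap\mathcal{R}$; $\mathcal{D}=\mathcal{L}\circ\mathcal{R}$. Schutzenberger group of a $\mathcal{D}$-class $D$: pick an $\mathcal{H}$-class $H\subseteq D$, put $RT(H)=\{m\in M:Hm\subseteq H\}$, $r_m:H\to H$, $h\mapsto hm$, and $G_D=\{r_m:m\in RT(H)\}$ with product $r_mr_n=r_{mn}$; up to isomorphism this depends only on $D$. Cell algebra over $k$: an associative unital $k$-algebra $A$ with a finite poset $\Lambda$, finite sets $L(\lambda),R(\lambda)$ for $\lambda\in\Lambda$, and a $k$-basis $C=\{{}_sC_t^\lambda:\lambda\in\Lambda,s\in L(\lambda),t\in R(\lambda)\}$ (indexed injectively) such that, with $\hat A^\lambda=\text{span}\{{}_sC_t^\mu:\mu>\lambda\}$: (i) for all $a\in A,\lambda,s,s'$ there is $r_L(a,\lambda,s,s')\in k$ with $a\,{}_sC_t^\lambda\equiv\sum_{s'\in L(\lambda)}r_L(a,\lambda,s,s')\,{}_{s'}C_t^\lambda\bmod\hat A^\lambda$ for every $t\in R(\lambda)$; (ii) for all $a,\lambda,t,t'$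 there is $r_R(a,\lambda,t,t')\in k$ with ${}_sC_t^\lambda\,a\equiv\sum_{t'\in R(\lambda)}r_R(a,\lambda,t,t')\,{}_sC_{t'}^\lambda\bmod\hat A^\lambda$ for every $s\in L(\lambda)$. For $\lambda\in\Lambda$ there is a bilinear form determined on formal bases $\{C_t^\lambda\}_{t\in R(\lambda)}$ of the right cell module $C_R^\lambda$ and $\{{}_sC^\lambda\}_{s\in L(\lambda)}$ of the left cell module ${}_LC^\lambda$ by ${}_{s'}C_t^\lambda\cdot{}_sC_{t'}^\lambda\equiv\langle C_t^\lambda,{}_sC^\lambda\rangle\,{}_{s'}C_{t'}^\lambda\bmod\hat A^\lambda$ for all $s',t'$. $\Lambda_0$ is the set of $\lambda\in\Lambda$ for which this form is not identically zero. For the cell algebra $k[G_D]$ the poset is denoted $\Lambda_D$ and the corresponding subset $(\Lambda_D)_0$. Quasi-hereditary is in the sense of Cline–Parshall–Scott: $A$ has a finite chain of two-sided ideals from $0$ to $A$ in which each successive quotient is a heredity ideal. *)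

theory Defs
  imports "HOL-Algebra.Module" "HOL-Algebra.QuotRing" "HOL-Algebra.Ideal_Product"
begin

section \<open>Green's relations and Schutzenberger groups\<close>

definition regular_monoid :: "('m, 'x) monoid_scheme \<Rightarrow> bool" where
  "regular_monoid M \<longleftrightarrow>
     monoid M \<and> (\<forall>x\<in>carrier M. \<exists>y\<in>carrier M. x = x \<otimes>\<^bsub>M\<^esub> y \<otimes>\<^bsub>M\<^esub> x)"

text \<open>Here \<open>carrier M #> x\<close> is \<open>Mx\<close> and \<open>x <# carrier M\<close> is \<open>xM\<close>.\<close>

definition green_L :: "('m, 'x) monoid_scheme \<Rightarrow> 'm rel" where
  "green_L M = {(x, y). x \<in> carrier M \<and> y \<in> carrier M \<and>
     carrier M #>\<^bsub>M\<^esub> x = carrier M #>\<^bsub>M\<^esub> y}"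

definition green_R :: "('m, 'x) monoid_scheme \<Rightarrow> 'm rel" where
  "green_R M = {(x, y). x \<in> carrier M \<and> y \<in> carrier M \<and>
     x <#\<^bsub>M\<^esub> carrier M = y <#\<^bsub>M\<^esub> carrier M}"

definition green_H :: "('m, 'x) monoid_scheme \<Rightarrow> 'm rel" where
  "green_H M = green_L M \<inter> green_R M"

definition green_D :: "('m, 'x) monoid_scheme \<Rightarrow> 'm rel" where
  "green_D M = green_L M O green_R M"

definition H_classes :: "('m, 'x) monoid_scheme \<Rightarrow> 'm set set" where
  "H_classes M = carrier M // green_H M"

definition D_classes :: "('m, 'x) monoid_scheme \<Rightarrow> 'm set set" where
  "D_classes M = carrier M // green_D M"

definition right_stabilizer :: "('m, 'x) monoid_scheme \<Rightarrow> 'm set \<Rightarrow> 'm set" where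
  "right_stabilizer M H = {m \<in> carrier M. H #>\<^bsub>M\<^esub> m \<subseteq> H}"

definition right_translation :: "('m, 'x) monoid_scheme \<Rightarrow> 'm set \<Rightarrow> 'm \<Rightarrow> 'm \<Rightarrow> 'm" where
  "right_translation M H m = (\<lambda>h\<in>H. h \<otimes>\<^bsub>M\<^esub> m)"

text \<open>
  Translations act on the right, so the product of \<open>f\<close> and \<open>g\<close> is ``first \<open>f\<close>, then \<open>g\<close>''. This is
  the product determined by \<open>r\<^sub>m r\<^sub>n = r\<^sub>m\<^sub>n\<close>; see the lemma \<open>schutzenberger_mult\<close>.
\<close>

definition schutzenberger_group :: "('m, 'x) monoid_scheme \<Rightarrow> 'm set \<Rightarrow> ('m \<Rightarrow> 'm) monoid" where
  "schutzenberger_group M H =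
     \<lparr>carrier = right_translation M H ` right_stabilizer M H,
      mult = (\<lambda>f g. compose H g f),
      one = (\<lambda>h\<in>H. h)\<rparr>"

lemma schutzenberger_mult:
  assumes "monoid M" "H \<subseteq> carrier M" "m \<in> right_stabilizer M H" "n \<in> right_stabilizer M H"
  shows "m \<otimes>\<^bsub>M\<^esub> n \<in> right_stabilizer M H"
    and "right_translation M H m \<otimes>\<^bsub>schutzenberger_group M H\<^esub> right_translation M H n =
           right_translation M H (m \<otimes>\<^bsub>M\<^esub> n)"
proof -
  interpret monoid M by fact
  have assoc: "h \<otimes>\<^bsub>M\<^esub> (m \<otimes>\<^bsub>M\<^esub> n) = h \<otimes>\<^bsub>M\<^esub> m \<otimes>\<^bsub>M\<^esub> n" if "h \<in> H" for h
    using that assms by (intro m_assoc[symmetric]) (auto simp: right_stabilizer_def)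
  have stab: "h \<otimes>\<^bsub>M\<^esub> m \<in> H" "h \<otimes>\<^bsub>M\<^esub> n \<in> H" if "h \<in> H" for h
    using that assms by (auto simp: right_stabilizer_def r_coset_def)
  show "m \<otimes>\<^bsub>M\<^esub> n \<in> right_stabilizer M H"
    using assms(3,4) stab by (auto simp: right_stabilizer_def r_coset_def assoc)
  show "right_translation M H m \<otimes>\<^bsub>schutzenberger_group M H\<^esub> right_translation M H n =
          right_translation M H (m \<otimes>\<^bsub>M\<^esub> n)"
    using stab by (auto simp: schutzenberger_group_def right_translation_def compose_def assoc
        intro!: restrict_ext)
qed


section \<open>Monoid algebras\<close>

definition fin_supp :: "('r, 'x) ring_scheme \<Rightarrow> 'i set \<Rightarrow> ('i \<Rightarrow> 'r) set" where
  "fin_supp R I = {f. (\<forall>i. f i \<in> carrier R) \<and> (\<forall>i. i \<notin> I \<longrightarrow> f i = \<zero>\<^bsub>R\<^esub>) \<and>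
     finite {i. f i \<noteq> \<zero>\<^bsub>R\<^esub>}}"

text \<open>
  The formal sum of the \<open>f x\<close> times \<open>x\<close> is represented by the coefficient function \<open>f\<close>, which
  vanishes outside \<open>carrier M\<close>. The product sums over the supports only, since \<open>finsum\<close> over an
  infinite set is zero by convention.
\<close>

definition monoid_algebra ::
  "('k, 'x) ring_scheme \<Rightarrow> ('m, 'y) monoid_scheme \<Rightarrow> ('k, 'm \<Rightarrow> 'k) module" where
  "monoid_algebra K M =
     \<lparr>carrier = fin_supp K (carrier M),
      mult = (\<lambda>f g x. \<Oplus>\<^bsub>K\<^esub>p\<in>{(y, z). f y \<noteq> \<zero>\<^bsub>K\<^esub> \<and> g z \<noteq> \<zero>\<^bsub>K\<^esub> \<and> y \<otimes>\<^bsub>M\<^esub> z = x}.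
                f (fst p) \<otimes>\<^bsub>K\<^esub> g (snd p)),
      one = (\<lambda>x. if x = \<one>\<^bsub>M\<^esub> then \<one>\<^bsub>K\<^esub> else \<zero>\<^bsub>K\<^esub>),
      zero = (\<lambda>x. \<zero>\<^bsub>K\<^esub>),
      add = (\<lambda>f g x. f x \<oplus>\<^bsub>K\<^esub> g x),
      smult = (\<lambda>c f x. c \<otimes>\<^bsub>K\<^esub> f x)\<rparr>"


section \<open>Cell algebras\<close>

text \<open>The library's locale \<open>algebra\<close> is restricted to commutative algebras.\<close>

locale assoc_algebra = field K + module K A + A: ring A
  for K (structure) and A (structure) +
  assumes smult_mult_left:
      "\<lbrakk>c \<in> carrier K; x \<in> carrier A; y \<in> carrier A\<rbrakk> \<Longrightarrow>
        (c \<odot>\<^bsub>A\<^esub> x) \<otimes>\<^bsub>A\<^esub> y = c \<odot>\<^bsub>A\<^esub> (x \<otimes>\<^bsub>A\<^esub> y)"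
    and smult_mult_right:
      "\<lbrakk>c \<in> carrier K; x \<in> carrier A; y \<in> carrier A\<rbrakk> \<Longrightarrow>
        x \<otimes>\<^bsub>A\<^esub> (c \<odot>\<^bsub>A\<^esub> y) = c \<odot>\<^bsub>A\<^esub> (x \<otimes>\<^bsub>A\<^esub> y)"

definition linear_span ::
  "('k, 'x) ring_scheme \<Rightarrow> ('k, 'a, 'y) module_scheme \<Rightarrow> 'a set \<Rightarrow> 'a set" where
  "linear_span K A S =
     {\<Oplus>\<^bsub>A\<^esub>x\<in>F. c x \<odot>\<^bsub>A\<^esub> x | F c. finite F \<and> F \<subseteq> S \<and> c \<in> F \<rightarrow> carrier K}"

definition linearly_independent ::
  "('k, 'x) ring_scheme \<Rightarrow> ('k, 'a, 'y) module_scheme \<Rightarrow> 'a set \<Rightarrow> bool" where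
  "linearly_independent K A S \<longleftrightarrow>
     (\<forall>F c. finite F \<and> F \<subseteq> S \<and> c \<in> F \<rightarrow> carrier K \<and> (\<Oplus>\<^bsub>A\<^esub>x\<in>F. c x \<odot>\<^bsub>A\<^esub> x) = \<zero>\<^bsub>A\<^esub>
        \<longrightarrow> (\<forall>x\<in>F. c x = \<zero>\<^bsub>K\<^esub>))"

definition is_basis ::
  "('k, 'x) ring_scheme \<Rightarrow> ('k, 'a, 'y) module_scheme \<Rightarrow> 'a set \<Rightarrow> bool" where
  "is_basis K A S \<longleftrightarrow>
     S \<subseteq> carrier A \<and> linearly_independent K A S \<and> linear_span K A S = carrier A"

text \<open>
  \<open>(\<lambda>, \<mu>) \<in> cell_le X\<close> means \<open>\<lambda> \<le> \<mu>\<close>, and \<open>cell_elt X \<lambda> s t\<close> is the basis element with left index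
  \<open>s\<close> and right index \<open>t\<close>.
\<close>

record ('l, 's, 't, 'a) cell_datum =
  cell_poset :: "'l set"
  cell_le :: "'l rel"
  cell_left :: "'l \<Rightarrow> 's set"
  cell_right :: "'l \<Rightarrow> 't set"
  cell_elt :: "'l \<Rightarrow> 's \<Rightarrow> 't \<Rightarrow> 'a"

definition cell_indices :: "('l, 's, 't, 'a) cell_datum \<Rightarrow> ('l \<times> 's \<times> 't) set" where
  "cell_indices X = (SIGMA l:cell_poset X. cell_left X l \<times> cell_right X l)"

definition cell_above ::
  "('k, 'x) ring_scheme \<Rightarrow> ('k, 'a, 'y) module_scheme \<Rightarrow> ('l, 's, 't, 'a) cell_datum \<Rightarrow> 'l \<Rightarrow> 'a set"
where
  "cell_above K A X l = linear_span K A
     {cell_elt X m s t | m s t. (m, s, t) \<in> cell_indices X \<and> (l, m) \<in> cell_le X \<and> m \<noteq> l}"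

definition cell_algebra ::
  "('k, 'x) ring_scheme \<Rightarrow> ('k, 'a, 'y) module_scheme \<Rightarrow> ('l, 's, 't, 'a) cell_datum \<Rightarrow> bool"
where
  "cell_algebra K A X \<longleftrightarrow>
     assoc_algebra K A \<and>
     finite (cell_poset X) \<and> partial_order_on (cell_poset X) (cell_le X) \<and>
     (\<forall>l\<in>cell_poset X. finite (cell_left X l) \<and> finite (cell_right X l)) \<and>
     inj_on (\<lambda>(l, s, t). cell_elt X l s t) (cell_indices X) \<and>
     is_basis K A ((\<lambda>(l, s, t). cell_elt X l s t) ` cell_indices X) \<and>
     (\<forall>a\<in>carrier A. \<forall>l\<in>cell_poset X. \<forall>s\<in>cell_left X l.
        \<exists>r\<in>cell_left X l \<rightarrow> carrier K. \<forall>t\<in>cell_right X l.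
          (a \<otimes>\<^bsub>A\<^esub> cell_elt X l s t)
            \<ominus>\<^bsub>A\<^esub> (\<Oplus>\<^bsub>A\<^esub>s'\<in>cell_left X l. r s' \<odot>\<^bsub>A\<^esub> cell_elt X l s' t) \<in> cell_above K A X l) \<and>
     (\<forall>a\<in>carrier A. \<forall>l\<in>cell_poset X. \<forall>t\<in>cell_right X l.
        \<exists>r\<in>cell_right X l \<rightarrow> carrier K. \<forall>s\<in>cell_left X l.
          (cell_elt X l s t \<otimes>\<^bsub>A\<^esub> a)
            \<ominus>\<^bsub>A\<^esub> (\<Oplus>\<^bsub>A\<^esub>t'\<in>cell_right X l. r t' \<odot>\<^bsub>A\<^esub> cell_elt X l s t') \<in> cell_above K A X l)"

text \<open>
  The form on the formal basis vectors indexed by \<open>t\<close> (right cell module) and \<open>s\<close> (left cell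
  module). For a cell algebra the defining scalar exists and is unique.
\<close>

definition cell_form_basis ::
  "('k, 'x) ring_scheme \<Rightarrow> ('k, 'a, 'y) module_scheme \<Rightarrow> ('l, 's, 't, 'a) cell_datum \<Rightarrow>
     'l \<Rightarrow> 't \<Rightarrow> 's \<Rightarrow> 'k"
where
  "cell_form_basis K A X l t s =
     (THE c. c \<in> carrier K \<and>
        (\<forall>s'\<in>cell_left X l. \<forall>t'\<in>cell_right X l.
           (cell_elt X l s' t \<otimes>\<^bsub>A\<^esub> cell_elt X l s t') \<ominus>\<^bsub>A\<^esub> (c \<odot>\<^bsub>A\<^esub> cell_elt X l s' t')
             \<in> cell_above K A X l))"

text \<open>
  Vectors of the right and left cell modules are given by their coordinates, i.e. by elements of
  \<open>fin_supp K (cell_right X l)\<close> and \<open>fin_supp K (cell_left X l)\<close>.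
\<close>

definition cell_form ::
  "('k, 'x) ring_scheme \<Rightarrow> ('k, 'a, 'y) module_scheme \<Rightarrow> ('l, 's, 't, 'a) cell_datum \<Rightarrow>
     'l \<Rightarrow> ('t \<Rightarrow> 'k) \<Rightarrow> ('s \<Rightarrow> 'k) \<Rightarrow> 'k"
where
  "cell_form K A X l u v =
     (\<Oplus>\<^bsub>K\<^esub>t\<in>cell_right X l. \<Oplus>\<^bsub>K\<^esub>s\<in>cell_left X l.
        u t \<otimes>\<^bsub>K\<^esub> v s \<otimes>\<^bsub>K\<^esub> cell_form_basis K A X l t s)"

definition cell_poset_0 ::
  "('k, 'x) ring_scheme \<Rightarrow> ('k, 'a, 'y) module_scheme \<Rightarrow> ('l, 's, 't, 'a) cell_datum \<Rightarrow> 'l set"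
where
  "cell_poset_0 K A X =
     {l \<in> cell_poset X. \<exists>u\<in>fin_supp K (cell_right X l). \<exists>v\<in>fin_supp K (cell_left X l).
        cell_form K A X l u v \<noteq> \<zero>\<^bsub>K\<^esub>}"


section \<open>Quasi-hereditary rings\<close>

definition right_ideal :: "'r set \<Rightarrow> ('r, 'x) ring_scheme \<Rightarrow> bool" where
  "right_ideal I R \<longleftrightarrow>
     additive_subgroup I R \<and> (\<forall>a\<in>I. \<forall>x\<in>carrier R. a \<otimes>\<^bsub>R\<^esub> x \<in> I)"

definition maximal_right_ideal :: "'r set \<Rightarrow> ('r, 'x) ring_scheme \<Rightarrow> bool" where
  "maximal_right_ideal I R \<longleftrightarrow>
     right_ideal I R \<and> I \<noteq> carrier R \<and>
     (\<forall>J. right_ideal J R \<and> I \<subseteq> J \<longrightarrow> J = I \<or> J = carrier R)"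

definition jacobson_radical :: "('r, 'x) ring_scheme \<Rightarrow> 'r set" where
  "jacobson_radical R = carrier R \<inter> \<Inter>{I. maximal_right_ideal I R}"

text \<open>
  Right modules use the library record for modules with \<open>r \<odot> x\<close> standing for \<open>x r\<close>. The library's
  locale \<open>module\<close> is restricted to commutative scalars. The record fields \<open>mult\<close> and \<open>one\<close> are not
  used.
\<close>

locale right_module = R?: ring R + M?: abelian_group M
  for R (structure) and M (structure) +
  assumes rsmult_closed:
      "\<lbrakk>r \<in> carrier R; x \<in> carrier M\<rbrakk> \<Longrightarrow> r \<odot>\<^bsub>M\<^esub> x \<in> carrier M"
    and rsmult_r_distr:
      "\<lbrakk>r \<in> carrier R; s \<in> carrier R; x \<in> carrier M\<rbrakk> \<Longrightarrow>
        (r \<oplus>\<^bsub>R\<^esub> s) \<odot>\<^bsub>M\<^esub> x = r \<odot>\<^bsub>M\<^esub> x \<oplus>\<^bsub>M\<^esub> s \<odot>\<^bsub>M\<^esub> x"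
    and rsmult_l_distr:
      "\<lbrakk>r \<in> carrier R; x \<in> carrier M; y \<in> carrier M\<rbrakk> \<Longrightarrow>
        r \<odot>\<^bsub>M\<^esub> (x \<oplus>\<^bsub>M\<^esub> y) = r \<odot>\<^bsub>M\<^esub> x \<oplus>\<^bsub>M\<^esub> r \<odot>\<^bsub>M\<^esub> y"
    and rsmult_assoc:
      "\<lbrakk>r \<in> carrier R; s \<in> carrier R; x \<in> carrier M\<rbrakk> \<Longrightarrow>
        (r \<otimes>\<^bsub>R\<^esub> s) \<odot>\<^bsub>M\<^esub> x = s \<odot>\<^bsub>M\<^esub> (r \<odot>\<^bsub>M\<^esub> x)"
    and rsmult_one:
      "x \<in> carrier M \<Longrightarrow> \<one>\<^bsub>R\<^esub> \<odot>\<^bsub>M\<^esub> x = x"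

definition right_module_hom ::
  "('r, 'x) ring_scheme \<Rightarrow> ('r, 'm, 'y) module_scheme \<Rightarrow> ('r, 'n, 'z) module_scheme \<Rightarrow> ('m \<Rightarrow> 'n) set"
where
  "right_module_hom R M N =
     {f \<in> carrier M \<rightarrow> carrier N.
        (\<forall>x\<in>carrier M. \<forall>y\<in>carrier M. f (x \<oplus>\<^bsub>M\<^esub> y) = f x \<oplus>\<^bsub>N\<^esub> f y) \<and>
        (\<forall>r\<in>carrier R. \<forall>x\<in>carrier M. f (r \<odot>\<^bsub>M\<^esub> x) = r \<odot>\<^bsub>N\<^esub> f x)}"

definition free_right_module :: "('r, 'x) ring_scheme \<Rightarrow> 'i set \<Rightarrow> ('r, 'i \<Rightarrow> 'r) module" where
  "free_right_module R I =
     \<lparr>carrier = fin_supp R I, mult = undefined, one = undefined,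
      zero = (\<lambda>i. \<zero>\<^bsub>R\<^esub>),
      add = (\<lambda>f g i. f i \<oplus>\<^bsub>R\<^esub> g i),
      smult = (\<lambda>r f i. f i \<otimes>\<^bsub>R\<^esub> r)\<rparr>"

text \<open>
  Projective means being a direct summand of a free module, i.e. a retract of one. Every module is a
  quotient of the free module on its own underlying set, so it is no restriction to take the index
  set \<open>I\<close> in the type of the elements of \<open>P\<close>.
\<close>

definition projective_right_module ::
  "('r, 'x) ring_scheme \<Rightarrow> ('r, 'p, 'y) module_scheme \<Rightarrow> bool"
where
  "projective_right_module R P \<longleftrightarrow>
     right_module R P \<and>
     (\<exists>(I :: 'p set) f g.
        f \<in> right_module_hom R P (free_right_module R I) \<and>
        g \<in> right_module_hom R (free_right_module R I) P \<and>
        (\<forall>x\<in>carrier P. g (f x) = x))"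

definition right_ideal_module :: "('r, 'x) ring_scheme \<Rightarrow> 'r set \<Rightarrow> ('r, 'r) module" where
  "right_ideal_module R J =
     \<lparr>carrier = J, mult = undefined, one = undefined,
      zero = \<zero>\<^bsub>R\<^esub>, add = (\<oplus>\<^bsub>R\<^esub>), smult = (\<lambda>r x. x \<otimes>\<^bsub>R\<^esub> r)\<rparr>"

definition heredity_ideal :: "'r set \<Rightarrow> ('r, 'x) ring_scheme \<Rightarrow> bool" where
  "heredity_ideal J R \<longleftrightarrow>
     ideal J R \<and>
     ideal_prod R J J = J \<and>
     ideal_prod R (ideal_prod R J (jacobson_radical R)) J = {\<zero>\<^bsub>R\<^esub>} \<and>
     projective_right_module R (right_ideal_module R J)"

definition quasi_hereditary :: "('r, 'x) ring_scheme \<Rightarrow> bool" where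
  "quasi_hereditary R \<longleftrightarrow>
     ring R \<and>
     (\<exists>(n :: nat) I.
        I 0 = {\<zero>\<^bsub>R\<^esub>} \<and> I n = carrier R \<and>
        (\<forall>i\<le>n. ideal (I i) R) \<and>
        (\<forall>i<n. I i \<subset> I (Suc i) \<and>
           heredity_ideal ((\<lambda>x. I i +>\<^bsub>R\<^esub> x) ` I (Suc i)) (R Quot I i)))"

end

theory Submission
  imports Defs
begin

text \<open>
  The algebra \<open>k[M]\<close> is filtered in two stages.

  First, the D-classes of \<open>M\<close> are added one at a time, those that generate small ideals first. This
  gives monoid ideals \<open>Y\<close> of \<open>M\<close> and ideals \<open>k[Y]\<close> of \<open>k[M]\<close>. By regularity the class \<open>D\<close> that is added to
  \<open>Y\<close> contains an idempotent \<open>e\<close>, and every element of \<open>D\<close> is a unique product \<open>a g b\<close>: here \<open>g\<close> lies in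
  the maximal subgroup at \<open>e\<close>, which is a copy of the Schutzenberger group \<open>G\<close>, while \<open>a\<close> and \<open>b\<close>
  run through representatives of the R-classes and of the L-classes in \<open>D\<close>. Modulo \<open>k[Y]\<close>, the
  ideal \<open>k[Y \<union> D]\<close> therefore consists of matrices over \<open>k[G]\<close>, multiplied through a sandwich matrix
  that has the unit \<open>e\<close> among its entries (\<open>rees_layer_D\<close>).

  Second, an ideal \<open>I\<close> of \<open>k[G]\<close> lifts to the ideal of those elements of \<open>k[Y \<union> D]\<close> all of whose
  matrix entries lie in \<open>I\<close>. The chain of cell ideals of \<open>k[G]\<close> thus becomes a chain of ideals from
  \<open>k[Y]\<close> to \<open>k[Y \<union> D]\<close> (\<open>heredity_chain_lift\<close>).

  Each step \<open>I \<subset> J\<close> of these chains is controlled by generators: an element \<open>e\<close> of \<open>J\<close> that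
  is idempotent modulo \<open>I\<close>, whose corner \<open>e R e\<close> is a division ring modulo \<open>I\<close>, and finitely many \<open>u = u e\<close>
  such that \<open>J/I\<close> is the direct sum of the right modules \<open>u (R/I)\<close>, each of them a copy of
  \<open>e (R/I)\<close>. Such data make \<open>J/I\<close> a heredity ideal
  (\<open>heredity_generators_zero_imp_heredity_ideal\<close>). In a cell algebra, a nonzero value \<open>c\<close> of the form
  at indices \<open>t\<^sub>0\<close>, \<open>s\<^sub>0\<close> yields them: \<open>e\<close> is the cell element with indices \<open>s\<^sub>0\<close>, \<open>t\<^sub>0\<close> divided by
  \<open>c\<close>, and the \<open>u\<close> are the cell elements with right index \<open>t\<^sub>0\<close> (\<open>heredity_layer_cell\<close>). They pass from
  \<open>k[G]\<close> to \<open>k[M]\<close> by keeping \<open>e\<close> and replacing each \<open>u\<close> by all the products \<open>a u\<close>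
  (\<open>heredity_layer_lift\<close>).
\<close>

section \<open>Additive maps, finite sums and right ideals\<close>

lemma additive_map_zero:
  assumes "abelian_group G" "abelian_group H" "f \<in> carrier G \<rightarrow> carrier H"
    and add: "\<And>x y. \<lbrakk>x \<in> carrier G; y \<in> carrier G\<rbrakk> \<Longrightarrow> f (x \<oplus>\<^bsub>G\<^esub> y) = f x \<oplus>\<^bsub>H\<^esub> f y"
  shows "f \<zero>\<^bsub>G\<^esub> = \<zero>\<^bsub>H\<^esub>"
proof -
  interpret G: abelian_group G by fact
  interpret H: abelian_group H by fact
  have "f \<zero>\<^bsub>G\<^esub> \<in> carrier H" using assms(3) by auto
  moreover have "f \<zero>\<^bsub>G\<^esub> \<oplus>\<^bsub>H\<^esub> f \<zero>\<^bsub>G\<^esub> = f \<zero>\<^bsub>G\<^esub>" using add[of "\<zero>\<^bsub>G\<^esub>" "\<zero>\<^bsub>G\<^esub>"] by simp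
  ultimately show ?thesis by (metis H.add.r_cancel_one')
qed

lemma additive_map_finsum:
  assumes "abelian_group G" "abelian_group H" "f \<in> carrier G \<rightarrow> carrier H"
    and add: "\<And>x y. \<lbrakk>x \<in> carrier G; y \<in> carrier G\<rbrakk> \<Longrightarrow> f (x \<oplus>\<^bsub>G\<^esub> y) = f x \<oplus>\<^bsub>H\<^esub> f y"
    and "g \<in> S \<rightarrow> carrier G"
  shows "f (\<Oplus>\<^bsub>G\<^esub>i\<in>S. g i) = (\<Oplus>\<^bsub>H\<^esub>i\<in>S. f (g i))"
proof -
  interpret G: abelian_group G by fact
  interpret H: abelian_group H by fact
  note zero = additive_map_zero[OF assms(1-4)]
  show ?thesis using assms(5)
  proof (induction S rule: infinite_finite_induct)
    case (insert x F)
    have "(\<lambda>i. f (g i)) \<in> F \<rightarrow> carrier H" "f (g x) \<in> carrier H"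
      using insert.prems assms(3) by auto
    with insert show ?case using G.finsum_closed[of g F] by (simp add: add Pi_iff)
  qed (auto simp: zero)
qed

lemma (in abelian_monoid) finsum_mem:
  assumes "\<zero> \<in> N" "N \<subseteq> carrier G" "\<And>x y. \<lbrakk>x \<in> N; y \<in> N\<rbrakk> \<Longrightarrow> x \<oplus> y \<in> N"
    and "\<And>i. i \<in> S \<Longrightarrow> g i \<in> N"
  shows "(\<Oplus>i\<in>S. g i) \<in> N"
  using assms(4)
proof (induction S rule: infinite_finite_induct)
  case (insert x F)
  then have "g \<in> F \<rightarrow> carrier G" "g x \<in> carrier G" using assms(2) by auto
  with insert show ?case by (simp add: assms(3))
qed (use assms(1) in auto)

lemma (in abelian_monoid) finsum_all_zero:
  "(\<And>i. i \<in> S \<Longrightarrow> f i = \<zero>) \<Longrightarrow> (\<Oplus>i\<in>S. f i) = \<zero>"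
  by (rule add.finprod_one_eqI)

lemma (in abelian_monoid) finsum_single:
  assumes "finite S" "i \<in> S" "f i \<in> carrier G" "\<And>j. \<lbrakk>j \<in> S; j \<noteq> i\<rbrakk> \<Longrightarrow> f j = \<zero>"
  shows "(\<Oplus>j\<in>S. f j) = f i"
proof -
  have "f j \<in> carrier G" if "j \<in> S" for j using assms(3) assms(4)[OF that] by (cases "j = i") auto
  then have "(\<Oplus>j\<in>S. f j) = (\<Oplus>j\<in>{i}. f j)"
    using assms by (intro add.finprod_mono_neutral_cong_right) auto
  then show ?thesis using assms(3) by simp
qed

lemma (in abelian_group) minus_eq_zero_iff:
  assumes "x \<in> carrier G" "y \<in> carrier G"
  shows "x \<ominus> y = \<zero> \<longleftrightarrow> x = y"
proof
  assume "x \<ominus> y = \<zero>"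
  then have "x \<ominus> y \<oplus> y = y" using assms by simp
  then show "x = y" using assms by (simp add: a_minus_def a_assoc l_neg)
qed (use assms in \<open>simp add: a_minus_def r_neg\<close>)

lemma right_idealI:
  fixes R (structure)
  assumes "ring R" "N \<subseteq> carrier R" "\<zero>\<^bsub>R\<^esub> \<in> N"
    and add: "\<And>x y. \<lbrakk>x \<in> N; y \<in> N\<rbrakk> \<Longrightarrow> x \<oplus>\<^bsub>R\<^esub> y \<in> N"
    and mult: "\<And>x a. \<lbrakk>x \<in> N; a \<in> carrier R\<rbrakk> \<Longrightarrow> x \<otimes>\<^bsub>R\<^esub> a \<in> N"
  shows "right_ideal N R"
proof -
  interpret ring R by fact
  have "\<ominus> x \<in> N" if "x \<in> N" for x
  proof -
    have "x \<in> carrier R" using that assms(2) by auto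
    then have "x \<otimes> (\<ominus> \<one>) = \<ominus> x" by (simp add: r_minus)
    then show ?thesis using mult[OF that, of "\<ominus> \<one>"] by simp
  qed
  then have "subgroup N (add_monoid R)"
    using assms by (intro add.subgroupI) (auto simp: a_inv_def)
  then show ?thesis using mult by (auto simp: right_ideal_def additive_subgroup_def)
qed

lemma right_idealD:
  fixes R (structure)
  assumes "right_ideal N R" "ring R"
  shows "N \<subseteq> carrier R" "\<zero>\<^bsub>R\<^esub> \<in> N" "\<And>x y. \<lbrakk>x \<in> N; y \<in> N\<rbrakk> \<Longrightarrow> x \<oplus>\<^bsub>R\<^esub> y \<in> N"
    "\<And>x y. \<lbrakk>x \<in> N; y \<in> N\<rbrakk> \<Longrightarrow> x \<ominus>\<^bsub>R\<^esub> y \<in> N"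
    "\<And>x a. \<lbrakk>x \<in> N; a \<in> carrier R\<rbrakk> \<Longrightarrow> x \<otimes>\<^bsub>R\<^esub> a \<in> N"
proof -
  interpret ring R by fact
  have N: "additive_subgroup N R" and m: "\<forall>a\<in>N. \<forall>x\<in>carrier R. a \<otimes> x \<in> N"
    using assms(1) by (auto simp: right_ideal_def)
  interpret N: additive_subgroup N R by fact
  show "N \<subseteq> carrier R" "\<zero>\<^bsub>R\<^esub> \<in> N" "\<And>x y. \<lbrakk>x \<in> N; y \<in> N\<rbrakk> \<Longrightarrow> x \<oplus>\<^bsub>R\<^esub> y \<in> N"
    "\<And>x a. \<lbrakk>x \<in> N; a \<in> carrier R\<rbrakk> \<Longrightarrow> x \<otimes>\<^bsub>R\<^esub> a \<in> N"
    using m by (auto simp: N.a_subset)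
  show "\<And>x y. \<lbrakk>x \<in> N; y \<in> N\<rbrakk> \<Longrightarrow> x \<ominus>\<^bsub>R\<^esub> y \<in> N"
    by (simp add: a_minus_def)
qed

lemma ideal_is_right_ideal: "ideal N R \<Longrightarrow> right_ideal N R"
  by (simp add: right_ideal_def ideal_def ideal_axioms_def additive_subgroup_def)

lemma idealI_closed:
  fixes R (structure)
  assumes "ring R" "N \<subseteq> carrier R" "\<zero> \<in> N" "\<And>x y. \<lbrakk>x \<in> N; y \<in> N\<rbrakk> \<Longrightarrow> x \<oplus> y \<in> N"
    and "\<And>x a. \<lbrakk>x \<in> N; a \<in> carrier R\<rbrakk> \<Longrightarrow> a \<otimes> x \<in> N"
    and "\<And>x a. \<lbrakk>x \<in> N; a \<in> carrier R\<rbrakk> \<Longrightarrow> x \<otimes> a \<in> N"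
  shows "ideal N R"
proof -
  have "right_ideal N R" using assms by (intro right_idealI) auto
  then show ?thesis using assms
    by (auto simp: right_ideal_def ideal_def ideal_axioms_def)
qed

lemma ideal_minus_trans:
  fixes R (structure)
  assumes "ideal I R" and c: "x \<in> carrier R" "y \<in> carrier R" "z \<in> carrier R"
    and "x \<ominus> y \<in> I" "y \<ominus> z \<in> I"
  shows "x \<ominus> z \<in> I"
proof -
  interpret ideal I R by fact
  have "(x \<ominus> y) \<oplus> (y \<ominus> z) = x \<ominus> z"
    using c by (simp add: a_minus_def a_assoc r_neg1)
  then show ?thesis using additive_subgroup.a_closed[OF ideal.axioms(1)[OF assms(1)] assms(5,6)] by simp
qed

section \<open>Heredity layers\<close>

text \<open>
  All conditions are relative to \<open>I\<close>, so that they can be verified by computing in \<open>R\<close> modulo \<open>I\<close>.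
  The last two say that \<open>J/I\<close> is the direct sum of the right modules \<open>u (R/I)\<close>, and that the map
  from \<open>e (R/I)\<close> to \<open>u (R/I)\<close> given by left multiplication with \<open>u = u e\<close> is injective. That the \<open>u\<close> generate is
  expressed through all right ideals \<open>N\<close>, because this form is applied by exhibiting
  a suitable right ideal, and it transfers along ring homomorphisms by taking preimages.
\<close>

definition heredity_generators ::
  "('a, 'x) ring_scheme \<Rightarrow> 'a set \<Rightarrow> 'a set \<Rightarrow> 'a \<Rightarrow> 'a set \<Rightarrow> bool" where
  "heredity_generators R I J e U \<longleftrightarrow>
     ideal I R \<and> ideal J R \<and> I \<subseteq> J \<and> e \<in> J \<and> e \<notin> I \<and> (e \<otimes>\<^bsub>R\<^esub> e) \<ominus>\<^bsub>R\<^esub> e \<in> I \<and>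
     (\<forall>x\<in>carrier R. e \<otimes>\<^bsub>R\<^esub> x \<otimes>\<^bsub>R\<^esub> e \<in> I \<or>
        (\<exists>y\<in>carrier R. (e \<otimes>\<^bsub>R\<^esub> x \<otimes>\<^bsub>R\<^esub> e \<otimes>\<^bsub>R\<^esub> y \<otimes>\<^bsub>R\<^esub> e) \<ominus>\<^bsub>R\<^esub> e \<in> I)) \<and>
     finite U \<and> U \<subseteq> J \<and> (\<forall>u\<in>U. (u \<otimes>\<^bsub>R\<^esub> e) \<ominus>\<^bsub>R\<^esub> u \<in> I) \<and>
     (\<forall>N. right_ideal N R \<and> I \<subseteq> N \<and> U \<subseteq> N \<longrightarrow> J \<subseteq> N) \<and>
     (\<forall>b\<in>U \<rightarrow> carrier R. (\<Oplus>\<^bsub>R\<^esub>u\<in>U. u \<otimes>\<^bsub>R\<^esub> b u) \<in> I \<longrightarrow> (\<forall>u\<in>U. e \<otimes>\<^bsub>R\<^esub> b u \<in> I))"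

lemma heredity_generatorsD:
  fixes R (structure)
  assumes "heredity_generators R I J e U"
  shows "ideal I R" "ideal J R" "I \<subseteq> J" "e \<in> J" "e \<notin> I" "(e \<otimes> e) \<ominus> e \<in> I"
    and "\<And>x. x \<in> carrier R \<Longrightarrow> e \<otimes> x \<otimes> e \<in> I \<or>
        (\<exists>y\<in>carrier R. (e \<otimes> x \<otimes> e \<otimes> y \<otimes> e) \<ominus> e \<in> I)"
    and "finite U" "U \<subseteq> J" "\<And>u. u \<in> U \<Longrightarrow> (u \<otimes> e) \<ominus> u \<in> I"
    and "\<And>N. \<lbrakk>right_ideal N R; I \<subseteq> N; U \<subseteq> N\<rbrakk> \<Longrightarrow> J \<subseteq> N"
    and "\<And>b u. \<lbrakk>b \<in> U \<rightarrow> carrier R; (\<Oplus>u\<in>U. u \<otimes> b u) \<in> I; u \<in> U\<rbrakk> \<Longrightarrow> e \<otimes> b u \<in> I"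
  using assms unfolding heredity_generators_def by simp_all

definition heredity_layer :: "('a, 'x) ring_scheme \<Rightarrow> 'a set \<Rightarrow> 'a set \<Rightarrow> bool" where
  "heredity_layer R I J \<longleftrightarrow> (\<exists>e U. heredity_generators R I J e U)"

lemma heredity_generators_quotient:
  fixes R (structure)
  assumes R: "ring R" and gen: "heredity_generators R I J e U"
  shows "heredity_generators (R Quot I) {\<zero>\<^bsub>R Quot I\<^esub>} ((\<lambda>x. I +>\<^bsub>R\<^esub> x) ` J) (I +>\<^bsub>R\<^esub> e)
    ((\<lambda>x. I +>\<^bsub>R\<^esub> x) ` U)"
proof -
  note g = heredity_generatorsD[OF gen]
  interpret ring R by fact
  interpret I: ideal I R by (rule g(1))
  interpret J: ideal J R by (rule g(2))
  let ?B = "R Quot I" and ?q = "\<lambda>x. I +> x"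
  interpret q: ring_hom_ring R ?B ?q by (rule I.rcos_ring_hom_ring)
  have zero: "?q x = \<zero>\<^bsub>?B\<^esub> \<longleftrightarrow> x \<in> I" if "x \<in> carrier R" for x
  proof -
    have "?q x = ?q \<zero> \<longleftrightarrow> x \<ominus> \<zero> \<in> I"
      using that by (intro quotient_eq_iff_same_a_r_cos[symmetric]) (auto simp: I.ideal_axioms)
    then show ?thesis using that by (simp add: a_minus_def)
  qed
  have eq: "?q x = ?q y \<longleftrightarrow> x \<ominus> y \<in> I" if "x \<in> carrier R" "y \<in> carrier R" for x y
    using that by (intro quotient_eq_iff_same_a_r_cos[symmetric]) (auto simp: I.ideal_axioms)
  have surj: "\<exists>x\<in>carrier R. z = ?q x" if "z \<in> carrier ?B" for z
    using that unfolding FactRing_simps by auto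
  have e: "e \<in> carrier R" using g(4) J.a_subset by auto
  have U: "U \<subseteq> carrier R" "finite U" using g(8,9) J.a_subset by auto
  have minus: "?q (x \<ominus> y) = ?q x \<ominus>\<^bsub>?B\<^esub> ?q y" if "x \<in> carrier R" "y \<in> carrier R" for x y
    using that by (simp add: a_minus_def)
  have J': "ideal (?q ` J) ?B"
    using ring_ideal_imp_quot_ideal[OF I.ideal_axioms J.ideal_axioms] .
  have inj: "inj_on ?q U"
  \<comment> \<open>If two generators agreed modulo \<open>I\<close>, their difference would be a relation with coefficient \<open>1\<close>,
    which forces \<open>e\<close> into \<open>I\<close>.\<close>
  proof (rule inj_onI, rule ccontr)
    fix u v assume uv: "u \<in> U" "v \<in> U" "?q u = ?q v" "u \<noteq> v"
    let ?b = "\<lambda>w. if w = u then \<one> else if w = v then \<ominus> \<one> else \<zero>"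
    have uvc: "u \<in> carrier R" "v \<in> carrier R" using uv U by auto
    have "(\<Oplus>w\<in>U. w \<otimes> ?b w) = (\<Oplus>w\<in>{u, v}. w \<otimes> ?b w)"
      using U uv by (intro add.finprod_mono_neutral_cong_right) (auto simp: subset_iff)
    also have "\<dots> = u \<ominus> v" using uvc uv(4) by (auto simp: a_minus_def r_minus)
    also have "\<dots> \<in> I" using uv uvc eq by auto
    finally have "e \<otimes> ?b u \<in> I"
      using uv U by (intro g(12)) (auto simp: Pi_iff)
    then show False using g(5) e by simp
  qed
  show ?thesis
    unfolding heredity_generators_def
  proof (intro conjI ballI allI impI; (elim conjE)?)
    show "ideal {\<zero>\<^bsub>?B\<^esub>} ?B" by (rule ring.zeroideal[OF q.S.ring_axioms])
    show "ideal (?q ` J) ?B" by (rule J')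
    then show "{\<zero>\<^bsub>?B\<^esub>} \<subseteq> ?q ` J" by (simp add: ideal_def additive_subgroup.zero_closed)
    show "?q e \<in> ?q ` J" "?q e \<notin> {\<zero>\<^bsub>?B\<^esub>}" using g(4,5) zero[OF e] by auto
    show "(?q e \<otimes>\<^bsub>?B\<^esub> ?q e) \<ominus>\<^bsub>?B\<^esub> ?q e \<in> {\<zero>\<^bsub>?B\<^esub>}"
      using g(6) e zero[of "e \<otimes> e \<ominus> e"] by (simp add: minus)
    show "finite (?q ` U)" "?q ` U \<subseteq> ?q ` J" using g(8,9) by auto
  next
    fix z assume "z \<in> carrier ?B"
    then obtain x where x: "x \<in> carrier R" "z = ?q x" using surj by auto
    from g(7)[OF x(1)] consider "e \<otimes> x \<otimes> e \<in> I" | y where "y \<in> carrier R" "e \<otimes> x \<otimes> e \<otimes> y \<otimes> e \<ominus> e \<in> I"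
      by blast
    then show "?q e \<otimes>\<^bsub>?B\<^esub> z \<otimes>\<^bsub>?B\<^esub> ?q e \<in> {\<zero>\<^bsub>?B\<^esub>} \<or>
      (\<exists>y\<in>carrier ?B. (?q e \<otimes>\<^bsub>?B\<^esub> z \<otimes>\<^bsub>?B\<^esub> ?q e \<otimes>\<^bsub>?B\<^esub> y \<otimes>\<^bsub>?B\<^esub> ?q e) \<ominus>\<^bsub>?B\<^esub> ?q e \<in> {\<zero>\<^bsub>?B\<^esub>})"
    proof cases
      case 1
      then show ?thesis using zero[of "e \<otimes> x \<otimes> e"] e x by auto
    next
      case 2
      then have "(?q e \<otimes>\<^bsub>?B\<^esub> z \<otimes>\<^bsub>?B\<^esub> ?q e \<otimes>\<^bsub>?B\<^esub> ?q y \<otimes>\<^bsub>?B\<^esub> ?q e) \<ominus>\<^bsub>?B\<^esub> ?q e \<in> {\<zero>\<^bsub>?B\<^esub>}"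
        using zero[of "e \<otimes> x \<otimes> e \<otimes> y \<otimes> e \<ominus> e"] e x by (simp add: minus)
      then show ?thesis using 2(1) by auto
    qed
  next
    fix v assume "v \<in> ?q ` U"
    then obtain u where u: "u \<in> U" "v = ?q u" by auto
    then show "(v \<otimes>\<^bsub>?B\<^esub> ?q e) \<ominus>\<^bsub>?B\<^esub> v \<in> {\<zero>\<^bsub>?B\<^esub>}"
      using g(10) e U zero[of "u \<otimes> e \<ominus> u"] by (auto simp: minus subset_iff)
  next
    fix N assume N: "right_ideal N ?B" "?q ` U \<subseteq> N"
    note Nd = right_idealD[OF N(1) q.S.ring_axioms]
    have "right_ideal {x \<in> carrier R. ?q x \<in> N} R"
    proof (rule right_idealI)
      show "\<zero> \<in> {x \<in> carrier R. ?q x \<in> N}" using Nd(2) by simp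
      fix x assume "x \<in> {x \<in> carrier R. ?q x \<in> N}"
      then have x: "x \<in> carrier R" "?q x \<in> N" by auto
      { fix y assume "y \<in> {x \<in> carrier R. ?q x \<in> N}"
        then have y: "y \<in> carrier R" "?q y \<in> N" by auto
        show "x \<oplus> y \<in> {x \<in> carrier R. ?q x \<in> N}" using Nd(3)[OF x(2) y(2)] x y by simp }
      fix a assume a: "a \<in> carrier R"
      show "x \<otimes> a \<in> {x \<in> carrier R. ?q x \<in> N}"
        using Nd(5)[OF x(2) q.hom_closed[OF a]] x a by simp
    qed (rule ring_axioms, blast)
    moreover have "I \<subseteq> {x \<in> carrier R. ?q x \<in> N}"
    proof
      fix x assume x: "x \<in> I"
      then have "?q x = \<zero>\<^bsub>?B\<^esub>" using zero[of x] I.a_subset by blast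
      then show "x \<in> {x \<in> carrier R. ?q x \<in> N}" using Nd(2) x I.a_subset by auto
    qed
    moreover have "U \<subseteq> {x \<in> carrier R. ?q x \<in> N}" using U N(2) by auto
    ultimately show "?q ` J \<subseteq> N" using g(11) by blast
  next
    fix b v
    assume b: "b \<in> ?q ` U \<rightarrow> carrier ?B"
      and sum: "(\<Oplus>\<^bsub>?B\<^esub>u\<in>?q ` U. u \<otimes>\<^bsub>?B\<^esub> b u) \<in> {\<zero>\<^bsub>?B\<^esub>}" and v: "v \<in> ?q ` U"
    have "\<forall>u\<in>U. \<exists>x\<in>carrier R. b (?q u) = ?q x" using surj b by (meson Pi_mem imageI)
    then have "\<exists>c. \<forall>u\<in>U. c u \<in> carrier R \<and> b (?q u) = ?q (c u)" unfolding Bex_def by (rule bchoice)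
    then obtain c where c: "\<forall>u\<in>U. c u \<in> carrier R \<and> b (?q u) = ?q (c u)" ..
    have cc: "(\<lambda>u. u \<otimes> c u) \<in> U \<rightarrow> carrier R" using c U by auto
    have qc: "(\<lambda>u. ?q (u \<otimes> c u)) \<in> U \<rightarrow> carrier ?B" using cc q.hom_closed by (simp only: Pi_iff) blast
    have bc: "?q u \<otimes>\<^bsub>?B\<^esub> b (?q u) = ?q (u \<otimes> c u)" if "u \<in> U" for u
      using that c U by (auto simp: subset_iff)
    have "?q (\<Oplus>u\<in>U. u \<otimes> c u) = (\<Oplus>\<^bsub>?B\<^esub>u\<in>U. ?q (u \<otimes> c u))"
      using cc by (intro additive_map_finsum) (auto intro: abelian_group_axioms q.S.abelian_group_axioms)
    also have "\<dots> = (\<Oplus>\<^bsub>?B\<^esub>u\<in>U. ?q u \<otimes>\<^bsub>?B\<^esub> b (?q u))"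
      using bc qc by (intro q.S.finsum_cong') auto
    also have "\<dots> = (\<Oplus>\<^bsub>?B\<^esub>u\<in>?q ` U. u \<otimes>\<^bsub>?B\<^esub> b u)"
      using inj b U by (intro q.S.finsum_reindex[symmetric]) (auto simp: Pi_iff subset_iff)
    finally have "(\<Oplus>u\<in>U. u \<otimes> c u) \<in> I" using zero[of "\<Oplus>u\<in>U. u \<otimes> c u"] sum cc by auto
    then have *: "\<forall>u\<in>U. e \<otimes> c u \<in> I" using g(12)[of c] c by (auto simp: Pi_iff)
    obtain u where u: "u \<in> U" "v = ?q u" using v by auto
    have "?q (e \<otimes> c u) = \<zero>\<^bsub>?B\<^esub>" using zero[of "e \<otimes> c u"] * u c e by auto
    then show "?q e \<otimes>\<^bsub>?B\<^esub> b v \<in> {\<zero>\<^bsub>?B\<^esub>}" using c u e by auto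
  qed
qed

text \<open>
  \<open>J\<^sup>2 = J\<close> holds since \<open>u = u e\<close>, and \<open>J\<close> is projective as a direct sum of copies of the direct summand
  \<open>e R\<close> of \<open>R\<close>. For \<open>J rad(R) J = 0\<close> it suffices that \<open>e b r b' e = 0\<close> for \<open>r\<close> in the radical.
  The elements \<open>z\<close> with \<open>e b z R e = 0\<close> form a right ideal, and because the corner \<open>e R e\<close> is a division ring
  this right ideal is maximal unless it is all of \<open>R\<close>; in both cases it contains the radical.
\<close>

lemma heredity_generators_zero_imp_heredity_ideal:
  fixes R (structure)
  assumes R: "ring R" and gen: "heredity_generators R {\<zero>} J e U"
  shows "heredity_ideal J R"
proof -
  interpret ring R by fact
  note g = heredity_generatorsD[OF gen]
  interpret J: ideal J R by (rule g(2))
  have Jc: "x \<in> carrier R" if "x \<in> J" for x using that J.a_subset by auto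
  have e: "e \<in> carrier R" "e \<noteq> \<zero>" using g(4,5) Jc by auto
  have U: "u \<in> carrier R" "u \<in> J" if "u \<in> U" for u using that g(9) Jc by auto
  have Uc: "U \<subseteq> carrier R" using U by auto
  have ee: "e \<otimes> e = e" using g(6) e by (simp add: minus_eq_zero_iff)
  have ue: "u \<otimes> e = u" if "u \<in> U" for u using g(10)[OF that] U[OF that] e by (simp add: minus_eq_zero_iff)
  have div: "e \<otimes> x \<otimes> e = \<zero> \<or> (\<exists>y\<in>carrier R. e \<otimes> x \<otimes> e \<otimes> y \<otimes> e = e)" if "x \<in> carrier R" for x
    using g(7)[OF that] e that by (auto simp: minus_eq_zero_iff)
  have J_least: "x \<in> N" if "right_ideal N R" "U \<subseteq> N" "x \<in> J" for x N
    using g(11)[of N] that right_idealD(2)[OF that(1) R] by auto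
  let ?rad = "jacobson_radical R"
  have rad: "r \<in> carrier R" if "r \<in> ?rad" for r using that by (simp add: jacobson_radical_def)

  have JJ: "ideal_prod R J J = J"
  proof
    show "ideal_prod R J J \<subseteq> J" using ideal_prod_inter[OF g(2) g(2)] by auto
    have "right_ideal (ideal_prod R J J) R"
      by (intro ideal_is_right_ideal ideal_prod_is_ideal g(2))
    moreover have "U \<subseteq> ideal_prod R J J"
    proof
      fix u assume u: "u \<in> U"
      then have "u \<otimes> e \<in> ideal_prod R J J" using U g(4) by (intro ideal_prod.prod) auto
      then show "u \<in> ideal_prod R J J" using ue[OF u] by simp
    qed
    ultimately show "J \<subseteq> ideal_prod R J J" using J_least by blast
  qed

  have ezero: "e \<otimes> b \<otimes> r \<otimes> b' \<otimes> e = \<zero>"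
    if r: "r \<in> ?rad" and b: "b \<in> carrier R" "b' \<in> carrier R" for r b b'
  proof -
    define N where "N = {z \<in> carrier R. \<forall>c\<in>carrier R. e \<otimes> b \<otimes> z \<otimes> c \<otimes> e = \<zero>}"
    have N: "right_ideal N R"
    proof (rule right_idealI)
      fix z a assume z: "z \<in> N" and a: "a \<in> carrier R"
      have "e \<otimes> b \<otimes> (z \<otimes> a) \<otimes> c \<otimes> e = e \<otimes> b \<otimes> z \<otimes> (a \<otimes> c) \<otimes> e" if "c \<in> carrier R" for c
        using z a e b that by (auto simp: N_def m_assoc)
      then show "z \<otimes> a \<in> N" using z a by (auto simp: N_def)
    qed (use e b in \<open>auto simp: N_def R l_distr r_distr\<close>)
    have "r \<in> N"
    proof (rule ccontr)
      assume rN: "r \<notin> N"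
      have "maximal_right_ideal N R"
        unfolding maximal_right_ideal_def
      proof (intro conjI allI impI; (elim conjE)?)
        show "right_ideal N R" by (rule N)
        show "N \<noteq> carrier R" using rN rad r by auto
        fix N' assume N': "right_ideal N' R" "N \<subseteq> N'"
        note d = right_idealD[OF N'(1) R]
        show "N' = N \<or> N' = carrier R"
        proof (rule ccontr)
          assume "\<not> (N' = N \<or> N' = carrier R)"
          then obtain z where z: "z \<in> N'" "z \<notin> N" and nt: "N' \<noteq> carrier R" using N'(2) by auto
          have zc: "z \<in> carrier R" using z(1) d(1) by auto
          then obtain c where c: "c \<in> carrier R" "e \<otimes> b \<otimes> z \<otimes> c \<otimes> e \<noteq> \<zero>"
            using z by (auto simp: N_def)
          then obtain y where y: "y \<in> carrier R" "e \<otimes> (b \<otimes> z \<otimes> c) \<otimes> e \<otimes> y \<otimes> e = e"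
            using div[of "b \<otimes> z \<otimes> c"] b zc e by (auto simp: m_assoc)
          \<comment> \<open>With \<open>y\<close> inverting the nonzero corner element, \<open>e b z w = e b\<close>; hence \<open>1 - z w\<close> lies in \<open>N\<close>, and any
            right ideal containing \<open>N\<close> and \<open>z\<close> contains \<open>1\<close>.\<close>
          let ?w = "c \<otimes> e \<otimes> y \<otimes> e \<otimes> b"
          have w: "?w \<in> carrier R" using c y e b by auto
          have "e \<otimes> b \<otimes> (\<one> \<ominus> z \<otimes> ?w) = e \<otimes> b \<ominus> e \<otimes> (b \<otimes> z \<otimes> c) \<otimes> e \<otimes> y \<otimes> e \<otimes> b"
            using c y(1) e b zc by (simp add: a_minus_def r_distr r_minus m_assoc)
          also have "\<dots> = \<zero>" using y(2) e b by (simp add: a_minus_def r_neg)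
          finally have "\<one> \<ominus> z \<otimes> ?w \<in> N" using w zc e by (auto simp: N_def)
          then have "\<one> \<ominus> z \<otimes> ?w \<in> N'" using N' by auto
          moreover have "z \<otimes> ?w \<in> N'" using d(5)[OF z(1) w] .
          ultimately have "(\<one> \<ominus> z \<otimes> ?w) \<oplus> z \<otimes> ?w \<in> N'" by (rule d(3))
          also have "(\<one> \<ominus> z \<otimes> ?w) \<oplus> z \<otimes> ?w = \<one>" using w zc by (simp add: a_minus_def a_assoc l_neg)
          finally have "carrier R \<subseteq> N'" using d(5)[of \<one>] by auto
          with nt d(1) show False by auto
        qed
      qed
      then show False using rN r by (auto simp: jacobson_radical_def)
    qed
    then show ?thesis using b by (auto simp: N_def)
  qed

  have xre: "x \<otimes> r \<otimes> c \<otimes> e = \<zero>" if x: "x \<in> J" and r: "r \<in> ?rad" and c: "c \<in> carrier R" for x r c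
  proof -
    let ?N = "{x \<in> carrier R. \<forall>a\<in>carrier R. x \<otimes> a \<otimes> r \<otimes> c \<otimes> e = \<zero>}"
    have "right_ideal ?N R"
    proof (rule right_idealI)
      fix z b assume z: "z \<in> ?N" and b: "b \<in> carrier R"
      have "z \<otimes> b \<otimes> a \<otimes> r \<otimes> c \<otimes> e = z \<otimes> (b \<otimes> a) \<otimes> r \<otimes> c \<otimes> e" if "a \<in> carrier R" for a
        using z b that by (auto simp: m_assoc)
      then show "z \<otimes> b \<in> ?N" using z b by auto
    qed (use e c rad[OF r] in \<open>auto simp: R l_distr\<close>)
    moreover have "U \<subseteq> ?N"
    proof
      fix u assume u: "u \<in> U"
      have "u \<otimes> a \<otimes> r \<otimes> c \<otimes> e = \<zero>" if a: "a \<in> carrier R" for a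
      proof -
        have "u \<otimes> a \<otimes> r \<otimes> c \<otimes> e = u \<otimes> (e \<otimes> a \<otimes> r \<otimes> c \<otimes> e)"
          using ue[OF u, symmetric] U(1)[OF u] a e c rad[OF r] by (metis m_assoc m_closed)
        then show ?thesis using ezero[OF r a c] U(1)[OF u] by simp
      qed
      then show "u \<in> ?N" using U(1)[OF u] by auto
    qed
    ultimately have "x \<in> ?N" using x J_least by blast
    then have "x \<otimes> \<one> \<otimes> r \<otimes> c \<otimes> e = \<zero>" by blast
    then show ?thesis using Jc[OF x] by simp
  qed
  have xry: "x \<otimes> r \<otimes> y = \<zero>" if x: "x \<in> J" and r: "r \<in> ?rad" and y: "y \<in> J" for x r y
  proof -
    let ?N = "{y \<in> carrier R. x \<otimes> r \<otimes> y = \<zero>}"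
    have "right_ideal ?N R"
      using rad[OF r] Jc[OF x] by (intro right_idealI) (auto simp: R r_distr m_assoc[symmetric])
    moreover have "U \<subseteq> ?N"
    proof
      fix u assume u: "u \<in> U"
      have "x \<otimes> r \<otimes> u = x \<otimes> r \<otimes> (u \<otimes> e)" using ue[OF u] by simp
      also have "\<dots> = x \<otimes> r \<otimes> u \<otimes> e"
        using U(1)[OF u] rad[OF r] Jc[OF x] e by (simp add: m_assoc)
      also have "\<dots> = \<zero>" using xre[OF x r U(1)[OF u]] .
      finally show "u \<in> ?N" using U(1)[OF u] by simp
    qed
    ultimately show ?thesis using y J_least by blast
  qed
  have JRc: "z \<in> carrier R \<and> (\<forall>y\<in>J. z \<otimes> y = \<zero>)" if "z \<in> ideal_prod R J ?rad" for z
    using that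
  proof induction
    case (prod i j) then show ?case using xry Jc rad by auto
  next
    case (sum s t) then show ?case using Jc by (auto simp: l_distr)
  qed
  have prod0: "z = \<zero>" if "z \<in> ideal_prod R (ideal_prod R J ?rad) J" for z
    using that
  proof induction
    case (prod i j) then show ?case using JRc by blast
  next
    case (sum s t) then show ?case by simp
  qed
  have "\<zero> \<in> ideal_prod R (ideal_prod R J ?rad) J"
  proof -
    have rad0: "\<zero> \<in> ?rad"
      by (auto simp: jacobson_radical_def maximal_right_ideal_def right_idealD(2)[OF _ R])
    then have "\<zero> \<otimes> \<zero> \<in> ideal_prod R J ?rad" using rad0 J.zero_closed by (intro ideal_prod.prod)
    then have "\<zero> \<otimes> \<zero> \<otimes> \<zero> \<in> ideal_prod R (ideal_prod R J ?rad) J"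
      using J.zero_closed by (rule ideal_prod.prod)
    then show ?thesis by simp
  qed
  then have Jrad: "ideal_prod R (ideal_prod R J ?rad) J = {\<zero>}" using prod0 by blast

  let ?P = "right_ideal_module R J" and ?F = "free_right_module R U"
  have P: "right_module R ?P"
  proof (intro right_module.intro right_module_axioms.intro R)
    show "abelian_group ?P"
    proof (rule abelian_groupI)
      fix x assume x: "x \<in> carrier ?P"
      then have "\<ominus> x \<in> J" "\<ominus> x \<oplus> x = \<zero>" by (auto simp: right_ideal_module_def Jc l_neg)
      then show "\<exists>y\<in>carrier ?P. y \<oplus>\<^bsub>?P\<^esub> x = \<zero>\<^bsub>?P\<^esub>" by (auto simp: right_ideal_module_def)
    qed (auto simp: right_ideal_module_def Jc a_ac)
  qed (auto simp: right_ideal_module_def Jc J.I_r_closed l_distr r_distr m_assoc)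

  \<comment> \<open>\<open>E\<close> is the direct sum of copies of \<open>e R\<close>, a summand of the free module; \<open>S\<close> maps it
    isomorphically onto \<open>J\<close>, and its inverse \<open>f\<close> is the section that makes \<open>J\<close> projective.\<close>
  define S where "S v = (\<Oplus>u\<in>U. u \<otimes> v u)" for v
  define E where "E = {v. (\<forall>u\<in>U. v u \<in> carrier R \<and> e \<otimes> v u = v u) \<and> (\<forall>u. u \<notin> U \<longrightarrow> v u = \<zero>)}"
  have Spi: "(\<lambda>u. u \<otimes> v u) \<in> U \<rightarrow> carrier R" if "\<forall>u\<in>U. v u \<in> carrier R" for v using that U by auto
  have SJ: "S v \<in> J" if "\<forall>u\<in>U. v u \<in> carrier R" for v
    unfolding S_def using that J.a_subset U by (intro finsum_mem) (auto intro: J.I_r_closed)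
  have Sadd: "S (\<lambda>u. v u \<oplus> w u) = S v \<oplus> S w"
    if "\<forall>u\<in>U. v u \<in> carrier R" "\<forall>u\<in>U. w u \<in> carrier R" for v w
  proof -
    have "S (\<lambda>u. v u \<oplus> w u) = (\<Oplus>u\<in>U. u \<otimes> v u \<oplus> u \<otimes> w u)"
      unfolding S_def using that U by (intro finsum_cong') (auto simp: r_distr)
    then show ?thesis unfolding S_def using finsum_addf[OF Spi[OF that(1)] Spi[OF that(2)]] by simp
  qed
  have Smult: "S (\<lambda>u. v u \<otimes> a) = S v \<otimes> a" if "\<forall>u\<in>U. v u \<in> carrier R" "a \<in> carrier R" for v a
  proof -
    have "S v \<otimes> a = (\<Oplus>u\<in>U. u \<otimes> v u \<otimes> a)"
      unfolding S_def using Spi[OF that(1)] that g(8) by (intro finsum_ldistr)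
    then show ?thesis unfolding S_def using that U by (auto simp: m_assoc intro!: finsum_cong')
  qed
  have Ec: "\<forall>u\<in>U. v u \<in> carrier R" if "v \<in> E" for v using that by (auto simp: E_def)
  have Eadd: "(\<lambda>u. v u \<oplus> w u) \<in> E" if "v \<in> E" "w \<in> E" for v w
    using that e by (auto simp: E_def r_distr)
  have Emult: "(\<lambda>u. v u \<otimes> a) \<in> E" if "v \<in> E" "a \<in> carrier R" for v a
    using that e by (auto simp: E_def m_assoc[symmetric])
  have uniq: "v = w" if vw: "v \<in> E" "w \<in> E" "S v = S w" for v w
  proof -
    let ?d = "\<lambda>u. v u \<oplus> w u \<otimes> \<ominus> \<one>"
    have d: "?d \<in> E" using Eadd[OF vw(1) Emult[OF vw(2), of "\<ominus> \<one>"]] by simp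
    have "S ?d = S v \<oplus> S w \<otimes> \<ominus> \<one>"
      using Sadd[of v "\<lambda>u. w u \<otimes> \<ominus> \<one>"] Smult[of w "\<ominus> \<one>"] vw Ec by auto
    also have "\<dots> = \<zero>"
      using vw(3) SJ[OF Ec[OF vw(2)]] Jc by (simp add: r_minus r_neg)
    finally have "e \<otimes> ?d u = \<zero>" if "u \<in> U" for u
      using g(12)[of ?d u] Ec[OF d] that by (auto simp: S_def)
    then have "?d u = \<zero>" if "u \<in> U" for u using d that by (auto simp: E_def)
    then have "v u = w u" if "u \<in> U" for u
      using Ec[OF vw(1)] Ec[OF vw(2)] that by (metis r_minus r_one one_closed add.inv_closed a_minus_def minus_eq_zero_iff)
    then have "v u = w u" for u using vw by (cases "u \<in> U") (auto simp: E_def)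
    then show ?thesis ..
  qed
  have exist: "\<exists>v\<in>E. S v = x" if "x \<in> J" for x
  proof -
    have "right_ideal (S ` E) R"
    proof (rule right_idealI)
      show "S ` E \<subseteq> carrier R" using SJ Ec Jc by blast
      have "(\<lambda>u. \<zero>) \<in> E" using e by (auto simp: E_def)
      moreover have "S (\<lambda>u. \<zero>) = \<zero>" unfolding S_def using U by (intro add.finprod_one_eqI) auto
      ultimately show "\<zero> \<in> S ` E" by (metis imageI)
      fix x assume "x \<in> S ` E"
      then obtain v where v: "v \<in> E" "x = S v" by auto
      { fix y assume "y \<in> S ` E"
        then obtain w where w: "w \<in> E" "y = S w" by auto
        show "x \<oplus> y \<in> S ` E"
          using Sadd[OF Ec[OF v(1)] Ec[OF w(1)]] Eadd[OF v(1) w(1)] v(2) w(2) by (metis imageI) }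
      { fix a assume a: "a \<in> carrier R"
        show "x \<otimes> a \<in> S ` E"
          using Smult[OF Ec[OF v(1)] a] Emult[OF v(1) a] v(2) by (metis imageI) }
    qed (rule R)
    moreover have "U \<subseteq> S ` E"
    proof
      fix u assume u: "u \<in> U"
      let ?v = "\<lambda>w. if w = u then e else \<zero>"
      have "S ?v = (\<Oplus>w\<in>{u}. w \<otimes> ?v w)"
        unfolding S_def using u U e g(8) by (intro add.finprod_mono_neutral_cong_right) auto
      also have "\<dots> = u" using u U e ue by simp
      finally have "S ?v = u" .
      moreover have "?v \<in> E" using u e ee by (auto simp: E_def)
      ultimately show "u \<in> S ` E" by (metis imageI)
    qed
    ultimately have "x \<in> S ` E" using that J_least by blast
    then show ?thesis by auto
  qed
  define f where "f x = (THE v. v \<in> E \<and> S v = x)" for x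
  have f: "f x \<in> E" "S (f x) = x" if "x \<in> J" for x
  proof -
    have "\<exists>!v. v \<in> E \<and> S v = x" using exist[OF that] uniq by blast
    from theI'[OF this] show "f x \<in> E" "S (f x) = x" by (auto simp: f_def)
  qed
  have fI: "f (S v) = v" if "v \<in> E" for v using f[of "S v"] SJ[OF Ec[OF that]] uniq that by auto
  have "projective_right_module R ?P"
    unfolding projective_right_module_def
  proof (intro conjI exI)
    show "right_module R ?P" by (rule P)
    show "f \<in> right_module_hom R ?P ?F"
      unfolding right_module_hom_def
    proof (intro CollectI conjI ballI)
      have "finite {u. v u \<noteq> \<zero>}" if "v \<in> E" for v
        using that by (intro finite_subset[OF _ g(8)]) (auto simp: E_def)
      then have "E \<subseteq> fin_supp R U" by (auto simp: E_def fin_supp_def)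
      then show "f \<in> carrier ?P \<rightarrow> carrier ?F"
        using f by (auto simp: right_ideal_module_def free_right_module_def)
      fix x assume "x \<in> carrier ?P"
      then have x: "x \<in> J" by (simp add: right_ideal_module_def)
      { fix y assume "y \<in> carrier ?P"
        then have y: "y \<in> J" by (simp add: right_ideal_module_def)
        have "f (S (\<lambda>u. f x u \<oplus> f y u)) = (\<lambda>u. f x u \<oplus> f y u)"
          using f x y by (intro fI Eadd) auto
        then show "f (x \<oplus>\<^bsub>?P\<^esub> y) = f x \<oplus>\<^bsub>?F\<^esub> f y"
          using Sadd[OF Ec Ec, OF f(1) f(1), OF x y] f(2)[OF x] f(2)[OF y]
          by (simp add: right_ideal_module_def free_right_module_def) }
    next
      fix a x assume a: "a \<in> carrier R" and "x \<in> carrier ?P"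
      then have x: "x \<in> J" by (simp add: right_ideal_module_def)
      have "f (S (\<lambda>u. f x u \<otimes> a)) = (\<lambda>u. f x u \<otimes> a)"
        using f x a by (intro fI Emult) auto
      then show "f (a \<odot>\<^bsub>?P\<^esub> x) = a \<odot>\<^bsub>?F\<^esub> f x"
        using Smult[OF Ec, OF f(1) a, OF x] f(2)[OF x]
        by (simp add: right_ideal_module_def free_right_module_def)
    qed
    show "S \<in> right_module_hom R ?F ?P"
      using SJ Sadd Smult
      by (auto simp: right_module_hom_def right_ideal_module_def free_right_module_def fin_supp_def)
    show "\<forall>x\<in>carrier ?P. S (f x) = x" using f by (simp add: right_ideal_module_def)
  qed
  then show ?thesis unfolding heredity_ideal_def using g(2) JJ Jrad by simp
qed

definition heredity_step :: "('a, 'x) ring_scheme \<Rightarrow> 'a set \<Rightarrow> 'a set \<Rightarrow> bool" where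
  "heredity_step R I J \<longleftrightarrow> ideal I R \<and> ideal J R \<and> I \<subset> J \<and>
     heredity_ideal ((\<lambda>x. I +>\<^bsub>R\<^esub> x) ` J) (R Quot I)"

lemma heredity_layer_imp_step:
  assumes "ring R" "heredity_layer R I J"
  shows "heredity_step R I J"
proof -
  obtain e U where gen: "heredity_generators R I J e U" using assms(2) by (auto simp: heredity_layer_def)
  note g = heredity_generatorsD[OF gen]
  have "ring (R Quot I)" by (rule ideal.quotient_is_ring[OF g(1)])
  from heredity_generators_zero_imp_heredity_ideal[OF this heredity_generators_quotient[OF assms(1) gen]]
  show ?thesis using g(1-5) by (auto simp: heredity_step_def)
qed

lemma quasi_hereditary_if_layers:
  assumes R: "ring R" and chain: "(heredity_layer R)\<^sup>*\<^sup>* {\<zero>\<^bsub>R\<^esub>} (carrier R)"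
  shows "quasi_hereditary R"
proof -
  interpret ring R by fact
  from chain obtain n where "(heredity_layer R ^^ n) {\<zero>\<^bsub>R\<^esub>} (carrier R)"
    by (auto simp: rtranclp_power)
  then obtain I where I: "I 0 = {\<zero>\<^bsub>R\<^esub>}" "I n = carrier R" "\<forall>i<n. heredity_layer R (I i) (I (Suc i))"
    by (auto simp: relpowp_fun_conv)
  then have step: "\<forall>i<n. heredity_step R (I i) (I (Suc i))" using heredity_layer_imp_step[OF R] by auto
  have "ideal (I i) R" if "i \<le> n" for i
  proof (cases "i = n")
    case True then show ?thesis using I(2) oneideal by simp
  next
    case False then show ?thesis using step that by (auto simp: heredity_step_def)
  qed
  then show ?thesis
    using I(1,2) step R unfolding quasi_hereditary_def heredity_step_def by (intro conjI exI[of _ n] exI[of _ I]) auto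
qed

section \<open>Coordinates with respect to a finite basis\<close>

context assoc_algebra
begin

lemma K_abelian_group: "abelian_group K"
  by (rule ring.is_abelian_group[OF ring_axioms])

lemma K_abelian_monoid: "abelian_monoid K"
  by (rule abelian_group.axioms[OF K_abelian_group])

lemmas K_minus_eq_zero_iff = abelian_group.minus_eq_zero_iff[OF K_abelian_group]
lemmas K_finsum_all_zero = abelian_monoid.finsum_all_zero[OF K_abelian_monoid]
lemmas K_finsum_single = abelian_monoid.finsum_single[OF K_abelian_monoid]
lemmas K_r_neg = abelian_group.r_neg[OF K_abelian_group]

text \<open>
  Right ideals are subspaces because \<open>c x = x (c 1)\<close>.
\<close>

lemma right_ideal_smult:
  assumes "right_ideal N A" "c \<in> carrier K" "x \<in> N"
  shows "c \<odot>\<^bsub>A\<^esub> x \<in> N"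
proof -
  note Nd = right_idealD[OF assms(1) A.ring_axioms]
  have xc: "x \<in> carrier A" using assms(3) Nd(1) by auto
  have "x \<otimes>\<^bsub>A\<^esub> (c \<odot>\<^bsub>A\<^esub> \<one>\<^bsub>A\<^esub>) \<in> N" using assms by (intro Nd(5)) auto
  then show ?thesis using smult_mult_right[OF assms(2) xc, of "\<one>\<^bsub>A\<^esub>"] xc by simp
qed

end

locale finite_basis = assoc_algebra K A for K (structure) and A (structure) +
  fixes S :: "'c set"
  assumes finite_S: "finite S" and basis: "is_basis K A S"
begin

lemma S_carrier: "b \<in> S \<Longrightarrow> b \<in> carrier A"
  using basis by (auto simp: is_basis_def)

text \<open>
  Requiring the coefficient function to vanish outside \<open>S\<close> makes it unique.
\<close>

definition crd :: "'c \<Rightarrow> 'c \<Rightarrow> 'a" where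
  "crd x = (THE c. c \<in> S \<rightarrow> carrier K \<and> (\<forall>b. b \<notin> S \<longrightarrow> c b = \<zero>) \<and> (\<Oplus>\<^bsub>A\<^esub>b\<in>S. c b \<odot>\<^bsub>A\<^esub> b) = x)"

lemma lincomb_extend:
  assumes "F \<subseteq> S" "c \<in> F \<rightarrow> carrier K"
  shows "(\<Oplus>\<^bsub>A\<^esub>b\<in>F. c b \<odot>\<^bsub>A\<^esub> b) = (\<Oplus>\<^bsub>A\<^esub>b\<in>S. (if b \<in> F then c b else \<zero>) \<odot>\<^bsub>A\<^esub> b)"
  using assms S_carrier finite_S
  by (intro M.add.finprod_mono_neutral_cong_left) (auto simp: subset_iff Pi_iff)

lemma lincomb_inj:
  assumes c: "c \<in> S \<rightarrow> carrier K" and d: "d \<in> S \<rightarrow> carrier K" and b: "b \<in> S"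
    and eq: "(\<Oplus>\<^bsub>A\<^esub>b\<in>S. c b \<odot>\<^bsub>A\<^esub> b) = (\<Oplus>\<^bsub>A\<^esub>b\<in>S. d b \<odot>\<^bsub>A\<^esub> b)"
  shows "c b = d b"
proof -
  let ?d = "\<lambda>b. c b \<oplus> (\<ominus> \<one>) \<otimes> d b"
  have cd: "c b \<in> carrier K" "d b \<in> carrier K" if "b \<in> S" for b using that c d by auto
  have tc: "(\<lambda>b. c b \<odot>\<^bsub>A\<^esub> b) \<in> S \<rightarrow> carrier A" "(\<lambda>b. d b \<odot>\<^bsub>A\<^esub> b) \<in> S \<rightarrow> carrier A"
    "(\<lambda>b. \<ominus> \<one> \<odot>\<^bsub>A\<^esub> (d b \<odot>\<^bsub>A\<^esub> b)) \<in> S \<rightarrow> carrier A"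
    using S_carrier cd by auto
  have "(\<Oplus>\<^bsub>A\<^esub>b\<in>S. ?d b \<odot>\<^bsub>A\<^esub> b) = (\<Oplus>\<^bsub>A\<^esub>b\<in>S. c b \<odot>\<^bsub>A\<^esub> b \<oplus>\<^bsub>A\<^esub> \<ominus> \<one> \<odot>\<^bsub>A\<^esub> (d b \<odot>\<^bsub>A\<^esub> b))"
  proof (rule M.finsum_cong')
    fix b assume "b \<in> S"
    then show "?d b \<odot>\<^bsub>A\<^esub> b = c b \<odot>\<^bsub>A\<^esub> b \<oplus>\<^bsub>A\<^esub> \<ominus> \<one> \<odot>\<^bsub>A\<^esub> (d b \<odot>\<^bsub>A\<^esub> b)"
      using cd S_carrier by (subst smult_l_distr) (auto simp: smult_assoc1[symmetric])
  qed (use cd S_carrier in auto)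
  also have "\<dots> = (\<Oplus>\<^bsub>A\<^esub>b\<in>S. c b \<odot>\<^bsub>A\<^esub> b) \<oplus>\<^bsub>A\<^esub> (\<Oplus>\<^bsub>A\<^esub>b\<in>S. \<ominus> \<one> \<odot>\<^bsub>A\<^esub> (d b \<odot>\<^bsub>A\<^esub> b))"
    using tc by (intro M.finsum_addf) auto
  also have "(\<Oplus>\<^bsub>A\<^esub>b\<in>S. \<ominus> \<one> \<odot>\<^bsub>A\<^esub> (d b \<odot>\<^bsub>A\<^esub> b)) = \<ominus> \<one> \<odot>\<^bsub>A\<^esub> (\<Oplus>\<^bsub>A\<^esub>b\<in>S. d b \<odot>\<^bsub>A\<^esub> b)"
    using tc finite_S by (intro finsum_smult_ldistr[symmetric]) auto
  also have "\<dots> = \<ominus>\<^bsub>A\<^esub> (\<Oplus>\<^bsub>A\<^esub>b\<in>S. d b \<odot>\<^bsub>A\<^esub> b)"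
    using tc by (simp add: smult_l_minus)
  finally have "(\<Oplus>\<^bsub>A\<^esub>b\<in>S. ?d b \<odot>\<^bsub>A\<^esub> b) = \<zero>\<^bsub>A\<^esub>"
    using tc eq by (simp add: M.r_neg)
  moreover have "?d \<in> S \<rightarrow> carrier K" using cd by auto
  ultimately have "?d b = \<zero>"
    using basis finite_S b unfolding is_basis_def linearly_independent_def by blast
  then have "c b \<ominus> d b = \<zero>" using cd[OF b] by (simp add: a_minus_def l_minus)
  then show ?thesis using cd[OF b] by (simp add: K_minus_eq_zero_iff)
qed

lemma crd_lincomb:
  assumes c: "c \<in> S \<rightarrow> carrier K" and b: "b \<in> S"
  shows "crd (\<Oplus>\<^bsub>A\<^esub>b\<in>S. c b \<odot>\<^bsub>A\<^esub> b) b = c b"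
proof -
  let ?c = "\<lambda>b. if b \<in> S then c b else \<zero>"
  have sum: "(\<Oplus>\<^bsub>A\<^esub>b\<in>S. ?c b \<odot>\<^bsub>A\<^esub> b) = (\<Oplus>\<^bsub>A\<^esub>b\<in>S. c b \<odot>\<^bsub>A\<^esub> b)"
    using lincomb_extend[OF _ c] by simp
  have "crd (\<Oplus>\<^bsub>A\<^esub>b\<in>S. c b \<odot>\<^bsub>A\<^esub> b) = ?c"
    unfolding crd_def
  proof (rule the_equality)
    show "?c \<in> S \<rightarrow> carrier K \<and> (\<forall>b. b \<notin> S \<longrightarrow> ?c b = \<zero>) \<and>
      (\<Oplus>\<^bsub>A\<^esub>b\<in>S. ?c b \<odot>\<^bsub>A\<^esub> b) = (\<Oplus>\<^bsub>A\<^esub>b\<in>S. c b \<odot>\<^bsub>A\<^esub> b)"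
      using c sum by auto
    fix d assume d: "d \<in> S \<rightarrow> carrier K \<and> (\<forall>b. b \<notin> S \<longrightarrow> d b = \<zero>) \<and>
      (\<Oplus>\<^bsub>A\<^esub>b\<in>S. d b \<odot>\<^bsub>A\<^esub> b) = (\<Oplus>\<^bsub>A\<^esub>b\<in>S. c b \<odot>\<^bsub>A\<^esub> b)"
    show "d = ?c"
    proof
      fix b show "d b = ?c b" using d c lincomb_inj[of d c b] by (cases "b \<in> S") auto
    qed
  qed
  then show ?thesis using b by simp
qed

lemma lincomb_exists:
  assumes "x \<in> carrier A"
  obtains c where "c \<in> S \<rightarrow> carrier K" "x = (\<Oplus>\<^bsub>A\<^esub>b\<in>S. c b \<odot>\<^bsub>A\<^esub> b)"
proof -
  have "x \<in> linear_span K A S" using assms basis by (simp add: is_basis_def)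
  then obtain F c where F: "F \<subseteq> S" "c \<in> F \<rightarrow> carrier K" "x = (\<Oplus>\<^bsub>A\<^esub>b\<in>F. c b \<odot>\<^bsub>A\<^esub> b)"
    by (auto simp: linear_span_def)
  with lincomb_extend[OF F(1,2)] show ?thesis
    by (intro that[of "\<lambda>b. if b \<in> F then c b else \<zero>"]) auto
qed

lemma crd_closed [simp]: "\<lbrakk>x \<in> carrier A; b \<in> S\<rbrakk> \<Longrightarrow> crd x b \<in> carrier K"
  by (elim lincomb_exists) (simp add: crd_lincomb Pi_iff)

lemma lincomb_crd: "x \<in> carrier A \<Longrightarrow> (\<Oplus>\<^bsub>A\<^esub>b\<in>S. crd x b \<odot>\<^bsub>A\<^esub> b) = x"
  using S_carrier by (elim lincomb_exists, simp) (intro M.finsum_cong', auto simp: crd_lincomb Pi_iff)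

lemma crd_add [simp]:
  assumes "x \<in> carrier A" "y \<in> carrier A" "b \<in> S"
  shows "crd (x \<oplus>\<^bsub>A\<^esub> y) b = crd x b \<oplus> crd y b"
proof -
  have tc: "(\<lambda>b. crd x b \<odot>\<^bsub>A\<^esub> b) \<in> S \<rightarrow> carrier A" "(\<lambda>b. crd y b \<odot>\<^bsub>A\<^esub> b) \<in> S \<rightarrow> carrier A"
    using assms S_carrier by auto
  have "(\<Oplus>\<^bsub>A\<^esub>b\<in>S. (crd x b \<oplus> crd y b) \<odot>\<^bsub>A\<^esub> b) = (\<Oplus>\<^bsub>A\<^esub>b\<in>S. crd x b \<odot>\<^bsub>A\<^esub> b \<oplus>\<^bsub>A\<^esub> crd y b \<odot>\<^bsub>A\<^esub> b)"
    using assms S_carrier by (intro M.finsum_cong') (auto simp: smult_l_distr)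
  also have "\<dots> = x \<oplus>\<^bsub>A\<^esub> y" using M.finsum_addf[OF tc] lincomb_crd assms by simp
  finally have "crd (x \<oplus>\<^bsub>A\<^esub> y) b = crd (\<Oplus>\<^bsub>A\<^esub>b\<in>S. (crd x b \<oplus> crd y b) \<odot>\<^bsub>A\<^esub> b) b" by simp
  also have "\<dots> = crd x b \<oplus> crd y b" using assms by (intro crd_lincomb) auto
  finally show ?thesis .
qed

lemma crd_smult [simp]:
  assumes "a \<in> carrier K" "x \<in> carrier A" "b \<in> S"
  shows "crd (a \<odot>\<^bsub>A\<^esub> x) b = a \<otimes> crd x b"
proof -
  have tc: "(\<lambda>b. crd x b \<odot>\<^bsub>A\<^esub> b) \<in> S \<rightarrow> carrier A"
    using assms S_carrier by auto
  have "(\<Oplus>\<^bsub>A\<^esub>b\<in>S. (a \<otimes> crd x b) \<odot>\<^bsub>A\<^esub> b) = (\<Oplus>\<^bsub>A\<^esub>b\<in>S. a \<odot>\<^bsub>A\<^esub> (crd x b \<odot>\<^bsub>A\<^esub> b))"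
    using assms S_carrier by (intro M.finsum_cong') (auto simp: smult_assoc1)
  also have "\<dots> = a \<odot>\<^bsub>A\<^esub> x"
    using finsum_smult_ldistr[OF finite_S assms(1) tc] lincomb_crd assms by simp
  finally have "crd (a \<odot>\<^bsub>A\<^esub> x) b = crd (\<Oplus>\<^bsub>A\<^esub>b\<in>S. (a \<otimes> crd x b) \<odot>\<^bsub>A\<^esub> b) b" by simp
  also have "\<dots> = a \<otimes> crd x b" using assms by (intro crd_lincomb) auto
  finally show ?thesis .
qed

lemma crd_zero [simp]: "b \<in> S \<Longrightarrow> crd \<zero>\<^bsub>A\<^esub> b = \<zero>"
  using crd_smult[of \<zero> "\<zero>\<^bsub>A\<^esub>" b] by simp

lemma crd_minus [simp]:
  "\<lbrakk>x \<in> carrier A; y \<in> carrier A; b \<in> S\<rbrakk> \<Longrightarrow> crd (x \<ominus>\<^bsub>A\<^esub> y) b = crd x b \<ominus> crd y b"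
  using crd_smult[of "\<ominus> \<one>" y b] by (simp add: a_minus_def smult_l_minus l_minus)

lemma crd_finsum:
  assumes "g \<in> I \<rightarrow> carrier A" "b \<in> S"
  shows "crd (\<Oplus>\<^bsub>A\<^esub>i\<in>I. g i) b = (\<Oplus>i\<in>I. crd (g i) b)"
  using assms by (intro additive_map_finsum) (auto intro: M.abelian_group_axioms K_abelian_group)

lemma crd_basis:
  assumes "d \<in> S" "b \<in> S"
  shows "crd d b = (if d = b then \<one> else \<zero>)"
proof -
  have "d = (\<Oplus>\<^bsub>A\<^esub>b\<in>{d}. \<one> \<odot>\<^bsub>A\<^esub> b)" using assms S_carrier by simp
  also have "\<dots> = (\<Oplus>\<^bsub>A\<^esub>b\<in>S. (if b \<in> {d} then \<one> else \<zero>) \<odot>\<^bsub>A\<^esub> b)"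
    using assms by (intro lincomb_extend) auto
  finally have "crd d b = crd (\<Oplus>\<^bsub>A\<^esub>b\<in>S. (if b \<in> {d} then \<one> else \<zero>) \<odot>\<^bsub>A\<^esub> b) b" by simp
  also have "\<dots> = (if d = b then \<one> else \<zero>)" using assms by (subst crd_lincomb) auto
  finally show ?thesis .
qed

lemma linear_span_eq:
  assumes "T \<subseteq> S"
  shows "linear_span K A T = {x \<in> carrier A. \<forall>b\<in>S - T. crd x b = \<zero>}"
proof (intro equalityI subsetI)
  fix x assume "x \<in> linear_span K A T"
  then obtain F c where F: "F \<subseteq> T" "c \<in> F \<rightarrow> carrier K" "x = (\<Oplus>\<^bsub>A\<^esub>b\<in>F. c b \<odot>\<^bsub>A\<^esub> b)"
    by (auto simp: linear_span_def)
  then have x: "x = (\<Oplus>\<^bsub>A\<^esub>b\<in>S. (if b \<in> F then c b else \<zero>) \<odot>\<^bsub>A\<^esub> b)"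
    using assms by (simp add: lincomb_extend)
  have cc: "(\<lambda>b. if b \<in> F then c b else \<zero>) \<in> S \<rightarrow> carrier K" using F by auto
  have "x \<in> carrier A" using x S_carrier cc by (auto intro!: M.finsum_closed simp: Pi_iff)
  moreover have "crd x b = \<zero>" if "b \<in> S - T" for b
    using crd_lincomb[OF cc, of b] that F(1) x by auto
  ultimately show "x \<in> {x \<in> carrier A. \<forall>b\<in>S - T. crd x b = \<zero>}" by auto
next
  fix x assume x: "x \<in> {x \<in> carrier A. \<forall>b\<in>S - T. crd x b = \<zero>}"
  have "(\<Oplus>\<^bsub>A\<^esub>b\<in>T. crd x b \<odot>\<^bsub>A\<^esub> b) = (\<Oplus>\<^bsub>A\<^esub>b\<in>S. crd x b \<odot>\<^bsub>A\<^esub> b)"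
    using assms finite_S x S_carrier by (intro M.add.finprod_mono_neutral_cong_left) auto
  also have "\<dots> = x" using x by (simp add: lincomb_crd)
  finally show "x \<in> linear_span K A T"
    unfolding linear_span_def using assms finite_S x
    by (auto intro!: exI[of _ T] exI[of _ "crd x"] dest: finite_subset)
qed

end

section \<open>The heredity layers of a cell algebra\<close>

locale cell_algebra_basis = assoc_algebra K A
  for K (structure) and A (structure) and X :: "('l, 's, 't, 'c) cell_datum" +
  assumes cell_alg: "cell_algebra K A X"
begin

abbreviation "\<Lambda> \<equiv> cell_poset X"
abbreviation "C \<equiv> cell_elt X"
abbreviation "idx \<equiv> cell_indices X"

definition cells :: "'c set" where "cells = (\<lambda>(l, s, t). C l s t) ` idx"

lemma idx_iff: "(l, s, t) \<in> idx \<longleftrightarrow> l \<in> \<Lambda> \<and> s \<in> cell_left X l \<and> t \<in> cell_right X l"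
  by (auto simp: cell_indices_def)

lemma finite_left_right: "l \<in> \<Lambda> \<Longrightarrow> finite (cell_left X l)" "l \<in> \<Lambda> \<Longrightarrow> finite (cell_right X l)"
  and finite_poset: "finite \<Lambda>"
  and order: "partial_order_on \<Lambda> (cell_le X)"
  and inj: "inj_on (\<lambda>(l, s, t). C l s t) idx"
  using cell_alg by (auto simp: cell_algebra_def)

lemma finite_idx: "finite idx"
  unfolding cell_indices_def using finite_poset finite_left_right by auto

sublocale finite_basis K A cells
proof
  show "finite cells" using finite_idx by (simp add: cells_def)
  show "is_basis K A cells" using cell_alg by (simp add: cell_algebra_def cells_def)
qed

lemma C_cells [simp]: "(l, s, t) \<in> idx \<Longrightarrow> C l s t \<in> cells"
  by (force simp: cells_def)

lemma C_carrier [simp]: "(l, s, t) \<in> idx \<Longrightarrow> C l s t \<in> carrier A"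
  by (simp add: S_carrier)

lemma C_eq_iff [simp]:
  "\<lbrakk>(l, s, t) \<in> idx; (l', s', t') \<in> idx\<rbrakk> \<Longrightarrow> C l s t = C l' s' t' \<longleftrightarrow> l = l' \<and> s = s' \<and> t = t'"
  using inj by (fastforce simp: inj_on_def)

text \<open>
  This is the span of the cell elements over \<open>Z\<close>. Describing it by vanishing coordinates turns
  congruences modulo such spans into equations between coordinates.
\<close>

definition cell_ideal :: "'l set \<Rightarrow> 'c set" where
  "cell_ideal Z = {x \<in> carrier A. \<forall>l s t. (l, s, t) \<in> idx \<and> l \<notin> Z \<longrightarrow> crd x (C l s t) = \<zero>}"

lemma cell_above_eq:
  assumes "l \<in> \<Lambda>"
  shows "cell_above K A X l = cell_ideal {m. (l, m) \<in> cell_le X \<and> m \<noteq> l}"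
proof -
  let ?T = "{C m s t | m s t. (m, s, t) \<in> idx \<and> (l, m) \<in> cell_le X \<and> m \<noteq> l}"
  have "?T \<subseteq> cells" by auto
  moreover have "(\<forall>b\<in>cells - ?T. P b) \<longleftrightarrow>
      (\<forall>m s t. (m, s, t) \<in> idx \<and> \<not> ((l, m) \<in> cell_le X \<and> m \<noteq> l) \<longrightarrow> P (C m s t))" for P
  proof
    assume H: "\<forall>b\<in>cells - ?T. P b"
    show "\<forall>m s t. (m, s, t) \<in> idx \<and> \<not> ((l, m) \<in> cell_le X \<and> m \<noteq> l) \<longrightarrow> P (C m s t)"
    proof (intro allI impI)
      fix m s t assume a: "(m, s, t) \<in> idx \<and> \<not> ((l, m) \<in> cell_le X \<and> m \<noteq> l)"
      have "C m s t \<notin> ?T"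
      proof
        assume "C m s t \<in> ?T"
        then obtain m' s' t' where "C m s t = C m' s' t'" "(m', s', t') \<in> idx" "(l, m') \<in> cell_le X \<and> m' \<noteq> l"
          by auto
        then show False using a by auto
      qed
      then show "P (C m s t)" using H a by auto
    qed
  next
    assume H: "\<forall>m s t. (m, s, t) \<in> idx \<and> \<not> ((l, m) \<in> cell_le X \<and> m \<noteq> l) \<longrightarrow> P (C m s t)"
    show "\<forall>b\<in>cells - ?T. P b"
    proof
      fix b assume b: "b \<in> cells - ?T"
      then obtain m s t where "(m, s, t) \<in> idx" "b = C m s t" by (auto simp: cells_def)
      then show "P b" using b H by blast
    qed
  qed
  ultimately show ?thesis
    unfolding cell_above_def cell_ideal_def by (subst linear_span_eq) auto
qed

lemma left_congruence:
    "\<forall>a\<in>carrier A. \<forall>l\<in>\<Lambda>. \<forall>s\<in>cell_left X l. \<exists>r\<in>cell_left X l \<rightarrow> carrier K. \<forall>t\<in>cell_right X l.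
       (a \<otimes>\<^bsub>A\<^esub> C l s t) \<ominus>\<^bsub>A\<^esub> (\<Oplus>\<^bsub>A\<^esub>s'\<in>cell_left X l. r s' \<odot>\<^bsub>A\<^esub> C l s' t) \<in> cell_above K A X l"
  and right_congruence:
    "\<forall>a\<in>carrier A. \<forall>l\<in>\<Lambda>. \<forall>t\<in>cell_right X l. \<exists>r\<in>cell_right X l \<rightarrow> carrier K. \<forall>s\<in>cell_left X l.
       (C l s t \<otimes>\<^bsub>A\<^esub> a) \<ominus>\<^bsub>A\<^esub> (\<Oplus>\<^bsub>A\<^esub>t'\<in>cell_right X l. r t' \<odot>\<^bsub>A\<^esub> C l s t') \<in> cell_above K A X l"
  using cell_alg unfolding cell_algebra_def by - (elim conjE, assumption)+

text \<open>
  The defining congruence of a cell algebra in coordinates: left multiplication does not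
  change the right index, and its coefficients \<open>r\<close> do not depend on it.
\<close>

lemma left_law:
  assumes a: "a \<in> carrier A" and l: "l \<in> \<Lambda>" and s: "s \<in> cell_left X l"
  obtains r where "r \<in> cell_left X l \<rightarrow> carrier K"
    "\<And>t s' t'. \<lbrakk>t \<in> cell_right X l; s' \<in> cell_left X l; t' \<in> cell_right X l\<rbrakk> \<Longrightarrow>
        crd (a \<otimes>\<^bsub>A\<^esub> C l s t) (C l s' t') = (if t' = t then r s' else \<zero>)"
    "\<And>t m s' t'. \<lbrakk>t \<in> cell_right X l; (m, s', t') \<in> idx; (l, m) \<notin> cell_le X\<rbrakk> \<Longrightarrow>
        crd (a \<otimes>\<^bsub>A\<^esub> C l s t) (C m s' t') = \<zero>"
proof -
  obtain r where r: "r \<in> cell_left X l \<rightarrow> carrier K"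
    and law: "\<And>t. t \<in> cell_right X l \<Longrightarrow> (a \<otimes>\<^bsub>A\<^esub> C l s t)
        \<ominus>\<^bsub>A\<^esub> (\<Oplus>\<^bsub>A\<^esub>s'\<in>cell_left X l. r s' \<odot>\<^bsub>A\<^esub> C l s' t) \<in> cell_above K A X l"
    using bspec[OF bspec[OF bspec[OF left_congruence a] l] s] by blast
  have key: "crd (a \<otimes>\<^bsub>A\<^esub> C l s t) (C m s' t') = (if m = l \<and> t' = t then r s' else \<zero>)"
    if t: "t \<in> cell_right X l" and m: "(m, s', t') \<in> idx" "m = l \<or> (l, m) \<notin> cell_le X" for t m s' t'
  proof -
    let ?x = "a \<otimes>\<^bsub>A\<^esub> C l s t" and ?y = "\<Oplus>\<^bsub>A\<^esub>s'\<in>cell_left X l. r s' \<odot>\<^bsub>A\<^esub> C l s' t"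
    have tc: "(\<lambda>s'. r s' \<odot>\<^bsub>A\<^esub> C l s' t) \<in> cell_left X l \<rightarrow> carrier A"
      using r l t by (auto simp: idx_iff)
    have c: "?x \<in> carrier A" "?y \<in> carrier A" using tc a l s t by (auto simp: idx_iff)
    have "crd (?x \<ominus>\<^bsub>A\<^esub> ?y) (C m s' t') = \<zero>"
      using law[OF t] m unfolding cell_above_eq[OF l] cell_ideal_def by auto
    then have "crd ?x (C m s' t') = crd ?y (C m s' t')"
      using c m by (simp add: K_minus_eq_zero_iff)
    also have "\<dots> = (\<Oplus>s''\<in>cell_left X l. crd (r s'' \<odot>\<^bsub>A\<^esub> C l s'' t) (C m s' t'))"
      using tc m by (intro crd_finsum) auto
    also have "\<dots> = (if m = l \<and> t' = t then r s' else \<zero>)"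
    proof -
      have crd: "crd (r s'' \<odot>\<^bsub>A\<^esub> C l s'' t) (C m s' t') =
          (if m = l \<and> s'' = s' \<and> t' = t then r s' else \<zero>)" if "s'' \<in> cell_left X l" for s''
        using that l t m r by (auto simp: idx_iff crd_basis Pi_iff)
      show ?thesis
      proof (cases "m = l \<and> t' = t")
        case True
        then have "s' \<in> cell_left X l" using m by (simp add: idx_iff)
        then show ?thesis using crd True r finite_left_right(1)[OF l]
          by (subst K_finsum_single[where i = s']) auto
      next
        case False
        then show ?thesis using crd by (subst K_finsum_all_zero) auto
      qed
    qed
    finally show ?thesis .
  qed
  show ?thesis
    by (rule that[OF r]) (use key l partial_order_onD(1)[OF order] in \<open>auto simp: idx_iff dest: refl_onD\<close>)
qed
lemma right_law:
  assumes a: "a \<in> carrier A" and l: "l \<in> \<Lambda>" and t: "t \<in> cell_right X l"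
  obtains r where "r \<in> cell_right X l \<rightarrow> carrier K"
    "\<And>s s' t'. \<lbrakk>s \<in> cell_left X l; s' \<in> cell_left X l; t' \<in> cell_right X l\<rbrakk> \<Longrightarrow>
        crd (C l s t \<otimes>\<^bsub>A\<^esub> a) (C l s' t') = (if s' = s then r t' else \<zero>)"
    "\<And>s m s' t'. \<lbrakk>s \<in> cell_left X l; (m, s', t') \<in> idx; (l, m) \<notin> cell_le X\<rbrakk> \<Longrightarrow>
        crd (C l s t \<otimes>\<^bsub>A\<^esub> a) (C m s' t') = \<zero>"
proof -
  obtain r where r: "r \<in> cell_right X l \<rightarrow> carrier K"
    and law: "\<And>s. s \<in> cell_left X l \<Longrightarrow> (C l s t \<otimes>\<^bsub>A\<^esub> a)
        \<ominus>\<^bsub>A\<^esub> (\<Oplus>\<^bsub>A\<^esub>t'\<in>cell_right X l. r t' \<odot>\<^bsub>A\<^esub> C l s t') \<in> cell_above K A X l"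
    using bspec[OF bspec[OF bspec[OF right_congruence a] l] t] by blast
  have key: "crd (C l s t \<otimes>\<^bsub>A\<^esub> a) (C m s' t') = (if m = l \<and> s' = s then r t' else \<zero>)"
    if s: "s \<in> cell_left X l" and m: "(m, s', t') \<in> idx" "m = l \<or> (l, m) \<notin> cell_le X" for s m s' t'
  proof -
    let ?x = "C l s t \<otimes>\<^bsub>A\<^esub> a" and ?y = "\<Oplus>\<^bsub>A\<^esub>t'\<in>cell_right X l. r t' \<odot>\<^bsub>A\<^esub> C l s t'"
    have tc: "(\<lambda>t'. r t' \<odot>\<^bsub>A\<^esub> C l s t') \<in> cell_right X l \<rightarrow> carrier A"
      using r l s by (auto simp: idx_iff)
    have c: "?x \<in> carrier A" "?y \<in> carrier A" using tc a l s t by (auto simp: idx_iff)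
    have "crd (?x \<ominus>\<^bsub>A\<^esub> ?y) (C m s' t') = \<zero>"
      using law[OF s] m unfolding cell_above_eq[OF l] cell_ideal_def by auto
    then have "crd ?x (C m s' t') = crd ?y (C m s' t')"
      using c m by (simp add: K_minus_eq_zero_iff)
    also have "\<dots> = (\<Oplus>t''\<in>cell_right X l. crd (r t'' \<odot>\<^bsub>A\<^esub> C l s t'') (C m s' t'))"
      using tc m by (intro crd_finsum) auto
    also have "\<dots> = (if m = l \<and> s' = s then r t' else \<zero>)"
    proof -
      have crd: "crd (r t'' \<odot>\<^bsub>A\<^esub> C l s t'') (C m s' t') =
          (if m = l \<and> t'' = t' \<and> s' = s then r t' else \<zero>)" if "t'' \<in> cell_right X l" for t''
        using that l s m r by (auto simp: idx_iff crd_basis Pi_iff)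
      show ?thesis
      proof (cases "m = l \<and> s' = s")
        case True
        then have "t' \<in> cell_right X l" using m by (simp add: idx_iff)
        then show ?thesis using crd True r finite_left_right(2)[OF l]
          by (subst K_finsum_single[where i = t']) auto
      next
        case False
        then show ?thesis using crd by (subst K_finsum_all_zero) auto
      qed
    qed
    finally show ?thesis .
  qed
  show ?thesis
    by (rule that[OF r]) (use key l partial_order_onD(1)[OF order] in \<open>auto simp: idx_iff dest: refl_onD\<close>)
qed

definition up_closed :: "'l set \<Rightarrow> bool" where
  "up_closed Z \<longleftrightarrow> Z \<subseteq> \<Lambda> \<and> (\<forall>l\<in>Z. \<forall>m. (l, m) \<in> cell_le X \<longrightarrow> m \<in> Z)"

lemma C_in_cell_ideal: "\<lbrakk>(l, s, t) \<in> idx; l \<in> Z\<rbrakk> \<Longrightarrow> C l s t \<in> cell_ideal Z"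
  by (auto simp: cell_ideal_def crd_basis)

lemma cell_ideal_carrier: "x \<in> cell_ideal Z \<Longrightarrow> x \<in> carrier A"
  by (simp add: cell_ideal_def)

lemma cell_ideal_add: "\<lbrakk>x \<in> cell_ideal Z; y \<in> cell_ideal Z\<rbrakk> \<Longrightarrow> x \<oplus>\<^bsub>A\<^esub> y \<in> cell_ideal Z"
  by (simp add: cell_ideal_def)

lemma cell_ideal_zero: "\<zero>\<^bsub>A\<^esub> \<in> cell_ideal Z"
  by (simp add: cell_ideal_def)

lemma cell_ideal_smult: "\<lbrakk>c \<in> carrier K; x \<in> cell_ideal Z\<rbrakk> \<Longrightarrow> c \<odot>\<^bsub>A\<^esub> x \<in> cell_ideal Z"
  by (simp add: cell_ideal_def)

lemma cell_ideal_minus: "\<lbrakk>x \<in> cell_ideal Z; y \<in> cell_ideal Z\<rbrakk> \<Longrightarrow> x \<ominus>\<^bsub>A\<^esub> y \<in> cell_ideal Z"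
  by (simp add: cell_ideal_def a_minus_def[of K])

lemma cell_ideal_induct:
  assumes x: "x \<in> cell_ideal Z"
    and N: "\<zero>\<^bsub>A\<^esub> \<in> N" "\<And>x y. \<lbrakk>x \<in> N; y \<in> N\<rbrakk> \<Longrightarrow> x \<oplus>\<^bsub>A\<^esub> y \<in> N" "N \<subseteq> carrier A"
      "\<And>c x. \<lbrakk>c \<in> carrier K; x \<in> N\<rbrakk> \<Longrightarrow> c \<odot>\<^bsub>A\<^esub> x \<in> N"
    and C: "\<And>l s t. \<lbrakk>(l, s, t) \<in> idx; l \<in> Z\<rbrakk> \<Longrightarrow> C l s t \<in> N"
  shows "x \<in> N"
proof -
  have xc: "x \<in> carrier A" using x by (rule cell_ideal_carrier)
  have "(\<Oplus>\<^bsub>A\<^esub>b\<in>cells. crd x b \<odot>\<^bsub>A\<^esub> b) \<in> N"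
  proof (rule M.finsum_mem[OF N(1,3,2)])
    fix b assume b: "b \<in> cells"
    then obtain l s t where i: "(l, s, t) \<in> idx" "b = C l s t" by (auto simp: cells_def)
    show "crd x b \<odot>\<^bsub>A\<^esub> b \<in> N"
    proof (cases "l \<in> Z")
      case True
      then show ?thesis using C[OF i(1)] N(4) xc b i by auto
    next
      case False
      then have "crd x b = \<zero>" using x i by (auto simp: cell_ideal_def)
      then show ?thesis using N(1) b S_carrier by simp
    qed
  qed
  then show ?thesis using xc by (simp add: lincomb_crd)
qed

lemma ideal_cell_ideal:
  assumes Z: "up_closed Z"
  shows "ideal (cell_ideal Z) A"
proof (rule idealI_closed)
  have up: "m \<in> Z" if "l \<in> Z" "(l, m) \<in> cell_le X" for l m using Z that by (auto simp: up_closed_def)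
  fix x a assume x: "x \<in> cell_ideal Z" and a: "a \<in> carrier A"
  have "x \<in> {x \<in> carrier A. a \<otimes>\<^bsub>A\<^esub> x \<in> cell_ideal Z \<and> x \<otimes>\<^bsub>A\<^esub> a \<in> cell_ideal Z}" (is "x \<in> ?N")
  proof (rule cell_ideal_induct[OF x])
    fix l s t assume i: "(l, s, t) \<in> idx" and l: "l \<in> Z"
    have ist: "l \<in> \<Lambda>" "s \<in> cell_left X l" "t \<in> cell_right X l" using i by (auto simp: idx_iff)
    have "crd (a \<otimes>\<^bsub>A\<^esub> C l s t) (C m s' t') = \<zero>" if "(m, s', t') \<in> idx" "m \<notin> Z" for m s' t'
      using left_law[OF a ist(1,2)] up[OF l] that ist(3) by metis
    moreover have "crd (C l s t \<otimes>\<^bsub>A\<^esub> a) (C m s' t') = \<zero>" if "(m, s', t') \<in> idx" "m \<notin> Z" for m s' t'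
      using right_law[OF a ist(1,3)] up[OF l] that ist(2) by metis
    ultimately show "C l s t \<in> ?N" using i a by (auto simp: cell_ideal_def)
  qed (use a in \<open>auto simp: cell_ideal_zero cell_ideal_add cell_ideal_smult A.r_distr A.l_distr
        smult_mult_left smult_mult_right\<close>)
  then show "a \<otimes>\<^bsub>A\<^esub> x \<in> cell_ideal Z" "x \<otimes>\<^bsub>A\<^esub> a \<in> cell_ideal Z" by auto
qed (auto simp: cell_ideal_zero cell_ideal_add A.ring_axioms cell_ideal_def)

text \<open>
  The definite description in the definition of the form has a unique solution. By the left law the product
  is confined to the right index \<open>t'\<close>, by the right law to the left index \<open>s'\<close>, so that only
  one coordinate survives, and by the independence statements in both laws
  its value is the same for all \<open>s'\<close> and \<open>t'\<close>.
\<close>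

lemma cell_form_basis_eq:
  assumes l: "l \<in> \<Lambda>" and s: "s \<in> cell_left X l" and t: "t \<in> cell_right X l"
  shows "cell_form_basis K A X l t s \<in> carrier K"
    and "\<And>s' t'. \<lbrakk>s' \<in> cell_left X l; t' \<in> cell_right X l\<rbrakk> \<Longrightarrow>
      (C l s' t \<otimes>\<^bsub>A\<^esub> C l s t') \<ominus>\<^bsub>A\<^esub> (cell_form_basis K A X l t s \<odot>\<^bsub>A\<^esub> C l s' t') \<in> cell_above K A X l"
proof -
  let ?p = "\<lambda>s' t'. C l s' t \<otimes>\<^bsub>A\<^esub> C l s t'"
  have ic: "C l s' t' \<in> carrier A" "(l, s', t') \<in> idx" if "s' \<in> cell_left X l" "t' \<in> cell_right X l" for s' t'
    using that l by (auto simp: idx_iff)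
  define P where "P c \<longleftrightarrow> c \<in> carrier K \<and> (\<forall>s'\<in>cell_left X l. \<forall>t'\<in>cell_right X l.
      ?p s' t' \<ominus>\<^bsub>A\<^esub> (c \<odot>\<^bsub>A\<^esub> C l s' t') \<in> cell_above K A X l)" for c
  have zero: "crd (?p s' t') (C l s'' t'') = \<zero>"
    if A: "s' \<in> cell_left X l" "t' \<in> cell_right X l" "s'' \<in> cell_left X l" "t'' \<in> cell_right X l"
      "(s'', t'') \<noteq> (s', t')" for s' t' s'' t''
  proof -
    obtain r where "\<And>t' s'' t''. \<lbrakk>t' \<in> cell_right X l; s'' \<in> cell_left X l; t'' \<in> cell_right X l\<rbrakk> \<Longrightarrow>
        crd (?p s' t') (C l s'' t'') = (if t'' = t' then r s'' else \<zero>)"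
      using left_law[OF ic(1)[OF A(1) t] l s] by metis
    moreover obtain q where "\<And>s' s'' t''. \<lbrakk>s' \<in> cell_left X l; s'' \<in> cell_left X l; t'' \<in> cell_right X l\<rbrakk> \<Longrightarrow>
        crd (?p s' t') (C l s'' t'') = (if s'' = s' then q t'' else \<zero>)"
      using right_law[OF ic(1)[OF s A(2)] l t] by metis
    ultimately show ?thesis using A by (metis (full_types))
  qed
  have diag: "crd (?p s' t') (C l s' t') = crd (?p s t) (C l s t)"
    if A: "s' \<in> cell_left X l" "t' \<in> cell_right X l" for s' t'
  proof -
    obtain r where "\<And>t' s'' t''. \<lbrakk>t' \<in> cell_right X l; s'' \<in> cell_left X l; t'' \<in> cell_right X l\<rbrakk> \<Longrightarrow>
        crd (?p s' t') (C l s'' t'') = (if t'' = t' then r s'' else \<zero>)"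
      using left_law[OF ic(1)[OF A(1) t] l s] by metis
    then have "crd (?p s' t') (C l s' t') = crd (?p s' t) (C l s' t)" using A t by simp
    also obtain q where "\<And>s' s'' t''. \<lbrakk>s' \<in> cell_left X l; s'' \<in> cell_left X l; t'' \<in> cell_right X l\<rbrakk> \<Longrightarrow>
        crd (?p s' t) (C l s'' t'') = (if s'' = s' then q t'' else \<zero>)"
      using right_law[OF ic(1)[OF s t] l t] by metis
    then have "crd (?p s' t) (C l s' t) = crd (?p s t) (C l s t)" using A s t by simp
    finally show ?thesis .
  qed
  have below: "crd (?p s' t') (C m s'' t'') = \<zero>"
    if "s' \<in> cell_left X l" "t' \<in> cell_right X l" "(m, s'', t'') \<in> idx" "(l, m) \<notin> cell_le X" for s' t' m s'' t''
    using left_law[OF ic(1)[OF that(1) t] l s] that by metis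
  let ?c = "crd (?p s t) (C l s t)"
  have c: "?c \<in> carrier K" using ic s t by auto
  have "P ?c"
    unfolding P_def cell_above_eq[OF l] cell_ideal_def
  proof (intro conjI ballI CollectI allI impI c; (elim conjE)?)
    fix s' t' assume s': "s' \<in> cell_left X l" and t': "t' \<in> cell_right X l"
    note i = ic[OF s' t'] ic[OF s' t] ic[OF s t']
    show "?p s' t' \<ominus>\<^bsub>A\<^esub> ?c \<odot>\<^bsub>A\<^esub> C l s' t' \<in> carrier A" using i c by auto
    fix m s'' t'' assume m: "(m, s'', t'') \<in> idx" "m \<notin> {m. (l, m) \<in> cell_le X \<and> m \<noteq> l}"
    have "crd (?p s' t') (C m s'' t'') = (if (m, s'', t'') = (l, s', t') then ?c else \<zero>)"
    proof (cases "m = l")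
      case True
      have "s'' \<in> cell_left X l" "t'' \<in> cell_right X l" using m True by (auto simp: idx_iff)
      then show ?thesis using zero[OF s' t', of s'' t''] diag[OF s' t'] True
        by (cases "(s'', t'') = (s', t')") auto
    next
      case False
      then show ?thesis using m below[OF s' t'] by auto
    qed
    then show "crd (?p s' t' \<ominus>\<^bsub>A\<^esub> ?c \<odot>\<^bsub>A\<^esub> C l s' t') (C m s'' t'') = \<zero>"
      using i c m(1) by (auto simp: crd_basis a_minus_def[of K] K_r_neg)
  qed
  moreover have "d = ?c" if "P d" for d
  proof -
    have d: "d \<in> carrier K" and "?p s t \<ominus>\<^bsub>A\<^esub> (d \<odot>\<^bsub>A\<^esub> C l s t) \<in> cell_above K A X l"
      using that s t by (auto simp: P_def)
    then have "crd (?p s t \<ominus>\<^bsub>A\<^esub> (d \<odot>\<^bsub>A\<^esub> C l s t)) (C l s t) = \<zero>"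
      using ic(2)[OF s t] unfolding cell_above_eq[OF l] cell_ideal_def by auto
    then have "?c \<ominus> d = \<zero>" using ic[OF s t] d by (simp add: crd_basis)
    then show ?thesis using c d by (simp add: K_minus_eq_zero_iff)
  qed
  ultimately have "P (THE c. P c)" by (rule theI)
  moreover have "cell_form_basis K A X l t s = (THE c. P c)" by (simp add: cell_form_basis_def P_def)
  ultimately have "P (cell_form_basis K A X l t s)" by simp
  then show "cell_form_basis K A X l t s \<in> carrier K"
    and "\<And>s' t'. \<lbrakk>s' \<in> cell_left X l; t' \<in> cell_right X l\<rbrakk> \<Longrightarrow>
      (C l s' t \<otimes>\<^bsub>A\<^esub> C l s t') \<ominus>\<^bsub>A\<^esub> (cell_form_basis K A X l t s \<odot>\<^bsub>A\<^esub> C l s' t') \<in> cell_above K A X l"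
    by (auto simp: P_def)
qed

lemma nonzero_form_basis:
  assumes "l \<in> cell_poset_0 K A X"
  obtains s t where "s \<in> cell_left X l" "t \<in> cell_right X l" "cell_form_basis K A X l t s \<noteq> \<zero>"
proof (rule ccontr)
  note witness = that
  assume "\<not> thesis"
  then have z: "cell_form_basis K A X l t s = \<zero>" if "s \<in> cell_left X l" "t \<in> cell_right X l" for s t
    using that witness[of s t] by blast
  obtain u v where uv: "u \<in> fin_supp K (cell_right X l)" "v \<in> fin_supp K (cell_left X l)"
    and "cell_form K A X l u v \<noteq> \<zero>"
    using assms by (auto simp: cell_poset_0_def)
  moreover have "cell_form K A X l u v = \<zero>"
    unfolding cell_form_def using uv z
    by (intro K_finsum_all_zero) (auto simp: fin_supp_def)
  ultimately show False by simp
qed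

text \<open>
  Let \<open>c\<close> be a nonzero value of the form at \<open>t\<^sub>0\<close>, \<open>s\<^sub>0\<close> and \<open>e = c\<^sup>-\<^sup>1 C\<close> with \<open>C\<close> the cell element with indices
  \<open>s\<^sub>0\<close>, \<open>t\<^sub>0\<close>. Modulo the cells above \<open>l\<close>, the product of the cell elements with indices \<open>s\<close>, \<open>t\<^sub>0\<close>
  and \<open>s\<^sub>0\<close>, \<open>t\<close> is \<open>c\<close> times the one with indices \<open>s\<close>, \<open>t\<close>. So \<open>e\<close> is idempotent, the cell elements with right
  index \<open>t\<^sub>0\<close> generate the layer, and the two laws leave only multiples of \<open>C\<close> in \<open>C A C\<close>. These generators
  are independent because right multiplication preserves the left index.
\<close>

lemma heredity_layer_cell:
  assumes Z: "up_closed Z" and l: "l \<in> Z" and Zl: "up_closed (Z - {l})" and nz: "l \<in> cell_poset_0 K A X"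
  shows "heredity_layer A (cell_ideal (Z - {l})) (cell_ideal Z)"
proof -
  let ?I = "cell_ideal (Z - {l})" and ?J = "cell_ideal Z"
  have ideals: "ideal ?I A" "ideal ?J A" by (rule ideal_cell_ideal[OF Zl], rule ideal_cell_ideal[OF Z])
  note I_r = ideal.I_r_closed[OF ideals(1)]
    and J_r = ideal.I_r_closed[OF ideals(2)] and J_l = ideal.I_l_closed[OF ideals(2)]
  have IJ: "?I \<subseteq> ?J" unfolding cell_ideal_def by blast
  have l\<Lambda>: "l \<in> \<Lambda>" using Z l unfolding up_closed_def by blast
  obtain s0 t0 where s0: "s0 \<in> cell_left X l" and t0: "t0 \<in> cell_right X l"
    and c0: "cell_form_basis K A X l t0 s0 \<noteq> \<zero>"
    using nonzero_form_basis[OF nz] .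
  define c where "c = cell_form_basis K A X l t0 s0"
  have c: "c \<in> carrier K" "c \<noteq> \<zero>" using cell_form_basis_eq(1)[OF l\<Lambda> s0 t0] c0 by (auto simp: c_def)
  define d where "d = inv c"
  have d: "d \<in> carrier K" "d \<otimes> c = \<one>" using c by (auto simp: d_def field_Units)
  have i: "(l, s, t) \<in> idx" if "s \<in> cell_left X l" "t \<in> cell_right X l" for s t
    using that l\<Lambda> by (simp add: idx_iff)
  have CJ: "C l s t \<in> ?J" if "s \<in> cell_left X l" "t \<in> cell_right X l" for s t
    using C_in_cell_ideal[OF i[OF that] l] .
  note Jc = cell_ideal_carrier[where Z = Z]
  have I_iff: "x \<in> ?I" if H: "x \<in> ?J" "\<And>s t. \<lbrakk>s \<in> cell_left X l; t \<in> cell_right X l\<rbrakk> \<Longrightarrow> crd x (C l s t) = \<zero>" for x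
  proof -
    have "crd x (C m s t) = \<zero>" if m: "(m, s, t) \<in> idx" "m \<notin> Z - {l}" for m s t
      using m \<open>x \<in> ?J\<close> H(2)[of s t] by (cases "m = l") (auto simp: cell_ideal_def idx_iff)
    then show ?thesis using H(1) by (auto simp: cell_ideal_def)
  qed
  have diffI: "x \<ominus>\<^bsub>A\<^esub> y \<in> ?I" if "x \<in> ?J" "y \<in> ?J"
    "\<And>s t. \<lbrakk>s \<in> cell_left X l; t \<in> cell_right X l\<rbrakk> \<Longrightarrow> crd x (C l s t) = crd y (C l s t)" for x y
  proof (rule I_iff)
    show "x \<ominus>\<^bsub>A\<^esub> y \<in> ?J" using that(1,2) by (rule cell_ideal_minus)
    fix s t assume st: "s \<in> cell_left X l" "t \<in> cell_right X l"
    then show "crd (x \<ominus>\<^bsub>A\<^esub> y) (C l s t) = \<zero>"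
      using that(3)[OF st] Jc[OF that(1)] Jc[OF that(2)] i[OF st] by (simp add: K_minus_eq_zero_iff)
  qed
  note trans = ideal_minus_trans[OF ideals(1)]
  have I0: "crd x (C l s t) = \<zero>" if "x \<in> ?I" "s \<in> cell_left X l" "t \<in> cell_right X l" for x s t
    using that i by (auto simp: cell_ideal_def)
  have above: "cell_above K A X l \<subseteq> ?I"
    unfolding cell_above_eq[OF l\<Lambda>] cell_ideal_def using Z l unfolding up_closed_def by blast
  have prod: "crd (C l s t0 \<otimes>\<^bsub>A\<^esub> C l s0 t) (C l s' t') = (if s' = s \<and> t' = t then c else \<zero>)"
    if st: "s \<in> cell_left X l" "t \<in> cell_right X l" "s' \<in> cell_left X l" "t' \<in> cell_right X l" for s t s' t'
  proof -
    have "(C l s t0 \<otimes>\<^bsub>A\<^esub> C l s0 t) \<ominus>\<^bsub>A\<^esub> (c \<odot>\<^bsub>A\<^esub> C l s t) \<in> ?I"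
      using cell_form_basis_eq(2)[OF l\<Lambda> s0 t0 st(1,2)] above by (auto simp: c_def)
    from I0[OF this st(3,4)]
    have "crd (C l s t0 \<otimes>\<^bsub>A\<^esub> C l s0 t) (C l s' t') = crd (c \<odot>\<^bsub>A\<^esub> C l s t) (C l s' t')"
      using st i s0 t0 c by (simp add: K_minus_eq_zero_iff)
    then show ?thesis using st i c by (auto simp: crd_basis)
  qed
  let ?C0 = "C l s0 t0"
  have C0: "?C0 \<in> ?J" "?C0 \<in> carrier A" using CJ[OF s0 t0] i[OF s0 t0] by auto
  define e where "e = d \<odot>\<^bsub>A\<^esub> ?C0"
  have e: "e \<in> ?J" "e \<in> carrier A"
    using C0 d by (auto simp: e_def cell_ideal_smult)
  define U where "U = (\<lambda>s. C l s t0) ` cell_left X l"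
  have U: "u \<in> ?J" "u \<in> carrier A" if "u \<in> U" for u
    using that CJ i t0 by (auto simp: U_def)
  have ue: "(C l s t0 \<otimes>\<^bsub>A\<^esub> e) \<ominus>\<^bsub>A\<^esub> C l s t0 \<in> ?I" if s: "s \<in> cell_left X l" for s
  proof (rule diffI)
    have Cs: "C l s t0 \<in> ?J" "C l s t0 \<in> carrier A" using CJ[OF s t0] i[OF s t0] by auto
    show "C l s t0 \<otimes>\<^bsub>A\<^esub> e \<in> ?J" using J_r[OF Cs(1) e(2)] .
    show "C l s t0 \<in> ?J" by (rule Cs)
    fix s' t' assume st: "s' \<in> cell_left X l" "t' \<in> cell_right X l"
    have "C l s t0 \<otimes>\<^bsub>A\<^esub> e = d \<odot>\<^bsub>A\<^esub> (C l s t0 \<otimes>\<^bsub>A\<^esub> ?C0)"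
      unfolding e_def using d Cs C0 by (intro smult_mult_right)
    then show "crd (C l s t0 \<otimes>\<^bsub>A\<^esub> e) (C l s' t') = crd (C l s t0) (C l s' t')"
      using prod[OF s t0 st] d Cs C0 i[OF st] i[OF s t0] by (auto simp: crd_basis)
  qed
  have ee: "(e \<otimes>\<^bsub>A\<^esub> e) \<ominus>\<^bsub>A\<^esub> e \<in> ?I"
  proof -
    have "d \<odot>\<^bsub>A\<^esub> ((?C0 \<otimes>\<^bsub>A\<^esub> e) \<ominus>\<^bsub>A\<^esub> ?C0) \<in> ?I" using ue[OF s0] d by (intro cell_ideal_smult)
    also have "d \<odot>\<^bsub>A\<^esub> ((?C0 \<otimes>\<^bsub>A\<^esub> e) \<ominus>\<^bsub>A\<^esub> ?C0) = (e \<otimes>\<^bsub>A\<^esub> e) \<ominus>\<^bsub>A\<^esub> e"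
      using C0 e(2) d
      by (simp add: a_minus_def[of A] smult_r_distr smult_r_minus e_def smult_mult_left)
    finally show ?thesis .
  qed
  have "heredity_generators A ?I ?J e U"
    unfolding heredity_generators_def
  proof (intro conjI ballI allI impI; (elim conjE)?)
    show "ideal ?I A" "ideal ?J A" by (rule ideals)+
    show "?I \<subseteq> ?J" "e \<in> ?J" by fact+
    show "e \<notin> ?I"
    proof
      assume "e \<in> ?I"
      then have "crd e ?C0 = \<zero>" using s0 t0 by (rule I0)
      moreover have "crd e ?C0 = d" using d C0 i[OF s0 t0] by (simp add: e_def crd_basis)
      ultimately show False using d c by simp
    qed
    show "e \<otimes>\<^bsub>A\<^esub> e \<ominus>\<^bsub>A\<^esub> e \<in> ?I" by (rule ee)
    show "finite U" using finite_left_right(1)[OF l\<Lambda>] by (simp add: U_def)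
    show "U \<subseteq> ?J" using U by auto
    show "(u \<otimes>\<^bsub>A\<^esub> e) \<ominus>\<^bsub>A\<^esub> u \<in> ?I" if "u \<in> U" for u using that ue by (auto simp: U_def)
  next
    fix x assume x: "x \<in> carrier A"
    let ?z = "?C0 \<otimes>\<^bsub>A\<^esub> x \<otimes>\<^bsub>A\<^esub> ?C0"
    have zJ: "?z \<in> ?J" using J_l[OF C0(1), of "?C0 \<otimes>\<^bsub>A\<^esub> x"] C0(2) x by simp
    have zc: "?z \<in> carrier A" using Jc[OF zJ] .
    have z2: "?z = ?C0 \<otimes>\<^bsub>A\<^esub> (x \<otimes>\<^bsub>A\<^esub> ?C0)" using C0 x by (simp add: A.m_assoc)
    have coord0: "crd ?z (C l s t) = \<zero>" if st: "s \<in> cell_left X l" "t \<in> cell_right X l" "(s, t) \<noteq> (s0, t0)" for s t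
    proof (cases "t = t0")
      case False
      obtain r where "\<And>t s' t'. \<lbrakk>t \<in> cell_right X l; s' \<in> cell_left X l; t' \<in> cell_right X l\<rbrakk> \<Longrightarrow>
        crd (?C0 \<otimes>\<^bsub>A\<^esub> x \<otimes>\<^bsub>A\<^esub> C l s0 t) (C l s' t') = (if t' = t then r s' else \<zero>)"
        using left_law[OF A.m_closed[OF C0(2) x] l\<Lambda> s0] by metis
      then show ?thesis using st t0 False by simp
    next
      case True
      obtain r where "\<And>s s' t'. \<lbrakk>s \<in> cell_left X l; s' \<in> cell_left X l; t' \<in> cell_right X l\<rbrakk> \<Longrightarrow>
        crd (C l s t0 \<otimes>\<^bsub>A\<^esub> (x \<otimes>\<^bsub>A\<^esub> ?C0)) (C l s' t') = (if s' = s then r t' else \<zero>)"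
        using right_law[OF A.m_closed[OF x C0(2)] l\<Lambda> t0] by metis
      then show ?thesis using st s0 True z2 by simp
    qed
    define k where "k = d \<otimes> crd ?z ?C0"
    have k: "k \<in> carrier K" using d zc i[OF s0 t0] by (simp add: k_def)
    have exe: "e \<otimes>\<^bsub>A\<^esub> x \<otimes>\<^bsub>A\<^esub> e = (d \<otimes> d) \<odot>\<^bsub>A\<^esub> ?z"
      using d C0 x by (simp add: e_def smult_mult_left smult_mult_right smult_assoc1)
    have exe_k: "(e \<otimes>\<^bsub>A\<^esub> x \<otimes>\<^bsub>A\<^esub> e) \<ominus>\<^bsub>A\<^esub> (k \<odot>\<^bsub>A\<^esub> e) \<in> ?I"
    proof (rule diffI)
      show "e \<otimes>\<^bsub>A\<^esub> x \<otimes>\<^bsub>A\<^esub> e \<in> ?J" unfolding exe using d zJ by (simp add: cell_ideal_smult)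
      show "k \<odot>\<^bsub>A\<^esub> e \<in> ?J" using k e by (simp add: cell_ideal_smult)
      fix s t assume st: "s \<in> cell_left X l" "t \<in> cell_right X l"
      show "crd (e \<otimes>\<^bsub>A\<^esub> x \<otimes>\<^bsub>A\<^esub> e) (C l s t) = crd (k \<odot>\<^bsub>A\<^esub> e) (C l s t)"
        unfolding exe using coord0[OF st] k d zc C0 i[OF st] i[OF s0 t0]
        by (cases "(s, t) = (s0, t0)") (auto simp: e_def crd_basis k_def m_ac)
    qed
    show "e \<otimes>\<^bsub>A\<^esub> x \<otimes>\<^bsub>A\<^esub> e \<in> ?I \<or>
      (\<exists>y\<in>carrier A. (e \<otimes>\<^bsub>A\<^esub> x \<otimes>\<^bsub>A\<^esub> e \<otimes>\<^bsub>A\<^esub> y \<otimes>\<^bsub>A\<^esub> e) \<ominus>\<^bsub>A\<^esub> e \<in> ?I)"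
    proof (cases "k = \<zero>")
      case True
      then show ?thesis using exe_k e x by (simp add: a_minus_def[of A])
    next
      case False
      define y where "y = inv k \<odot>\<^bsub>A\<^esub> \<one>\<^bsub>A\<^esub>"
      have ik: "inv k \<in> carrier K" "inv k \<otimes> k = \<one>" using k False by (auto simp: field_Units)
      have y: "y \<in> carrier A" using ik by (simp add: y_def)
      have ye: "y \<otimes>\<^bsub>A\<^esub> e = inv k \<odot>\<^bsub>A\<^esub> e" using ik e by (simp add: y_def smult_mult_left)
      have kye: "(k \<odot>\<^bsub>A\<^esub> e) \<otimes>\<^bsub>A\<^esub> (y \<otimes>\<^bsub>A\<^esub> e) = e \<otimes>\<^bsub>A\<^esub> e"
        unfolding ye using ik k e
        by (simp add: smult_mult_left smult_mult_right smult_assoc1[symmetric])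
      have rearrange: "(a \<ominus>\<^bsub>A\<^esub> b) \<otimes>\<^bsub>A\<^esub> (y \<otimes>\<^bsub>A\<^esub> e) = (a \<otimes>\<^bsub>A\<^esub> y \<otimes>\<^bsub>A\<^esub> e) \<ominus>\<^bsub>A\<^esub> b \<otimes>\<^bsub>A\<^esub> (y \<otimes>\<^bsub>A\<^esub> e)"
        if "a \<in> carrier A" "b \<in> carrier A" for a b
        using that y e by (simp add: a_minus_def[of A] A.l_distr A.l_minus A.m_assoc)
      have "((e \<otimes>\<^bsub>A\<^esub> x \<otimes>\<^bsub>A\<^esub> e) \<ominus>\<^bsub>A\<^esub> (k \<odot>\<^bsub>A\<^esub> e)) \<otimes>\<^bsub>A\<^esub> (y \<otimes>\<^bsub>A\<^esub> e) \<in> ?I"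
        using exe_k y e by (intro I_r) auto
      also have "((e \<otimes>\<^bsub>A\<^esub> x \<otimes>\<^bsub>A\<^esub> e) \<ominus>\<^bsub>A\<^esub> (k \<odot>\<^bsub>A\<^esub> e)) \<otimes>\<^bsub>A\<^esub> (y \<otimes>\<^bsub>A\<^esub> e) =
          (e \<otimes>\<^bsub>A\<^esub> x \<otimes>\<^bsub>A\<^esub> e \<otimes>\<^bsub>A\<^esub> y \<otimes>\<^bsub>A\<^esub> e) \<ominus>\<^bsub>A\<^esub> (k \<odot>\<^bsub>A\<^esub> e) \<otimes>\<^bsub>A\<^esub> (y \<otimes>\<^bsub>A\<^esub> e)"
        using x y e k by (intro rearrange) auto
      finally have "(e \<otimes>\<^bsub>A\<^esub> x \<otimes>\<^bsub>A\<^esub> e \<otimes>\<^bsub>A\<^esub> y \<otimes>\<^bsub>A\<^esub> e) \<ominus>\<^bsub>A\<^esub> (e \<otimes>\<^bsub>A\<^esub> e) \<in> ?I" unfolding kye .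
      then have "(e \<otimes>\<^bsub>A\<^esub> x \<otimes>\<^bsub>A\<^esub> e \<otimes>\<^bsub>A\<^esub> y \<otimes>\<^bsub>A\<^esub> e) \<ominus>\<^bsub>A\<^esub> e \<in> ?I"
        using trans[OF _ _ e(2) _ ee] x y e(2) by simp
      then show ?thesis using y by blast
    qed
  next
    fix N assume N: "right_ideal N A" "?I \<subseteq> N" "U \<subseteq> N"
    note Nd = right_idealD[OF N(1) A.ring_axioms]
    note Ns = right_ideal_smult[OF N(1)]
    show "?J \<subseteq> N"
    proof
      fix x assume "x \<in> ?J"
      then show "x \<in> N"
      proof (rule cell_ideal_induct[OF _ Nd(2,3,1) Ns])
        fix m s t assume m: "(m, s, t) \<in> idx" "m \<in> Z"
        show "C m s t \<in> N"
        proof (cases "m = l")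
          case False
          then show ?thesis using C_in_cell_ideal[OF m(1), of "Z - {l}"] m(2) N(2) by auto
        next
          case True
          have st: "s \<in> cell_left X l" "t \<in> cell_right X l" using m True by (auto simp: idx_iff)
          let ?p = "d \<odot>\<^bsub>A\<^esub> (C l s t0 \<otimes>\<^bsub>A\<^esub> C l s0 t)"
          have cc: "C l s t0 \<in> carrier A" "C l s0 t \<in> carrier A" "C l s t \<in> carrier A"
            using i st s0 t0 by auto
          have pN: "?p \<in> N"
            using N(3) st(1) cc d by (intro Ns Nd(5)) (auto simp: U_def)
          have "C l s t \<ominus>\<^bsub>A\<^esub> ?p \<in> ?I"
          proof (rule diffI)
            show "C l s t \<in> ?J" using CJ[OF st] .
            show "?p \<in> ?J" using J_r[OF CJ[OF st(1) t0] cc(2)] d by (simp add: cell_ideal_smult)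
            fix s' t' assume st': "s' \<in> cell_left X l" "t' \<in> cell_right X l"
            show "crd (C l s t) (C l s' t') = crd ?p (C l s' t')"
              using prod[OF st st'] i[OF st'] i[OF st] cc d by (auto simp: crd_basis)
          qed
          then have "(C l s t \<ominus>\<^bsub>A\<^esub> ?p) \<oplus>\<^bsub>A\<^esub> ?p \<in> N" using N(2) pN by (intro Nd(3)) auto
          also have "(C l s t \<ominus>\<^bsub>A\<^esub> ?p) \<oplus>\<^bsub>A\<^esub> ?p = C l s t"
            using cc d by (simp add: a_minus_def[of A] M.a_assoc M.l_neg)
          finally show ?thesis using True by simp
        qed
      qed
    qed
  next
    fix b u assume b: "b \<in> U \<rightarrow> carrier A" and sum: "(\<Oplus>\<^bsub>A\<^esub>u\<in>U. u \<otimes>\<^bsub>A\<^esub> b u) \<in> ?I" and "u \<in> U"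
    then obtain s where s: "s \<in> cell_left X l" "u = C l s t0" by (auto simp: U_def)
    let ?b = "\<lambda>s. b (C l s t0)"
    have bc: "?b s' \<in> carrier A" if "s' \<in> cell_left X l" for s' using that b by (auto simp: U_def)
    have tc: "(\<lambda>s'. C l s' t0 \<otimes>\<^bsub>A\<^esub> ?b s') \<in> cell_left X l \<rightarrow> carrier A"
      using bc i t0 by auto
    have "inj_on (\<lambda>s'. C l s' t0) (cell_left X l)" using i t0 by (auto simp: inj_on_def)
    then have sum': "(\<Oplus>\<^bsub>A\<^esub>s'\<in>cell_left X l. C l s' t0 \<otimes>\<^bsub>A\<^esub> ?b s') \<in> ?I"
      using sum tc b U unfolding U_def
      by (subst (asm) M.finsum_reindex) auto
    \<comment> \<open>The summand of \<open>s\<close> is the only one with coordinates in row \<open>s\<close>; as \<open>r\<close> does not depend on the row,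
      its vanishing there also kills the product with \<open>e\<close>, which has the row \<open>s\<^sub>0\<close>.\<close>
    obtain r where r: "\<And>s s' t'. \<lbrakk>s \<in> cell_left X l; s' \<in> cell_left X l; t' \<in> cell_right X l\<rbrakk> \<Longrightarrow>
        crd (C l s t0 \<otimes>\<^bsub>A\<^esub> b u) (C l s' t') = (if s' = s then r t' else \<zero>)"
      using right_law[OF bc[OF s(1)] l\<Lambda> t0] s(2) by metis
    have r0: "r t = \<zero>" if t: "t \<in> cell_right X l" for t
    proof -
      have "\<zero> = crd (\<Oplus>\<^bsub>A\<^esub>s'\<in>cell_left X l. C l s' t0 \<otimes>\<^bsub>A\<^esub> ?b s') (C l s t)"
        using I0[OF sum' s(1) t] by simp
      also have "\<dots> = (\<Oplus>s'\<in>cell_left X l. crd (C l s' t0 \<otimes>\<^bsub>A\<^esub> ?b s') (C l s t))"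
        using tc i[OF s(1) t] by (intro crd_finsum) auto
      also have "\<dots> = crd (C l s t0 \<otimes>\<^bsub>A\<^esub> ?b s) (C l s t)"
      proof (rule K_finsum_single)
        show "finite (cell_left X l)" using finite_left_right(1)[OF l\<Lambda>] .
        show "s \<in> cell_left X l" by (rule s)
        show "crd (C l s t0 \<otimes>\<^bsub>A\<^esub> ?b s) (C l s t) \<in> carrier K" using bc[OF s(1)] i s t t0 by auto
        fix s' assume s': "s' \<in> cell_left X l" "s' \<noteq> s"
        obtain q where "\<And>s'' t'. \<lbrakk>s'' \<in> cell_left X l; t' \<in> cell_right X l\<rbrakk> \<Longrightarrow>
          crd (C l s' t0 \<otimes>\<^bsub>A\<^esub> ?b s') (C l s'' t') = (if s'' = s' then q t' else \<zero>)"
          using right_law[OF bc[OF s'(1)] l\<Lambda> t0] s'(1) by metis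
        then show "crd (C l s' t0 \<otimes>\<^bsub>A\<^esub> ?b s') (C l s t) = \<zero>" using s s' t by auto
      qed
      also have "\<dots> = r t" using r[OF s(1) s(1) t] s(2) by simp
      finally show ?thesis by simp
    qed
    have bu: "b u \<in> carrier A" using bc[OF s(1)] s(2) by simp
    have "?C0 \<otimes>\<^bsub>A\<^esub> b u \<in> ?I"
      using J_r[OF C0(1) bu] r[OF s0] r0 by (intro I_iff) auto
    then show "e \<otimes>\<^bsub>A\<^esub> b u \<in> ?I"
      unfolding e_def using d C0 bu by (simp add: smult_mult_left cell_ideal_smult)
  qed
  then show ?thesis by (auto simp: heredity_layer_def)
qed

text \<open>
  An element with the fewest elements of \<open>Z\<close> below it is minimal.
\<close>

lemma exists_minimal:
  assumes "finite Z" "Z \<noteq> {}" "Z \<subseteq> \<Lambda>"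
  obtains l where "l \<in> Z" "\<And>m. \<lbrakk>m \<in> Z; (m, l) \<in> cell_le X\<rbrakk> \<Longrightarrow> m = l"
proof -
  let ?f = "\<lambda>l. card {m \<in> Z. (m, l) \<in> cell_le X}"
  obtain l where l: "l \<in> Z" "\<And>m. m \<in> Z \<Longrightarrow> ?f l \<le> ?f m"
    using assms(2) ex_has_least_nat[of "\<lambda>l. l \<in> Z" _ ?f] by blast
  have "m = l" if m: "m \<in> Z" "(m, l) \<in> cell_le X" for m
  proof (rule ccontr)
    assume ne: "m \<noteq> l"
    have tr: "trans (cell_le X)" and an: "antisym (cell_le X)"
      using order by (auto simp: partial_order_on_def preorder_on_def)
    have "(l, l) \<in> cell_le X" using partial_order_onD(1)[OF order] l(1) assms(3) by (auto dest: refl_onD)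
    then have "l \<in> {k \<in> Z. (k, l) \<in> cell_le X}" using l by auto
    moreover have "l \<notin> {k \<in> Z. (k, m) \<in> cell_le X}" using an m ne by (auto dest: antisymD)
    moreover have "{k \<in> Z. (k, m) \<in> cell_le X} \<subseteq> {k \<in> Z. (k, l) \<in> cell_le X}"
      using tr m by (auto dest: transD)
    ultimately have "{k \<in> Z. (k, m) \<in> cell_le X} \<subset> {k \<in> Z. (k, l) \<in> cell_le X}" by blast
    then have "?f m < ?f l" using assms(1) by (intro psubset_card_mono) auto
    then show False using l(2)[OF m(1)] by simp
  qed
  then show ?thesis using that l(1) by blast
qed

lemma heredity_chain_cell_ideal:
  assumes nz: "cell_poset_0 K A X = \<Lambda>"
  shows "up_closed Z \<Longrightarrow> (heredity_layer A)\<^sup>*\<^sup>* {\<zero>\<^bsub>A\<^esub>} (cell_ideal Z)"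
proof (induction "card Z" arbitrary: Z)
  have fin: "finite Z" if "up_closed Z" for Z
    using that finite_poset by (auto simp: up_closed_def dest: finite_subset)
  {
    case 0
    then have "Z = {}" using fin[OF 0(2)] by simp
    have "x = \<zero>\<^bsub>A\<^esub>" if x: "x \<in> cell_ideal {}" for x
      using cell_ideal_induct[OF x, of "{\<zero>\<^bsub>A\<^esub>}"] by auto
    then have "cell_ideal {} = {\<zero>\<^bsub>A\<^esub>}" using cell_ideal_zero by auto
    then show ?case using \<open>Z = {}\<close> by simp
  next
    case (Suc n)
    have "Z \<noteq> {}" "Z \<subseteq> \<Lambda>" using Suc(2,3) by (auto simp: up_closed_def)
    then obtain l where l: "l \<in> Z" "\<And>m. \<lbrakk>m \<in> Z; (m, l) \<in> cell_le X\<rbrakk> \<Longrightarrow> m = l"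
      using exists_minimal[OF fin[OF Suc(3)]] by blast
    have up: "up_closed (Z - {l})" using Suc(3) l by (auto simp: up_closed_def)
    have "n = card (Z - {l})" using Suc(2) l fin[OF Suc(3)] by simp
    from Suc(1)[OF this up] have "(heredity_layer A)\<^sup>*\<^sup>* {\<zero>\<^bsub>A\<^esub>} (cell_ideal (Z - {l}))" .
    moreover have "heredity_layer A (cell_ideal (Z - {l})) (cell_ideal Z)"
      using \<open>Z \<subseteq> \<Lambda>\<close> l(1) nz by (intro heredity_layer_cell Suc(3) l(1) up) auto
    ultimately show ?case by (rule rtranclp.rtrancl_into_rtrancl)
  }
qed

end

theorem cell_algebra_heredity_chain:
  assumes "cell_algebra K A X" "cell_poset_0 K A X = cell_poset X"
  shows "(heredity_layer A)\<^sup>*\<^sup>* {\<zero>\<^bsub>A\<^esub>} (carrier A)"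
proof -
  interpret assoc_algebra K A using assms(1) by (simp add: cell_algebra_def)
  interpret cell_algebra_basis K A X by unfold_locales (rule assms(1))
  have "up_closed \<Lambda>"
    using order by (auto simp: up_closed_def partial_order_on_def preorder_on_def refl_on_def)
  moreover have "cell_ideal \<Lambda> = carrier A" by (auto simp: cell_ideal_def idx_iff)
  ultimately show ?thesis using heredity_chain_cell_ideal[OF assms(2), of \<Lambda>] by simp
qed

section \<open>Algebras of finite monoids\<close>

locale finite_monoid_algebra = K?: field K + Mon: monoid M for K (structure) and M (structure) +
  assumes finite_M: "finite (carrier M)"
begin

abbreviation A :: "('a, 'c \<Rightarrow> 'a) module" where "A \<equiv> monoid_algebra K M"

definition delta :: "'c \<Rightarrow> 'c \<Rightarrow> 'a" where "delta m = (\<lambda>x. if x = m then \<one> else \<zero>)"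

definition factor_pairs :: "'c \<Rightarrow> ('c \<times> 'c) set" where
  "factor_pairs x = {p \<in> carrier M \<times> carrier M. fst p \<otimes>\<^bsub>M\<^esub> snd p = x}"

lemma finite_factor_pairs: "finite (factor_pairs x)"
  unfolding factor_pairs_def using finite_M by auto

lemma mem_carrier_iff: "f \<in> carrier A \<longleftrightarrow> (\<forall>x. f x \<in> carrier K) \<and> (\<forall>x. x \<notin> carrier M \<longrightarrow> f x = \<zero>)"
proof -
  have "finite {i. f i \<noteq> \<zero>}" if "\<forall>x. x \<notin> carrier M \<longrightarrow> f x = \<zero>"
    using that by (intro finite_subset[OF _ finite_M]) auto
  then show ?thesis by (auto simp: monoid_algebra_def fin_supp_def)
qed

lemma coeff_closed: "f \<in> carrier A \<Longrightarrow> f x \<in> carrier K"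
  and coeff_outside: "f \<in> carrier A \<Longrightarrow> x \<notin> carrier M \<Longrightarrow> f x = \<zero>"
  by (auto simp: mem_carrier_iff)

lemma add_apply: "(f \<oplus>\<^bsub>A\<^esub> g) x = f x \<oplus> g x"
  and smult_apply: "(c \<odot>\<^bsub>A\<^esub> f) x = c \<otimes> f x"
  and zero_apply: "\<zero>\<^bsub>A\<^esub> x = \<zero>"
  by (simp_all add: monoid_algebra_def)

lemma one_eq: "\<one>\<^bsub>A\<^esub> = delta \<one>\<^bsub>M\<^esub>"
  by (simp add: monoid_algebra_def delta_def)

lemma mult_apply:
  assumes "f \<in> carrier A" "g \<in> carrier A"
  shows "(f \<otimes>\<^bsub>A\<^esub> g) x = (\<Oplus>p\<in>factor_pairs x. f (fst p) \<otimes> g (snd p))"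
proof -
  let ?N = "{(y, z). f y \<noteq> \<zero> \<and> g z \<noteq> \<zero> \<and> y \<otimes>\<^bsub>M\<^esub> z = x}"
  have "(f \<otimes>\<^bsub>A\<^esub> g) x = (\<Oplus>p\<in>?N. f (fst p) \<otimes> g (snd p))" by (simp add: monoid_algebra_def)
  also have "\<dots> = (\<Oplus>p\<in>factor_pairs x. f (fst p) \<otimes> g (snd p))"
  proof (rule K.add.finprod_mono_neutral_cong_left)
    show "?N \<subseteq> factor_pairs x"
      using assms coeff_outside by (fastforce simp: factor_pairs_def)
    fix p assume p: "p \<in> factor_pairs x - ?N"
    then have "f (fst p) = \<zero> \<or> g (snd p) = \<zero>" by (auto simp: factor_pairs_def)
    then show "f (fst p) \<otimes> g (snd p) = \<zero>" using assms coeff_closed by auto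
  qed (use assms coeff_closed finite_factor_pairs in auto)
  finally show ?thesis .
qed

lemma mult_coeff_nonzero:
  assumes "f \<in> carrier A" "g \<in> carrier A" "(f \<otimes>\<^bsub>A\<^esub> g) x \<noteq> \<zero>"
  obtains y z where "y \<in> carrier M" "z \<in> carrier M" "f y \<noteq> \<zero>" "g z \<noteq> \<zero>" "x = y \<otimes>\<^bsub>M\<^esub> z"
proof (rule ccontr)
  note witness = that
  assume no: "\<not> thesis"
  have "f (fst p) \<otimes> g (snd p) = \<zero>" if "p \<in> factor_pairs x" for p
  proof -
    have "f (fst p) = \<zero> \<or> g (snd p) = \<zero>"
      using no witness[of "fst p" "snd p"] that unfolding factor_pairs_def by force
    then show ?thesis using assms(1,2) coeff_closed by auto
  qed
  then have "(f \<otimes>\<^bsub>A\<^esub> g) x = \<zero>" unfolding mult_apply[OF assms(1,2)] by (rule K.finsum_all_zero)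
  then show False using assms(3) by simp
qed

lemma delta_closed: "m \<in> carrier M \<Longrightarrow> delta m \<in> carrier A"
  by (auto simp: mem_carrier_iff delta_def)

lemma alg_add_closed: "\<lbrakk>f \<in> carrier A; g \<in> carrier A\<rbrakk> \<Longrightarrow> f \<oplus>\<^bsub>A\<^esub> g \<in> carrier A"
  and alg_zero_closed: "\<zero>\<^bsub>A\<^esub> \<in> carrier A"
  and alg_smult_closed: "\<lbrakk>c \<in> carrier K; f \<in> carrier A\<rbrakk> \<Longrightarrow> c \<odot>\<^bsub>A\<^esub> f \<in> carrier A"
  by (auto simp: mem_carrier_iff add_apply smult_apply zero_apply)

lemma alg_mult_closed:
  assumes "f \<in> carrier A" "g \<in> carrier A"
  shows "f \<otimes>\<^bsub>A\<^esub> g \<in> carrier A"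
  unfolding mem_carrier_iff
proof (intro conjI allI impI)
  fix x
  show "(f \<otimes>\<^bsub>A\<^esub> g) x \<in> carrier K"
    unfolding mult_apply[OF assms] using assms coeff_closed by (intro K.finsum_closed) auto
  assume "x \<notin> carrier M"
  then show "(f \<otimes>\<^bsub>A\<^esub> g) x = \<zero>" using mult_coeff_nonzero[OF assms] by blast
qed

lemma abelian_group_A: "abelian_group A"
proof (rule abelian_groupI)
  fix f assume f: "f \<in> carrier A"
  have "\<ominus> \<one> \<odot>\<^bsub>A\<^esub> f \<oplus>\<^bsub>A\<^esub> f = \<zero>\<^bsub>A\<^esub>"
    by (rule ext) (simp add: add_apply smult_apply zero_apply l_minus K.l_neg coeff_closed[OF f])
  then show "\<exists>g\<in>carrier A. g \<oplus>\<^bsub>A\<^esub> f = \<zero>\<^bsub>A\<^esub>" 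
    using f by (intro bexI[of _ "\<ominus> \<one> \<odot>\<^bsub>A\<^esub> f"] alg_smult_closed) auto
qed (auto simp: alg_add_closed alg_zero_closed fun_eq_iff add_apply zero_apply coeff_closed K.a_ac)

lemma module_A: "module K A"
  by (intro moduleI K.is_cring abelian_group_A alg_smult_closed)
    (auto simp: fun_eq_iff add_apply smult_apply coeff_closed K.l_distr K.r_distr K.m_assoc)

lemma finsum_apply:
  assumes "g \<in> S \<rightarrow> carrier A"
  shows "(\<Oplus>\<^bsub>A\<^esub>i\<in>S. g i) x = (\<Oplus>i\<in>S. g i x)"
  using additive_map_finsum[OF abelian_group_A K.is_abelian_group, of "\<lambda>f. f x" g S] assms
  by (auto simp: add_apply coeff_closed)

text \<open>Linear extension: a subspace containing all monoid elements is the whole algebra.\<close>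

lemma algebra_induct:
  assumes f: "f \<in> carrier A"
    and N: "\<zero>\<^bsub>A\<^esub> \<in> N" "N \<subseteq> carrier A" "\<And>x y. \<lbrakk>x \<in> N; y \<in> N\<rbrakk> \<Longrightarrow> x \<oplus>\<^bsub>A\<^esub> y \<in> N"
      "\<And>c x. \<lbrakk>c \<in> carrier K; x \<in> N\<rbrakk> \<Longrightarrow> c \<odot>\<^bsub>A\<^esub> x \<in> N"
    and delta: "\<And>m. \<lbrakk>m \<in> carrier M; f m \<noteq> \<zero>\<rbrakk> \<Longrightarrow> delta m \<in> N"
  shows "f \<in> N"
proof -
  interpret A: abelian_group A by (rule abelian_group_A)
  have tc: "(\<lambda>m. f m \<odot>\<^bsub>A\<^esub> delta m) \<in> carrier M \<rightarrow> carrier A"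
    using f by (auto intro!: alg_smult_closed delta_closed simp: coeff_closed)
  have "(\<Oplus>\<^bsub>A\<^esub>m\<in>carrier M. f m \<odot>\<^bsub>A\<^esub> delta m) = f"
  proof
    fix x
    have *: "(\<Oplus>\<^bsub>A\<^esub>m\<in>carrier M. f m \<odot>\<^bsub>A\<^esub> delta m) x = (\<Oplus>m\<in>carrier M. f m \<otimes> delta m x)"
      using finsum_apply[OF tc] by (simp add: smult_apply)
    show "(\<Oplus>\<^bsub>A\<^esub>m\<in>carrier M. f m \<odot>\<^bsub>A\<^esub> delta m) x = f x"
    proof (cases "x \<in> carrier M")
      case True
      then show ?thesis unfolding * using f finite_M
        by (subst K.finsum_single[where i = x]) (auto simp: delta_def coeff_closed)
    next
      case False
      then have "(\<Oplus>m\<in>carrier M. f m \<otimes> delta m x) = \<zero>"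
        using f by (intro K.finsum_all_zero) (auto simp: delta_def coeff_closed)
      then show ?thesis unfolding * using coeff_outside[OF f False] by simp
    qed
  qed
  moreover have "(\<Oplus>\<^bsub>A\<^esub>m\<in>carrier M. f m \<odot>\<^bsub>A\<^esub> delta m) \<in> N"
  proof (rule A.finsum_mem[OF N(1-3)])
    fix m assume m: "m \<in> carrier M"
    show "f m \<odot>\<^bsub>A\<^esub> delta m \<in> N"
    proof (cases "f m = \<zero>")
      case True
      have "\<zero> \<odot>\<^bsub>A\<^esub> delta m = \<zero>\<^bsub>A\<^esub>" by (auto simp: fun_eq_iff smult_apply zero_apply delta_def)
      then show ?thesis using True N(1) by simp
    next
      case False
      then show ?thesis using delta[OF m] f by (intro N(4) coeff_closed)
    qed
  qed
  ultimately show ?thesis by simp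
qed

lemma mult_l_distr:
  assumes "f \<in> carrier A" "g \<in> carrier A" "h \<in> carrier A"
  shows "(f \<oplus>\<^bsub>A\<^esub> g) \<otimes>\<^bsub>A\<^esub> h = f \<otimes>\<^bsub>A\<^esub> h \<oplus>\<^bsub>A\<^esub> g \<otimes>\<^bsub>A\<^esub> h"
proof
  fix x
  have c: "(\<lambda>p. f (fst p) \<otimes> h (snd p)) \<in> factor_pairs x \<rightarrow> carrier K"
    "(\<lambda>p. g (fst p) \<otimes> h (snd p)) \<in> factor_pairs x \<rightarrow> carrier K"
    using assms coeff_closed by auto
  have "((f \<oplus>\<^bsub>A\<^esub> g) \<otimes>\<^bsub>A\<^esub> h) x = (\<Oplus>p\<in>factor_pairs x. (f \<oplus>\<^bsub>A\<^esub> g) (fst p) \<otimes> h (snd p))"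
    by (rule mult_apply[OF alg_add_closed[OF assms(1,2)] assms(3)])
  also have "\<dots> = (\<Oplus>p\<in>factor_pairs x. f (fst p) \<otimes> h (snd p) \<oplus> g (fst p) \<otimes> h (snd p))"
    using assms coeff_closed by (intro K.finsum_cong') (auto simp: add_apply K.l_distr)
  also have "\<dots> = (f \<otimes>\<^bsub>A\<^esub> h \<oplus>\<^bsub>A\<^esub> g \<otimes>\<^bsub>A\<^esub> h) x"
    using assms by (simp add: K.finsum_addf[OF c] mult_apply add_apply)
  finally show "((f \<oplus>\<^bsub>A\<^esub> g) \<otimes>\<^bsub>A\<^esub> h) x = (f \<otimes>\<^bsub>A\<^esub> h \<oplus>\<^bsub>A\<^esub> g \<otimes>\<^bsub>A\<^esub> h) x" .
qed

lemma mult_r_distr: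
  assumes "f \<in> carrier A" "g \<in> carrier A" "h \<in> carrier A"
  shows "h \<otimes>\<^bsub>A\<^esub> (f \<oplus>\<^bsub>A\<^esub> g) = h \<otimes>\<^bsub>A\<^esub> f \<oplus>\<^bsub>A\<^esub> h \<otimes>\<^bsub>A\<^esub> g"
proof
  fix x
  have c: "(\<lambda>p. h (fst p) \<otimes> f (snd p)) \<in> factor_pairs x \<rightarrow> carrier K"
    "(\<lambda>p. h (fst p) \<otimes> g (snd p)) \<in> factor_pairs x \<rightarrow> carrier K"
    using assms coeff_closed by auto
  have "(h \<otimes>\<^bsub>A\<^esub> (f \<oplus>\<^bsub>A\<^esub> g)) x = (\<Oplus>p\<in>factor_pairs x. h (fst p) \<otimes> (f \<oplus>\<^bsub>A\<^esub> g) (snd p))"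
    by (rule mult_apply[OF assms(3) alg_add_closed[OF assms(1,2)]])
  also have "\<dots> = (\<Oplus>p\<in>factor_pairs x. h (fst p) \<otimes> f (snd p) \<oplus> h (fst p) \<otimes> g (snd p))"
    using assms coeff_closed by (intro K.finsum_cong') (auto simp: add_apply K.r_distr)
  also have "\<dots> = (h \<otimes>\<^bsub>A\<^esub> f \<oplus>\<^bsub>A\<^esub> h \<otimes>\<^bsub>A\<^esub> g) x"
    using assms by (simp add: K.finsum_addf[OF c] mult_apply add_apply)
  finally show "(h \<otimes>\<^bsub>A\<^esub> (f \<oplus>\<^bsub>A\<^esub> g)) x = (h \<otimes>\<^bsub>A\<^esub> f \<oplus>\<^bsub>A\<^esub> h \<otimes>\<^bsub>A\<^esub> g) x" .
qed

lemma mult_smult: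
  assumes "c \<in> carrier K" "f \<in> carrier A" "g \<in> carrier A"
  shows "(c \<odot>\<^bsub>A\<^esub> f) \<otimes>\<^bsub>A\<^esub> g = c \<odot>\<^bsub>A\<^esub> (f \<otimes>\<^bsub>A\<^esub> g)"
    and "f \<otimes>\<^bsub>A\<^esub> (c \<odot>\<^bsub>A\<^esub> g) = c \<odot>\<^bsub>A\<^esub> (f \<otimes>\<^bsub>A\<^esub> g)"
proof -
  have c: "(\<lambda>p. f (fst p) \<otimes> g (snd p)) \<in> factor_pairs x \<rightarrow> carrier K" for x
    using assms coeff_closed by auto
  have d: "c \<otimes> (f \<otimes>\<^bsub>A\<^esub> g) x = (\<Oplus>p\<in>factor_pairs x. c \<otimes> (f (fst p) \<otimes> g (snd p)))" for x
    using assms mult_apply[OF assms(2,3)] K.finsum_rdistr[OF finite_factor_pairs assms(1) c] by simp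
  show "(c \<odot>\<^bsub>A\<^esub> f) \<otimes>\<^bsub>A\<^esub> g = c \<odot>\<^bsub>A\<^esub> (f \<otimes>\<^bsub>A\<^esub> g)"
  proof
    fix x
    have "((c \<odot>\<^bsub>A\<^esub> f) \<otimes>\<^bsub>A\<^esub> g) x = (\<Oplus>p\<in>factor_pairs x. (c \<odot>\<^bsub>A\<^esub> f) (fst p) \<otimes> g (snd p))"
      by (rule mult_apply[OF alg_smult_closed[OF assms(1,2)] assms(3)])
    also have "\<dots> = (\<Oplus>p\<in>factor_pairs x. c \<otimes> (f (fst p) \<otimes> g (snd p)))"
      using assms coeff_closed by (intro K.finsum_cong') (auto simp: smult_apply K.m_assoc)
    finally show "((c \<odot>\<^bsub>A\<^esub> f) \<otimes>\<^bsub>A\<^esub> g) x = (c \<odot>\<^bsub>A\<^esub> (f \<otimes>\<^bsub>A\<^esub> g)) x"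
      using d[of x] smult_apply[of c "f \<otimes>\<^bsub>A\<^esub> g" x] by simp
  qed
  show "f \<otimes>\<^bsub>A\<^esub> (c \<odot>\<^bsub>A\<^esub> g) = c \<odot>\<^bsub>A\<^esub> (f \<otimes>\<^bsub>A\<^esub> g)"
  proof
    fix x
    have "(f \<otimes>\<^bsub>A\<^esub> (c \<odot>\<^bsub>A\<^esub> g)) x = (\<Oplus>p\<in>factor_pairs x. f (fst p) \<otimes> (c \<odot>\<^bsub>A\<^esub> g) (snd p))"
      by (rule mult_apply[OF assms(2) alg_smult_closed[OF assms(1,3)]])
    also have "\<dots> = (\<Oplus>p\<in>factor_pairs x. c \<otimes> (f (fst p) \<otimes> g (snd p)))"
      using assms coeff_closed by (intro K.finsum_cong') (auto simp: smult_apply K.m_lcomm)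
    finally show "(f \<otimes>\<^bsub>A\<^esub> (c \<odot>\<^bsub>A\<^esub> g)) x = (c \<odot>\<^bsub>A\<^esub> (f \<otimes>\<^bsub>A\<^esub> g)) x"
      using d[of x] smult_apply[of c "f \<otimes>\<^bsub>A\<^esub> g" x] by simp
  qed
qed

lemma delta_mult:
  assumes "m \<in> carrier M" "n \<in> carrier M"
  shows "delta m \<otimes>\<^bsub>A\<^esub> delta n = delta (m \<otimes>\<^bsub>M\<^esub> n)"
proof
  fix x
  have *: "(delta m \<otimes>\<^bsub>A\<^esub> delta n) x = (\<Oplus>p\<in>factor_pairs x. delta m (fst p) \<otimes> delta n (snd p))"
    by (rule mult_apply[OF assms[THEN delta_closed]])
  show "(delta m \<otimes>\<^bsub>A\<^esub> delta n) x = delta (m \<otimes>\<^bsub>M\<^esub> n) x"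
  proof (cases "m \<otimes>\<^bsub>M\<^esub> n = x")
    case True
    then have "(m, n) \<in> factor_pairs x" using assms by (simp add: factor_pairs_def)
    then show ?thesis unfolding * using True finite_factor_pairs
      by (subst K.finsum_single[where i = "(m, n)"]) (auto simp: delta_def)
  next
    case False
    then have "(\<Oplus>p\<in>factor_pairs x. delta m (fst p) \<otimes> delta n (snd p)) = \<zero>"
      by (intro K.finsum_all_zero) (auto simp: delta_def factor_pairs_def)
    then show ?thesis unfolding * using False by (auto simp: delta_def)
  qed
qed

lemma mult_zero:
  assumes "f \<in> carrier A"
  shows "\<zero>\<^bsub>A\<^esub> \<otimes>\<^bsub>A\<^esub> f = \<zero>\<^bsub>A\<^esub>" "f \<otimes>\<^bsub>A\<^esub> \<zero>\<^bsub>A\<^esub> = \<zero>\<^bsub>A\<^esub>"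
proof -
  have z: "\<zero> \<odot>\<^bsub>A\<^esub> g = \<zero>\<^bsub>A\<^esub>" if "g \<in> carrier A" for g
    using that by (auto simp: fun_eq_iff smult_apply zero_apply coeff_closed)
  show "\<zero>\<^bsub>A\<^esub> \<otimes>\<^bsub>A\<^esub> f = \<zero>\<^bsub>A\<^esub>"
    using mult_smult(1)[of \<zero> "\<zero>\<^bsub>A\<^esub>" f] assms z alg_zero_closed alg_mult_closed by simp
  show "f \<otimes>\<^bsub>A\<^esub> \<zero>\<^bsub>A\<^esub> = \<zero>\<^bsub>A\<^esub>"
    using mult_smult(2)[of \<zero> f "\<zero>\<^bsub>A\<^esub>"] assms z alg_zero_closed alg_mult_closed by simp
qed

text \<open>
  Two linear maps on the monoid algebra that agree on the monoid are equal.
\<close>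

lemma algebra_induct_eq:
  assumes f: "f \<in> carrier A" and FH: "abelian_group B"
    and F: "\<And>f. f \<in> carrier A \<Longrightarrow> F f \<in> carrier B" "\<And>f. f \<in> carrier A \<Longrightarrow> H f \<in> carrier B"
    and add: "\<And>f g. \<lbrakk>f \<in> carrier A; g \<in> carrier A\<rbrakk> \<Longrightarrow> F (f \<oplus>\<^bsub>A\<^esub> g) = F f \<oplus>\<^bsub>B\<^esub> F g"
      "\<And>f g. \<lbrakk>f \<in> carrier A; g \<in> carrier A\<rbrakk> \<Longrightarrow> H (f \<oplus>\<^bsub>A\<^esub> g) = H f \<oplus>\<^bsub>B\<^esub> H g"
    and smult: "\<And>c f. \<lbrakk>c \<in> carrier K; f \<in> carrier A\<rbrakk> \<Longrightarrow> F (c \<odot>\<^bsub>A\<^esub> f) = c \<odot>\<^bsub>B\<^esub> F f"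
      "\<And>c f. \<lbrakk>c \<in> carrier K; f \<in> carrier A\<rbrakk> \<Longrightarrow> H (c \<odot>\<^bsub>A\<^esub> f) = c \<odot>\<^bsub>B\<^esub> H f"
    and delta: "\<And>m. m \<in> carrier M \<Longrightarrow> F (delta m) = H (delta m)"
  shows "F f = H f"
proof -
  have "F \<zero>\<^bsub>A\<^esub> = \<zero>\<^bsub>B\<^esub>" "H \<zero>\<^bsub>A\<^esub> = \<zero>\<^bsub>B\<^esub>"
    using F add by (auto intro!: additive_map_zero[OF abelian_group_A FH])
  then have "f \<in> {f \<in> carrier A. F f = H f}"
    using add smult delta by (intro algebra_induct[OF f]) (auto simp: alg_zero_closed alg_add_closed alg_smult_closed delta_closed)
  then show ?thesis by simp
qed

lemma mult_assoc:
  assumes f: "f \<in> carrier A" and g: "g \<in> carrier A" and h: "h \<in> carrier A"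
  shows "f \<otimes>\<^bsub>A\<^esub> g \<otimes>\<^bsub>A\<^esub> h = f \<otimes>\<^bsub>A\<^esub> (g \<otimes>\<^bsub>A\<^esub> h)"
proof -
  note linear = alg_mult_closed delta_closed mult_l_distr mult_r_distr mult_smult
  have 1: "delta a \<otimes>\<^bsub>A\<^esub> delta b \<otimes>\<^bsub>A\<^esub> h = delta a \<otimes>\<^bsub>A\<^esub> (delta b \<otimes>\<^bsub>A\<^esub> h)"
    if "a \<in> carrier M" "b \<in> carrier M" "h \<in> carrier A" for a b h
    by (rule algebra_induct_eq[OF that(3) abelian_group_A]; simp add: linear that delta_mult Mon.m_assoc)
  have 2: "delta a \<otimes>\<^bsub>A\<^esub> g \<otimes>\<^bsub>A\<^esub> h = delta a \<otimes>\<^bsub>A\<^esub> (g \<otimes>\<^bsub>A\<^esub> h)"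
    if "a \<in> carrier M" "g \<in> carrier A" "h \<in> carrier A" for a g h
    by (rule algebra_induct_eq[OF that(2) abelian_group_A]; simp add: linear that 1)
  show ?thesis
    by (rule algebra_induct_eq[OF f abelian_group_A]; simp add: linear g h 2)
qed

lemma mult_one:
  assumes "f \<in> carrier A"
  shows "\<one>\<^bsub>A\<^esub> \<otimes>\<^bsub>A\<^esub> f = f" "f \<otimes>\<^bsub>A\<^esub> \<one>\<^bsub>A\<^esub> = f"
proof -
  have one: "\<one>\<^bsub>A\<^esub> \<in> carrier A" by (simp add: one_eq delta_closed)
  show "\<one>\<^bsub>A\<^esub> \<otimes>\<^bsub>A\<^esub> f = f"
    by (rule algebra_induct_eq[OF assms abelian_group_A])
      (simp_all add: one alg_mult_closed mult_r_distr mult_smult, simp add: one_eq delta_mult)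
  show "f \<otimes>\<^bsub>A\<^esub> \<one>\<^bsub>A\<^esub> = f"
    by (rule algebra_induct_eq[OF assms abelian_group_A])
      (simp_all add: one alg_mult_closed mult_l_distr mult_smult, simp add: one_eq delta_mult)
qed

lemma ring_A: "ring A"
proof (rule ringI[OF abelian_group_A])
  have "\<one>\<^bsub>A\<^esub> \<in> carrier A" by (simp add: one_eq delta_closed)
  then show "monoid A"
    by (intro monoidI) (auto simp: alg_mult_closed mult_assoc mult_one)
qed (auto simp: mult_l_distr mult_r_distr)

sublocale A: assoc_algebra K A
  by (intro assoc_algebra.intro assoc_algebra_axioms.intro K.field_axioms module_A ring_A)
    (auto simp: mult_smult)

definition supported_on :: "'c set \<Rightarrow> ('c \<Rightarrow> 'a) set" where
  "supported_on S = {f \<in> carrier A. \<forall>m. m \<notin> S \<longrightarrow> f m = \<zero>}"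

lemma minus_apply: "\<lbrakk>f \<in> carrier A; g \<in> carrier A\<rbrakk> \<Longrightarrow> (f \<ominus>\<^bsub>A\<^esub> g) x = f x \<ominus> g x"
  using A.smult_l_minus[of \<one> g] smult_apply[of "\<ominus> \<one>" g x] coeff_closed[of g x]
  by (simp add: a_minus_def add_apply K.l_minus)

lemma supported_on_closed:
  "\<zero>\<^bsub>A\<^esub> \<in> supported_on S" "supported_on S \<subseteq> carrier A"
  "\<lbrakk>f \<in> supported_on S; g \<in> supported_on S\<rbrakk> \<Longrightarrow> f \<oplus>\<^bsub>A\<^esub> g \<in> supported_on S"
  "\<lbrakk>c \<in> carrier K; f \<in> supported_on S\<rbrakk> \<Longrightarrow> c \<odot>\<^bsub>A\<^esub> f \<in> supported_on S"
  by (auto simp: supported_on_def alg_zero_closed alg_add_closed alg_smult_closed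
      zero_apply add_apply smult_apply)

lemma delta_supported_on: "\<lbrakk>m \<in> carrier M; m \<in> S\<rbrakk> \<Longrightarrow> delta m \<in> supported_on S"
  by (auto simp: supported_on_def delta_closed) (auto simp: delta_def)

text \<open>
  The empty set is included; it is where the chain of ideals of \<open>k[M]\<close> starts.
\<close>

definition monoid_ideal :: "'c set \<Rightarrow> bool" where
  "monoid_ideal Y \<longleftrightarrow> Y \<subseteq> carrier M \<and>
     (\<forall>y\<in>Y. \<forall>x\<in>carrier M. x \<otimes>\<^bsub>M\<^esub> y \<in> Y \<and> y \<otimes>\<^bsub>M\<^esub> x \<in> Y)"

lemma ideal_supported_on:
  assumes "monoid_ideal Y"
  shows "ideal (supported_on Y) A"
proof (rule idealI_closed)
  fix f a assume f: "f \<in> supported_on Y" and a: "a \<in> carrier A"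
  have fc: "f \<in> carrier A" and f0: "\<And>m. f m \<noteq> \<zero> \<Longrightarrow> m \<in> Y" using f by (auto simp: supported_on_def)
  have "m \<in> Y" if nz: "(a \<otimes>\<^bsub>A\<^esub> f) m \<noteq> \<zero>" for m
  proof -
    obtain y z where "y \<in> carrier M" "f z \<noteq> \<zero>" "m = y \<otimes>\<^bsub>M\<^esub> z" using mult_coeff_nonzero[OF a fc nz] by blast
    then show ?thesis using f0 assms unfolding monoid_ideal_def by blast
  qed
  then show "a \<otimes>\<^bsub>A\<^esub> f \<in> supported_on Y"
    using alg_mult_closed[OF a fc] unfolding supported_on_def by blast
  have "m \<in> Y" if nz: "(f \<otimes>\<^bsub>A\<^esub> a) m \<noteq> \<zero>" for m
  proof -
    obtain y z where "z \<in> carrier M" "f y \<noteq> \<zero>" "m = y \<otimes>\<^bsub>M\<^esub> z" using mult_coeff_nonzero[OF fc a nz] by blast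
    then show ?thesis using f0 assms unfolding monoid_ideal_def by blast
  qed
  then show "f \<otimes>\<^bsub>A\<^esub> a \<in> supported_on Y"
    using alg_mult_closed[OF fc a] unfolding supported_on_def by blast
qed (simp_all add: supported_on_closed ring_A)

lemma supported_on_carrier: "supported_on (carrier M) = carrier A"
  by (auto simp: supported_on_def coeff_outside)

lemma supported_on_empty: "supported_on {} = {\<zero>\<^bsub>A\<^esub>}"
  by (auto simp: supported_on_def fun_eq_iff zero_apply alg_zero_closed)

end

section \<open>Lifting heredity layers\<close>

text \<open>
  The shape of a regular D-class on top of a monoid ideal \<open>Y\<close>. The elements of the class are the
  products \<open>a (j g) b\<close>, with \<open>a\<close> a row index in \<open>P\<close>, \<open>b\<close> a column index in \<open>Q\<close> and \<open>g\<close> in a finite monoid \<open>G\<close>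
  embedded by \<open>j\<close>; its unit is at once a row and a column index. Multiplication from the
  left acts on rows and multiplication from the right on columns, up to factors from \<open>G\<close>, and
  the products \<open>b a\<close> are the entries of the sandwich matrix. Whatever leaves the class falls into \<open>Y\<close>.
\<close>

locale rees_layer = AM: finite_monoid_algebra K M + AG: finite_monoid_algebra K G
  for K :: "('k, 'x) ring_scheme" and M :: "('m, 'y) monoid_scheme" and G :: "('g, 'z) monoid_scheme" +
  fixes Y P Q :: "'m set" and j :: "'g \<Rightarrow> 'm"
  assumes Y: "AM.monoid_ideal Y"
    and P: "P \<subseteq> carrier M" and Q: "Q \<subseteq> carrier M"
    and j_closed: "g \<in> carrier G \<Longrightarrow> j g \<in> carrier M"
    and j_mult: "\<lbrakk>g \<in> carrier G; h \<in> carrier G\<rbrakk> \<Longrightarrow> j (g \<otimes>\<^bsub>G\<^esub> h) = j g \<otimes>\<^bsub>M\<^esub> j h"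
    and e_P: "j \<one>\<^bsub>G\<^esub> \<in> P" and e_Q: "j \<one>\<^bsub>G\<^esub> \<in> Q"
    and rees_inj: "\<lbrakk>a \<in> P; a' \<in> P; b \<in> Q; b' \<in> Q; g \<in> carrier G; g' \<in> carrier G;
        a \<otimes>\<^bsub>M\<^esub> j g \<otimes>\<^bsub>M\<^esub> b = a' \<otimes>\<^bsub>M\<^esub> j g' \<otimes>\<^bsub>M\<^esub> b'\<rbrakk> \<Longrightarrow> a = a' \<and> g = g' \<and> b = b'"
    and rees_not_Y: "\<lbrakk>a \<in> P; b \<in> Q; g \<in> carrier G\<rbrakk> \<Longrightarrow> a \<otimes>\<^bsub>M\<^esub> j g \<otimes>\<^bsub>M\<^esub> b \<notin> Y"
    and left_action: "\<lbrakk>x \<in> carrier M; a \<in> P; x \<otimes>\<^bsub>M\<^esub> a \<notin> Y\<rbrakk> \<Longrightarrow>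
        \<exists>a'\<in>P. \<exists>g\<in>carrier G. x \<otimes>\<^bsub>M\<^esub> a = a' \<otimes>\<^bsub>M\<^esub> j g"
    and right_action: "\<lbrakk>x \<in> carrier M; b \<in> Q; b \<otimes>\<^bsub>M\<^esub> x \<notin> Y\<rbrakk> \<Longrightarrow>
        \<exists>b'\<in>Q. \<exists>g\<in>carrier G. b \<otimes>\<^bsub>M\<^esub> x = j g \<otimes>\<^bsub>M\<^esub> b'"
    and sandwich: "\<lbrakk>b \<in> Q; a \<in> P; b \<otimes>\<^bsub>M\<^esub> a \<notin> Y\<rbrakk> \<Longrightarrow> \<exists>g\<in>carrier G. b \<otimes>\<^bsub>M\<^esub> a = j g"
begin

abbreviation A where "A \<equiv> AM.A"
abbreviation B where "B \<equiv> AG.A"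
abbreviation e where "e \<equiv> j \<one>\<^bsub>G\<^esub>"

definition rees :: "'m \<Rightarrow> 'g \<Rightarrow> 'm \<Rightarrow> 'm" where "rees a g b = a \<otimes>\<^bsub>M\<^esub> j g \<otimes>\<^bsub>M\<^esub> b"

definition W :: "'m set" where "W = Y \<union> {rees a g b | a g b. a \<in> P \<and> g \<in> carrier G \<and> b \<in> Q}"

lemma P_closed: "a \<in> P \<Longrightarrow> a \<in> carrier M" and Q_closed: "b \<in> Q \<Longrightarrow> b \<in> carrier M"
  and e_closed: "e \<in> carrier M"
  using P Q j_closed by auto

lemma Y_left: "\<lbrakk>x \<in> carrier M; y \<in> Y\<rbrakk> \<Longrightarrow> x \<otimes>\<^bsub>M\<^esub> y \<in> Y"
  and Y_right: "\<lbrakk>x \<in> carrier M; y \<in> Y\<rbrakk> \<Longrightarrow> y \<otimes>\<^bsub>M\<^esub> x \<in> Y"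
  using Y by (auto simp: AM.monoid_ideal_def)

lemma rees_closed: "\<lbrakk>a \<in> P; b \<in> Q; g \<in> carrier G\<rbrakk> \<Longrightarrow> rees a g b \<in> carrier M"
  by (simp add: rees_def P_closed Q_closed j_closed)

lemma rees_eq_iff: "\<lbrakk>a \<in> P; a' \<in> P; b \<in> Q; b' \<in> Q; g \<in> carrier G; g' \<in> carrier G\<rbrakk> \<Longrightarrow>
    rees a g b = rees a' g' b' \<longleftrightarrow> a = a' \<and> g = g' \<and> b = b'"
  using rees_inj unfolding rees_def by metis

lemma j_e: "g \<in> carrier G \<Longrightarrow> e \<otimes>\<^bsub>M\<^esub> j g = j g" "g \<in> carrier G \<Longrightarrow> j g \<otimes>\<^bsub>M\<^esub> e = j g"
  using j_mult[of "\<one>\<^bsub>G\<^esub>" g] j_mult[of g "\<one>\<^bsub>G\<^esub>"] by auto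

lemma j_inj: "\<lbrakk>g \<in> carrier G; h \<in> carrier G; j g = j h\<rbrakk> \<Longrightarrow> g = h"
  using rees_inj[OF e_P e_P e_Q e_Q, of g h] by (simp add: j_e)

subsection \<open>Embedding and blocks\<close>

text \<open>
  \<open>embed\<close> extends \<open>j\<close> linearly to \<open>k[G]\<close>, \<open>block a b f\<close> is the matrix entry of \<open>f\<close> at row \<open>a\<close> and
  column \<open>b\<close>, and \<open>spread a f b\<close> is the matrix with the single entry \<open>f\<close> there.
\<close>

definition embed :: "('g \<Rightarrow> 'k) \<Rightarrow> 'm \<Rightarrow> 'k" where
  "embed f m = (if m \<in> j ` carrier G then f (the_inv_into (carrier G) j m) else \<zero>\<^bsub>K\<^esub>)"

definition block :: "'m \<Rightarrow> 'm \<Rightarrow> ('m \<Rightarrow> 'k) \<Rightarrow> 'g \<Rightarrow> 'k" where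
  "block a b f g = (if g \<in> carrier G then f (rees a g b) else \<zero>\<^bsub>K\<^esub>)"

definition spread :: "'m \<Rightarrow> ('g \<Rightarrow> 'k) \<Rightarrow> 'm \<Rightarrow> 'm \<Rightarrow> 'k" where
  "spread a f b = AM.delta a \<otimes>\<^bsub>A\<^esub> embed f \<otimes>\<^bsub>A\<^esub> AM.delta b"

lemmas A_closed = AM.alg_zero_closed AM.alg_add_closed AM.alg_smult_closed AM.alg_mult_closed AM.delta_closed
lemmas B_closed = AG.alg_zero_closed AG.alg_add_closed AG.alg_smult_closed AG.alg_mult_closed AG.delta_closed

lemma inj_j: "inj_on j (carrier G)" using j_inj by (auto simp: inj_on_def)

lemma embed_j: "g \<in> carrier G \<Longrightarrow> embed f (j g) = f g"
  by (simp add: embed_def the_inv_into_f_f[OF inj_j])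

lemma embed_outside: "m \<notin> j ` carrier G \<Longrightarrow> embed f m = \<zero>\<^bsub>K\<^esub>"
  by (simp add: embed_def)

lemma embed_ext: 
  assumes "\<And>g. g \<in> carrier G \<Longrightarrow> embed f (j g) = h (j g)" "\<And>m. m \<notin> j ` carrier G \<Longrightarrow> h m = \<zero>\<^bsub>K\<^esub>"
  shows "embed f = h"
proof
  fix m show "embed f m = h m" using assms by (cases "m \<in> j ` carrier G") (auto simp: embed_outside)
qed

lemma embed_closed: "f \<in> carrier B \<Longrightarrow> embed f \<in> carrier A"
  unfolding AM.mem_carrier_iff
proof (intro conjI allI impI)
  fix m assume f: "f \<in> carrier B"
  show "embed f m \<in> carrier K"
    using AG.coeff_closed[OF f] by (cases "m \<in> j ` carrier G") (auto simp: embed_j embed_outside)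
  assume "m \<notin> carrier M"
  then have "m \<notin> j ` carrier G" using j_closed by auto
  then show "embed f m = \<zero>\<^bsub>K\<^esub>" by (rule embed_outside)
qed

lemma embed_add: "embed (f \<oplus>\<^bsub>B\<^esub> g) = embed f \<oplus>\<^bsub>A\<^esub> embed g"
  by (rule embed_ext) (auto simp: embed_j embed_outside AM.add_apply AG.add_apply)

lemma embed_smult: "c \<in> carrier K \<Longrightarrow> embed (c \<odot>\<^bsub>B\<^esub> f) = c \<odot>\<^bsub>A\<^esub> embed f"
  by (rule embed_ext) (auto simp: embed_j embed_outside AM.smult_apply AG.smult_apply)

lemma embed_zero: "embed \<zero>\<^bsub>B\<^esub> = \<zero>\<^bsub>A\<^esub>"
  by (rule embed_ext) (auto simp: embed_j AM.zero_apply AG.zero_apply)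

lemma embed_delta: "g \<in> carrier G \<Longrightarrow> embed (AG.delta g) = AM.delta (j g)"
  by (rule embed_ext) (auto simp: embed_j AM.delta_def AG.delta_def dest: j_inj)

lemma embed_mult:
  assumes "f \<in> carrier B" "h \<in> carrier B"
  shows "embed (f \<otimes>\<^bsub>B\<^esub> h) = embed f \<otimes>\<^bsub>A\<^esub> embed h"
proof -
  note linear = A_closed B_closed embed_closed embed_add embed_smult AG.mult_l_distr AM.mult_l_distr
    AG.mult_r_distr AM.mult_r_distr AG.mult_smult AM.mult_smult
  have 1: "embed (AG.delta g \<otimes>\<^bsub>B\<^esub> h) = AM.delta (j g) \<otimes>\<^bsub>A\<^esub> embed h" if "g \<in> carrier G" "h \<in> carrier B" for g h
    by (rule AG.algebra_induct_eq[OF that(2) AM.abelian_group_A];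
        simp add: linear that j_closed embed_delta AG.delta_mult AM.delta_mult j_mult)
  show ?thesis
    by (rule AG.algebra_induct_eq[OF assms(1) AM.abelian_group_A];
        simp add: linear assms(2) j_closed embed_delta 1)
qed

lemma block_closed: "f \<in> carrier A \<Longrightarrow> block a b f \<in> carrier B"
  by (auto simp: AG.mem_carrier_iff block_def AM.coeff_closed)

lemma block_add: "block a b (f \<oplus>\<^bsub>A\<^esub> h) = block a b f \<oplus>\<^bsub>B\<^esub> block a b h"
  by (auto simp: block_def AM.add_apply AG.add_apply)

lemma block_smult: "c \<in> carrier K \<Longrightarrow> block a b (c \<odot>\<^bsub>A\<^esub> f) = c \<odot>\<^bsub>B\<^esub> block a b f"
  by (auto simp: block_def AM.smult_apply AG.smult_apply)

lemma block_zero: "block a b \<zero>\<^bsub>A\<^esub> = \<zero>\<^bsub>B\<^esub>"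
  by (auto simp: block_def AM.zero_apply AG.zero_apply)

lemma block_finsum:
  "h \<in> S \<rightarrow> carrier A \<Longrightarrow> block a b (\<Oplus>\<^bsub>A\<^esub>i\<in>S. h i) = (\<Oplus>\<^bsub>B\<^esub>i\<in>S. block a b (h i))"
  by (rule additive_map_finsum[OF AM.abelian_group_A AG.abelian_group_A])
    (auto simp: block_closed block_add)

lemma spread_closed: "\<lbrakk>a \<in> carrier M; b \<in> carrier M; f \<in> carrier B\<rbrakk> \<Longrightarrow> spread a f b \<in> carrier A"
  by (simp add: spread_def A_closed embed_closed)

lemma spread_linear:
  assumes "a \<in> carrier M" "b \<in> carrier M"
  shows "\<lbrakk>f \<in> carrier B; h \<in> carrier B\<rbrakk> \<Longrightarrow> spread a (f \<oplus>\<^bsub>B\<^esub> h) b = spread a f b \<oplus>\<^bsub>A\<^esub> spread a h b"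
    and "\<lbrakk>c \<in> carrier K; f \<in> carrier B\<rbrakk> \<Longrightarrow> spread a (c \<odot>\<^bsub>B\<^esub> f) b = c \<odot>\<^bsub>A\<^esub> spread a f b"
    and "spread a \<zero>\<^bsub>B\<^esub> b = \<zero>\<^bsub>A\<^esub>"
  using assms
  by (simp_all add: spread_def embed_add embed_smult embed_zero embed_closed A_closed AM.mult_r_distr
      AM.mult_l_distr AM.mult_smult AM.mult_zero)

lemma spread_delta:
  "\<lbrakk>a \<in> carrier M; b \<in> carrier M; g \<in> carrier G\<rbrakk> \<Longrightarrow> spread a (AG.delta g) b = AM.delta (rees a g b)"
  by (simp add: spread_def embed_delta AM.delta_mult j_closed rees_def)

lemma spread_supported:
  assumes "a \<in> P" "b \<in> Q" "f \<in> carrier B"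
  shows "spread a f b \<in> AM.supported_on {rees a g b | g. g \<in> carrier G}"
proof -
  let ?S = "AM.supported_on {rees a g b | g. g \<in> carrier G}"
  note c = P_closed[OF assms(1)] Q_closed[OF assms(2)]
  have "f \<in> {f \<in> carrier B. spread a f b \<in> ?S}"
  proof (rule AG.algebra_induct[OF assms(3)])
    fix g assume g: "g \<in> carrier G"
    then have "AM.delta (rees a g b) \<in> ?S"
      using assms(1,2) by (intro AM.delta_supported_on rees_closed) blast+
    then show "AG.delta g \<in> {f \<in> carrier B. spread a f b \<in> ?S}"
      by (simp add: spread_delta c g B_closed)
  qed (simp_all add: B_closed spread_linear c AM.supported_on_closed)
  then show ?thesis by simp
qed

lemma block_spread:
  assumes "a \<in> P" "b \<in> Q" "a' \<in> P" "b' \<in> Q" "f \<in> carrier B"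
  shows "block a' b' (spread a f b) = (if a' = a \<and> b' = b then f else \<zero>\<^bsub>B\<^esub>)"
proof -
  note c = P_closed[OF assms(1)] Q_closed[OF assms(2)]
  show ?thesis
  proof (rule AG.algebra_induct_eq[OF assms(5) AG.abelian_group_A])
    fix g assume g: "g \<in> carrier G"
    show "block a' b' (spread a (AG.delta g) b) = (if a' = a \<and> b' = b then AG.delta g else \<zero>\<^bsub>B\<^esub>)"
      unfolding spread_delta[OF c g] using assms g
      by (auto simp: fun_eq_iff block_def AM.delta_def AG.delta_def AG.zero_apply rees_eq_iff)
  qed (simp_all add: B_closed block_closed spread_closed c spread_linear block_add block_smult)
qed

lemma Y_sub_W: "AM.supported_on Y \<subseteq> AM.supported_on W"
  by (auto simp: AM.supported_on_def W_def)

lemma block_Y: "\<lbrakk>f \<in> AM.supported_on Y; a \<in> P; b \<in> Q\<rbrakk> \<Longrightarrow> block a b f = \<zero>\<^bsub>B\<^esub>"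
  using rees_not_Y unfolding rees_def[symmetric]
  by (auto simp: fun_eq_iff block_def AG.zero_apply AM.supported_on_def)

lemma spread_W: "\<lbrakk>a \<in> P; b \<in> Q; f \<in> carrier B\<rbrakk> \<Longrightarrow> spread a f b \<in> AM.supported_on W"
  using spread_supported[of a b f] unfolding AM.supported_on_def W_def by blast

lemma finite_PQ: "finite P" "finite Q"
  using P Q AM.finite_M by (auto dest: finite_subset)

text \<open>
  Modulo \<open>k[Y]\<close> an element is the sum of its matrix entries. Both sides have the same blocks, and blocks determine
  all coefficients outside \<open>Y\<close>.
\<close>

lemma block_decomposition:
  assumes f: "f \<in> AM.supported_on W"
  shows "f \<ominus>\<^bsub>A\<^esub> (\<Oplus>\<^bsub>A\<^esub>p\<in>P \<times> Q. spread (fst p) (block (fst p) (snd p) f) (snd p)) \<in> AM.supported_on Y"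
proof -
  let ?t = "\<lambda>p. spread (fst p) (block (fst p) (snd p) f) (snd p)"
  let ?F = "\<Oplus>\<^bsub>A\<^esub>p\<in>P \<times> Q. ?t p"
  have fc: "f \<in> carrier A" using f AM.supported_on_closed(2) by blast
  have tW: "?t p \<in> AM.supported_on W" if "p \<in> P \<times> Q" for p
    using that block_closed[OF fc] by (intro spread_W) auto
  have tc: "?t \<in> P \<times> Q \<rightarrow> carrier A" using tW AM.supported_on_closed(2) by blast
  have FW: "?F \<in> AM.supported_on W"
    by (rule AM.A.M.finsum_mem) (simp_all add: AM.supported_on_closed tW)
  then have Fc: "?F \<in> carrier A" using AM.supported_on_closed(2) by blast
  have blockF: "block a b ?F = block a b f" if ab: "a \<in> P" "b \<in> Q" for a b
  proof -
    have bt: "block a b (?t p) = (if p = (a, b) then block a b f else \<zero>\<^bsub>B\<^esub>)" if "p \<in> P \<times> Q" for p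
      using that ab block_closed[OF fc] by (auto simp: block_spread)
    have "block a b ?F = (\<Oplus>\<^bsub>B\<^esub>p\<in>P \<times> Q. block a b (?t p))" by (rule block_finsum[OF tc])
    also have "\<dots> = block a b (?t (a, b))"
      using bt ab block_closed[OF fc] finite_PQ by (intro AG.A.M.finsum_single) auto
    finally show ?thesis using bt[of "(a, b)"] ab by simp
  qed
  have "f m = ?F m" if m: "m \<notin> Y" for m
  proof (cases "m \<in> W")
    case True
    then obtain a g b where abg: "a \<in> P" "g \<in> carrier G" "b \<in> Q" and mr: "m = rees a g b"
      using m by (auto simp: W_def)
    then show ?thesis using fun_cong[OF blockF[OF abg(1,3)], of g] by (simp add: block_def)
  next
    case False
    then show ?thesis using f FW by (simp add: AM.supported_on_def)
  qed
  moreover have "?F m \<ominus>\<^bsub>K\<^esub> ?F m = \<zero>\<^bsub>K\<^esub>" for m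
    using AM.coeff_closed[OF Fc, of m] by (simp add: AM.A.K_minus_eq_zero_iff)
  ultimately show ?thesis
    using fc Fc AM.A.M.minus_closed[OF fc Fc] by (simp add: AM.supported_on_def AM.minus_apply)
qed

lemma supported_on_W_induct:
  assumes f: "f \<in> AM.supported_on W"
    and N: "AM.supported_on Y \<subseteq> N" "N \<subseteq> carrier A" "\<And>x y. \<lbrakk>x \<in> N; y \<in> N\<rbrakk> \<Longrightarrow> x \<oplus>\<^bsub>A\<^esub> y \<in> N"
    and blocks: "\<And>a b. \<lbrakk>a \<in> P; b \<in> Q\<rbrakk> \<Longrightarrow> spread a (block a b f) b \<in> N"
  shows "f \<in> N"
proof -
  let ?F = "\<Oplus>\<^bsub>A\<^esub>p\<in>P \<times> Q. spread (fst p) (block (fst p) (snd p) f) (snd p)"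
  have zero: "\<zero>\<^bsub>A\<^esub> \<in> N" using N(1) AM.supported_on_closed(1) by blast
  have F: "?F \<in> N" by (rule AM.A.M.finsum_mem[OF zero N(2,3)]) (auto intro: blocks)
  have fc: "f \<in> carrier A" using f AM.supported_on_closed(2) by blast
  have Fc: "?F \<in> carrier A" using F N(2) by blast
  have "(f \<ominus>\<^bsub>A\<^esub> ?F) \<oplus>\<^bsub>A\<^esub> ?F \<in> N"
    using block_decomposition[OF f] N(1) F by (intro N(3)) blast+
  also have "(f \<ominus>\<^bsub>A\<^esub> ?F) \<oplus>\<^bsub>A\<^esub> ?F = f"
    using fc Fc by (simp add: a_minus_def[of A] AM.A.M.a_assoc AM.A.M.l_neg)
  finally show ?thesis .
qed

definition lift :: "('g \<Rightarrow> 'k) set \<Rightarrow> ('m \<Rightarrow> 'k) set" where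
  "lift I = {f \<in> AM.supported_on W. \<forall>a\<in>P. \<forall>b\<in>Q. block a b f \<in> I}"

lemma lift_mono: "I \<subseteq> J \<Longrightarrow> lift I \<subseteq> lift J"
  unfolding lift_def by blast

lemma lift_carrier: "lift (carrier B) = AM.supported_on W"
  using AM.supported_on_closed(2)[of W] block_closed by (auto simp: lift_def)

lemma lift_zero: "lift {\<zero>\<^bsub>B\<^esub>} = AM.supported_on Y"
proof (intro equalityI subsetI)
  fix f assume f: "f \<in> lift {\<zero>\<^bsub>B\<^esub>}"
  have "f m = \<zero>\<^bsub>K\<^esub>" if m: "m \<notin> Y" for m
  proof (cases "m \<in> W")
    case True
    then obtain a g b where abg: "a \<in> P" "g \<in> carrier G" "b \<in> Q" and mr: "m = rees a g b"
      using m by (auto simp: W_def)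
    have "block a b f = \<zero>\<^bsub>B\<^esub>" using f abg by (simp add: lift_def)
    from fun_cong[OF this, of g] show ?thesis using abg mr by (simp add: block_def AG.zero_apply)
  next
    case False
    then show ?thesis using f by (simp add: lift_def AM.supported_on_def)
  qed
  then show "f \<in> AM.supported_on Y" using f by (simp add: lift_def AM.supported_on_def)
next
  fix f assume "f \<in> AM.supported_on Y"
  then show "f \<in> lift {\<zero>\<^bsub>B\<^esub>}" using Y_sub_W block_Y by (auto simp: lift_def)
qed

lemma lift_subset: "lift I \<subseteq> carrier A"
  using AM.supported_on_closed(2)[of W] by (auto simp: lift_def)

lemma Y_sub_lift:
  assumes "\<zero>\<^bsub>B\<^esub> \<in> I"
  shows "AM.supported_on Y \<subseteq> lift I"
  using lift_mono[of "{\<zero>\<^bsub>B\<^esub>}" I] assms by (simp add: lift_zero)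

lemma spread_lift:
  assumes "\<zero>\<^bsub>B\<^esub> \<in> I" "I \<subseteq> carrier B" "a \<in> P" "b \<in> Q" "f \<in> I"
  shows "spread a f b \<in> lift I"
proof -
  have f: "f \<in> carrier B" using assms by auto
  show ?thesis using assms by (simp add: lift_def spread_W f block_spread)
qed

lemma embed_e:
  assumes "z \<in> carrier B"
  shows "embed z \<otimes>\<^bsub>A\<^esub> AM.delta e = embed z" "AM.delta e \<otimes>\<^bsub>A\<^esub> embed z = embed z"
  using embed_mult[OF assms, of "\<one>\<^bsub>B\<^esub>"] embed_mult[of "\<one>\<^bsub>B\<^esub>" z] assms
  by (simp_all add: AG.one_eq B_closed embed_delta AG.mult_one[unfolded AG.one_eq])

lemma spread_e:
  assumes "z \<in> carrier B" "a \<in> carrier M"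
  shows "spread a z e = AM.delta a \<otimes>\<^bsub>A\<^esub> embed z"
  using assms by (simp add: spread_def AM.mult_assoc embed_closed A_closed e_closed embed_e)

lemma spread_e_e: "z \<in> carrier B \<Longrightarrow> spread e z e = embed z"
  by (simp add: spread_e e_closed embed_e)

text \<open>
  Multiplying a one-entry matrix by a monoid element moves the entry to another row or
  column and multiplies it by an element of \<open>G\<close>, so that it stays in the ideal \<open>I\<close>, or sends everything into \<open>k[Y]\<close>.
\<close>

lemma delta_spread_lift:
  assumes I: "ideal I B" and m: "m \<in> carrier M" and ab: "a \<in> P" "b \<in> Q" and i: "i \<in> I"
  shows "AM.delta m \<otimes>\<^bsub>A\<^esub> spread a i b \<in> lift I" "spread a i b \<otimes>\<^bsub>A\<^esub> AM.delta m \<in> lift I"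
proof -
  interpret I: ideal I B by fact
  note c = P_closed[OF ab(1)] Q_closed[OF ab(2)]
  have ic: "i \<in> carrier B" using I.a_subset i by blast
  note ec = embed_closed[OF ic]
  note YL = Y_sub_lift[OF I.zero_closed]
  have idY: "ideal (AM.supported_on Y) A" by (rule AM.ideal_supported_on[OF Y])
  have 1: "AM.delta m \<otimes>\<^bsub>A\<^esub> spread a i b = AM.delta (m \<otimes>\<^bsub>M\<^esub> a) \<otimes>\<^bsub>A\<^esub> (embed i \<otimes>\<^bsub>A\<^esub> AM.delta b)"
    using c m ec by (simp add: spread_def AM.mult_assoc A_closed AM.delta_mult[symmetric])
  show "AM.delta m \<otimes>\<^bsub>A\<^esub> spread a i b \<in> lift I"
  proof (cases "m \<otimes>\<^bsub>M\<^esub> a \<in> Y")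
    case True
    then have "AM.delta (m \<otimes>\<^bsub>M\<^esub> a) \<in> AM.supported_on Y"
      using m c by (intro AM.delta_supported_on) auto
    then show ?thesis unfolding 1
      using ideal.I_r_closed[OF idY] YL ec c by (meson A_closed subsetD)
  next
    case False
    then obtain a' g where a': "a' \<in> P" "g \<in> carrier G" "m \<otimes>\<^bsub>M\<^esub> a = a' \<otimes>\<^bsub>M\<^esub> j g"
      using left_action[OF m ab(1)] by auto
    have "AM.delta m \<otimes>\<^bsub>A\<^esub> spread a i b = spread a' (AG.delta g \<otimes>\<^bsub>B\<^esub> i) b"
      unfolding 1 a'(3) using c ec a' P_closed[OF a'(1)] j_closed[OF a'(2)] ic
      by (simp add: spread_def AM.mult_assoc A_closed AM.delta_mult[symmetric] embed_mult embed_delta B_closed)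
    also have "\<dots> \<in> lift I"
      using a' ab i I.I_l_closed[OF i AG.delta_closed[OF a'(2)]] I.a_subset I.zero_closed
      by (intro spread_lift)
    finally show ?thesis .
  qed
  have 2: "spread a i b \<otimes>\<^bsub>A\<^esub> AM.delta m = (AM.delta a \<otimes>\<^bsub>A\<^esub> embed i) \<otimes>\<^bsub>A\<^esub> AM.delta (b \<otimes>\<^bsub>M\<^esub> m)"
    using c m ec by (simp add: spread_def AM.mult_assoc A_closed AM.delta_mult[symmetric])
  show "spread a i b \<otimes>\<^bsub>A\<^esub> AM.delta m \<in> lift I"
  proof (cases "b \<otimes>\<^bsub>M\<^esub> m \<in> Y")
    case True
    then have "AM.delta (b \<otimes>\<^bsub>M\<^esub> m) \<in> AM.supported_on Y"
      using m c by (intro AM.delta_supported_on) auto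
    then show ?thesis unfolding 2
      using ideal.I_l_closed[OF idY] YL ec c by (meson A_closed subsetD)
  next
    case False
    then obtain b' g where b': "b' \<in> Q" "g \<in> carrier G" "b \<otimes>\<^bsub>M\<^esub> m = j g \<otimes>\<^bsub>M\<^esub> b'"
      using right_action[OF m ab(2)] by auto
    have "spread a i b \<otimes>\<^bsub>A\<^esub> AM.delta m = spread a (i \<otimes>\<^bsub>B\<^esub> AG.delta g) b'"
      unfolding 2 b'(3) using c ec b' Q_closed[OF b'(1)] j_closed[OF b'(2)] ic
      by (simp add: spread_def AM.mult_assoc A_closed AM.delta_mult[symmetric] embed_mult embed_delta B_closed)
    also have "\<dots> \<in> lift I"
      using b' ab i I.I_r_closed[OF i AG.delta_closed[OF b'(2)]] I.a_subset I.zero_closed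
      by (intro spread_lift)
    finally show ?thesis .
  qed
qed

lemma lift_closed:
  assumes I: "ideal I B"
  shows "\<zero>\<^bsub>A\<^esub> \<in> lift I" "\<lbrakk>f \<in> lift I; h \<in> lift I\<rbrakk> \<Longrightarrow> f \<oplus>\<^bsub>A\<^esub> h \<in> lift I"
    "\<lbrakk>c \<in> carrier K; f \<in> lift I\<rbrakk> \<Longrightarrow> c \<odot>\<^bsub>A\<^esub> f \<in> lift I"
proof -
  interpret I: ideal I B by fact
  show "\<zero>\<^bsub>A\<^esub> \<in> lift I" by (simp add: lift_def AM.supported_on_closed block_zero)
  show "\<lbrakk>f \<in> lift I; h \<in> lift I\<rbrakk> \<Longrightarrow> f \<oplus>\<^bsub>A\<^esub> h \<in> lift I"
    by (simp add: lift_def AM.supported_on_closed block_add)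
  show "\<lbrakk>c \<in> carrier K; f \<in> lift I\<rbrakk> \<Longrightarrow> c \<odot>\<^bsub>A\<^esub> f \<in> lift I"
    by (simp add: lift_def AM.supported_on_closed block_smult
        AG.A.right_ideal_smult[OF ideal_is_right_ideal[OF I]])
qed

lemma ideal_lift:
  assumes I: "ideal I B"
  shows "ideal (lift I) A"
proof (rule idealI_closed[OF AM.ring_A lift_subset lift_closed(1,2)[OF I]])
  interpret I: ideal I B by fact
  note YL = Y_sub_lift[OF I.zero_closed]
  have idY: "ideal (AM.supported_on Y) A" by (rule AM.ideal_supported_on[OF Y])
  note lc = lift_closed[OF I]
  fix f x assume f: "f \<in> lift I" and x: "x \<in> carrier A"
  have fc: "f \<in> carrier A" and fW: "f \<in> AM.supported_on W" and blocks: "\<And>a b. \<lbrakk>a \<in> P; b \<in> Q\<rbrakk> \<Longrightarrow> block a b f \<in> I"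
    using f lift_subset by (auto simp: lift_def)
  have delta: "AM.delta m \<otimes>\<^bsub>A\<^esub> f \<in> lift I \<and> f \<otimes>\<^bsub>A\<^esub> AM.delta m \<in> lift I" if m: "m \<in> carrier M" for m
  proof -
    let ?N = "{f \<in> carrier A. AM.delta m \<otimes>\<^bsub>A\<^esub> f \<in> lift I \<and> f \<otimes>\<^bsub>A\<^esub> AM.delta m \<in> lift I}"
    have "f \<in> ?N"
    proof (rule supported_on_W_induct[OF fW])
      show "AM.supported_on Y \<subseteq> ?N"
        using ideal.I_l_closed[OF idY] ideal.I_r_closed[OF idY] YL AM.supported_on_closed(2)[of Y]
          AM.delta_closed[OF m] by blast
      show "spread a (block a b f) b \<in> ?N" if "a \<in> P" "b \<in> Q" for a b
        using delta_spread_lift[OF I m that blocks[OF that]] that block_closed[OF fc]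
        by (simp add: spread_closed P_closed Q_closed)
    qed (use m in \<open>auto simp: A_closed AM.mult_l_distr AM.mult_r_distr lc\<close>)
    then show ?thesis by simp
  qed
  have "x \<in> {x \<in> carrier A. x \<otimes>\<^bsub>A\<^esub> f \<in> lift I \<and> f \<otimes>\<^bsub>A\<^esub> x \<in> lift I}"
    by (rule AM.algebra_induct[OF x])
      (simp_all add: A_closed AM.mult_zero fc lc AM.mult_l_distr AM.mult_r_distr AM.mult_smult delta)
  then show "x \<otimes>\<^bsub>A\<^esub> f \<in> lift I" "f \<otimes>\<^bsub>A\<^esub> x \<in> lift I" by auto
qed

lemma embed_minus: "\<lbrakk>f \<in> carrier B; h \<in> carrier B\<rbrakk> \<Longrightarrow> embed (f \<ominus>\<^bsub>B\<^esub> h) = embed f \<ominus>\<^bsub>A\<^esub> embed h"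
  by (rule embed_ext)
    (auto simp: embed_j embed_outside AM.minus_apply AG.minus_apply embed_closed AM.A.K_minus_eq_zero_iff)

text \<open>
  The entries in column \<open>b\<close> of the row of \<open>e y\<close>.
\<close>

definition right_part :: "'m \<Rightarrow> ('m \<Rightarrow> 'k) \<Rightarrow> 'g \<Rightarrow> 'k" where
  "right_part b y = block e b (AM.delta e \<otimes>\<^bsub>A\<^esub> y)"

lemma right_part_closed: "y \<in> carrier A \<Longrightarrow> right_part b y \<in> carrier B"
  by (simp add: right_part_def block_closed A_closed e_closed)

text \<open>
  A matrix \<open>a' z\<close> with \<open>z\<close> in \<open>k[G]\<close> satisfies \<open>a' z = a' z e\<close>. So in the product with \<open>y\<close> only \<open>e y\<close> matters,
  whose entries modulo \<open>k[Y]\<close> all lie in the row of \<open>e\<close>; they are multiplied by \<open>z\<close> and moved to the row of \<open>a'\<close>.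
\<close>

lemma block_left_factor:
  assumes a: "a \<in> P" "a' \<in> P" and b: "b \<in> Q" and z: "z \<in> carrier B" and y: "y \<in> carrier A"
  shows "block a b ((AM.delta a' \<otimes>\<^bsub>A\<^esub> embed z) \<otimes>\<^bsub>A\<^esub> y) =
    (if a = a' then z \<otimes>\<^bsub>B\<^esub> right_part b y else \<zero>\<^bsub>B\<^esub>)"
proof (rule AM.algebra_induct_eq[OF y AG.abelian_group_A])
  note c = P_closed[OF a(2)] Q_closed[OF b] z embed_closed[OF z] e_closed
  note zc = AM.alg_mult_closed[OF AM.delta_closed[OF c(1)] c(4)]
  note idY = AM.ideal_supported_on[OF Y]
  {
    fix f assume f: "f \<in> carrier A"
    show "block a b ((AM.delta a' \<otimes>\<^bsub>A\<^esub> embed z) \<otimes>\<^bsub>A\<^esub> f) \<in> carrier B"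
      by (simp add: block_closed AM.alg_mult_closed zc f)
    show "(if a = a' then z \<otimes>\<^bsub>B\<^esub> right_part b f else \<zero>\<^bsub>B\<^esub>) \<in> carrier B"
      by (simp add: B_closed z right_part_closed f)
    fix k assume k: "k \<in> carrier K"
    show "block a b ((AM.delta a' \<otimes>\<^bsub>A\<^esub> embed z) \<otimes>\<^bsub>A\<^esub> (k \<odot>\<^bsub>A\<^esub> f)) =
        k \<odot>\<^bsub>B\<^esub> block a b ((AM.delta a' \<otimes>\<^bsub>A\<^esub> embed z) \<otimes>\<^bsub>A\<^esub> f)"
      by (simp only: AM.mult_smult(2)[OF k zc f] block_smult[OF k])
    have "right_part b (k \<odot>\<^bsub>A\<^esub> f) = k \<odot>\<^bsub>B\<^esub> right_part b f"
      unfolding right_part_def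
      by (simp only: AM.mult_smult(2)[OF k AM.delta_closed[OF e_closed] f] block_smult[OF k])
    then show "(if a = a' then z \<otimes>\<^bsub>B\<^esub> right_part b (k \<odot>\<^bsub>A\<^esub> f) else \<zero>\<^bsub>B\<^esub>) =
        k \<odot>\<^bsub>B\<^esub> (if a = a' then z \<otimes>\<^bsub>B\<^esub> right_part b f else \<zero>\<^bsub>B\<^esub>)"
      by (simp add: AG.mult_smult k z right_part_closed f)
  next
    fix f h assume f: "f \<in> carrier A" "h \<in> carrier A"
    show "block a b ((AM.delta a' \<otimes>\<^bsub>A\<^esub> embed z) \<otimes>\<^bsub>A\<^esub> (f \<oplus>\<^bsub>A\<^esub> h)) =
        block a b ((AM.delta a' \<otimes>\<^bsub>A\<^esub> embed z) \<otimes>\<^bsub>A\<^esub> f) \<oplus>\<^bsub>B\<^esub> block a b ((AM.delta a' \<otimes>\<^bsub>A\<^esub> embed z) \<otimes>\<^bsub>A\<^esub> h)"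
      by (simp only: AM.mult_r_distr[OF f zc] block_add)
    have "right_part b (f \<oplus>\<^bsub>A\<^esub> h) = right_part b f \<oplus>\<^bsub>B\<^esub> right_part b h"
      unfolding right_part_def
      by (simp only: AM.mult_r_distr[OF f AM.delta_closed[OF e_closed]] block_add)
    then show "(if a = a' then z \<otimes>\<^bsub>B\<^esub> right_part b (f \<oplus>\<^bsub>A\<^esub> h) else \<zero>\<^bsub>B\<^esub>) =
        (if a = a' then z \<otimes>\<^bsub>B\<^esub> right_part b f else \<zero>\<^bsub>B\<^esub>) \<oplus>\<^bsub>B\<^esub>
        (if a = a' then z \<otimes>\<^bsub>B\<^esub> right_part b h else \<zero>\<^bsub>B\<^esub>)"
      by (simp add: AG.mult_r_distr z right_part_closed f B_closed)
  next
    fix m assume m: "m \<in> carrier M"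
    let ?em = "e \<otimes>\<^bsub>M\<^esub> m"
    have em: "?em \<in> carrier M" using m e_closed by simp
    have eq: "(AM.delta a' \<otimes>\<^bsub>A\<^esub> embed z) \<otimes>\<^bsub>A\<^esub> AM.delta m = (AM.delta a' \<otimes>\<^bsub>A\<^esub> embed z) \<otimes>\<^bsub>A\<^esub> AM.delta ?em"
    proof -
      have "AM.delta a' \<otimes>\<^bsub>A\<^esub> embed z = (AM.delta a' \<otimes>\<^bsub>A\<^esub> embed z) \<otimes>\<^bsub>A\<^esub> AM.delta e"
        using c by (simp add: AM.mult_assoc A_closed embed_e)
      then have "(AM.delta a' \<otimes>\<^bsub>A\<^esub> embed z) \<otimes>\<^bsub>A\<^esub> AM.delta m =
          (AM.delta a' \<otimes>\<^bsub>A\<^esub> embed z) \<otimes>\<^bsub>A\<^esub> AM.delta e \<otimes>\<^bsub>A\<^esub> AM.delta m" by simp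
      also have "\<dots> = (AM.delta a' \<otimes>\<^bsub>A\<^esub> embed z) \<otimes>\<^bsub>A\<^esub> (AM.delta e \<otimes>\<^bsub>A\<^esub> AM.delta m)"
        by (rule AM.mult_assoc[OF zc AM.delta_closed[OF e_closed] AM.delta_closed[OF m]])
      finally show ?thesis by (simp only: AM.delta_mult[OF e_closed m])
    qed
    have rp: "right_part b (AM.delta m) = block e b (AM.delta ?em)"
      by (simp add: right_part_def AM.delta_mult e_closed m)
    show "block a b ((AM.delta a' \<otimes>\<^bsub>A\<^esub> embed z) \<otimes>\<^bsub>A\<^esub> AM.delta m) =
        (if a = a' then z \<otimes>\<^bsub>B\<^esub> right_part b (AM.delta m) else \<zero>\<^bsub>B\<^esub>)"
    proof (cases "?em \<in> Y")
      case True
      then have d: "AM.delta ?em \<in> AM.supported_on Y" using em by (intro AM.delta_supported_on)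
      have "block a b ((AM.delta a' \<otimes>\<^bsub>A\<^esub> embed z) \<otimes>\<^bsub>A\<^esub> AM.delta ?em) = \<zero>\<^bsub>B\<^esub>"
        using ideal.I_l_closed[OF idY d zc] a(1) b by (rule block_Y)
      moreover have "block e b (AM.delta ?em) = \<zero>\<^bsub>B\<^esub>" using d e_P b by (rule block_Y)
      ultimately show ?thesis by (simp only: eq rp AG.mult_zero[OF z] if_cancel)
    next
      case False
      then obtain b' g where b': "b' \<in> Q" "g \<in> carrier G" "?em = j g \<otimes>\<^bsub>M\<^esub> b'"
        using right_action[OF m e_Q] by auto
      note c' = Q_closed[OF b'(1)] j_closed[OF b'(2)]
      have "rees e g b' = ?em" by (simp add: rees_def b' j_e)
      then have de: "AM.delta ?em = spread e (AG.delta g) b'"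
        by (simp add: spread_delta e_closed c' b')
      have 1: "(AM.delta a' \<otimes>\<^bsub>A\<^esub> embed z) \<otimes>\<^bsub>A\<^esub> AM.delta ?em = spread a' (z \<otimes>\<^bsub>B\<^esub> AG.delta g) b'"
        unfolding b'(3) using c c' b'
        by (simp add: spread_def AM.mult_assoc A_closed AM.delta_mult[symmetric] embed_mult embed_delta B_closed)
      have 2: "block e b (AM.delta ?em) = (if b = b' then AG.delta g else \<zero>\<^bsub>B\<^esub>)"
        unfolding de using b b'(1,2) e_P by (simp add: block_spread B_closed)
      show ?thesis unfolding eq rp 1 2
        using a b b'(1,2) z by (simp add: block_spread B_closed AG.mult_zero)
    qed
  }
qed

lemma corner_sandwich:
  assumes m: "m \<in> carrier M"
  shows "e \<otimes>\<^bsub>M\<^esub> m \<otimes>\<^bsub>M\<^esub> e \<in> Y \<or> (\<exists>g\<in>carrier G. e \<otimes>\<^bsub>M\<^esub> m \<otimes>\<^bsub>M\<^esub> e = j g)"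
proof (cases "m \<otimes>\<^bsub>M\<^esub> e \<in> Y")
  case True
  then show ?thesis using Y_left[OF e_closed True] m e_closed by (simp add: AM.Mon.m_assoc)
next
  case False
  then obtain a g where a: "a \<in> P" "g \<in> carrier G" "m \<otimes>\<^bsub>M\<^esub> e = a \<otimes>\<^bsub>M\<^esub> j g"
    using left_action[OF m e_P] by auto
  note c = P_closed[OF a(1)] j_closed[OF a(2)] e_closed m
  have eq: "e \<otimes>\<^bsub>M\<^esub> m \<otimes>\<^bsub>M\<^esub> e = (e \<otimes>\<^bsub>M\<^esub> a) \<otimes>\<^bsub>M\<^esub> j g" using c a(3) by (simp add: AM.Mon.m_assoc)
  show ?thesis
  proof (cases "e \<otimes>\<^bsub>M\<^esub> a \<in> Y")
    case True
    then show ?thesis unfolding eq using Y_right[OF c(2)] by simp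
  next
    case False
    then obtain h where "h \<in> carrier G" "e \<otimes>\<^bsub>M\<^esub> a = j h" using sandwich[OF e_Q a(1)] by auto
    then show ?thesis unfolding eq using a(2) by (auto simp: j_mult[symmetric])
  qed
qed

text \<open>
  Modulo \<open>k[Y]\<close> the corner \<open>z k[M] z\<close> is no larger than \<open>z k[G] z\<close>, since for \<open>m\<close> in \<open>M\<close> the
  element \<open>e m e\<close> lies in \<open>Y\<close> or in the image of \<open>G\<close>.
\<close>

lemma corner_in_embed:
  assumes z: "z \<in> carrier B" and x: "x \<in> carrier A"
  shows "\<exists>w\<in>carrier B. embed z \<otimes>\<^bsub>A\<^esub> x \<otimes>\<^bsub>A\<^esub> embed z \<ominus>\<^bsub>A\<^esub> embed (z \<otimes>\<^bsub>B\<^esub> w \<otimes>\<^bsub>B\<^esub> z) \<in> AM.supported_on Y"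
proof -
  note ez = embed_closed[OF z]
  note Yc = AM.supported_on_closed[where S = Y]
  note idY = AM.ideal_supported_on[OF Y]
  let ?D = "\<lambda>x w. embed z \<otimes>\<^bsub>A\<^esub> x \<otimes>\<^bsub>A\<^esub> embed z \<ominus>\<^bsub>A\<^esub> embed (z \<otimes>\<^bsub>B\<^esub> w \<otimes>\<^bsub>B\<^esub> z)"
  let ?N = "{x \<in> carrier A. \<exists>w\<in>carrier B. ?D x w \<in> AM.supported_on Y}"
  have zero: "?D \<zero>\<^bsub>A\<^esub> \<zero>\<^bsub>B\<^esub> = \<zero>\<^bsub>A\<^esub>"
    by (simp add: AM.mult_zero ez AG.mult_zero z embed_zero a_minus_def[of A])
  have add: "?D (x \<oplus>\<^bsub>A\<^esub> y) (w \<oplus>\<^bsub>B\<^esub> v) = ?D x w \<oplus>\<^bsub>A\<^esub> ?D y v"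
    if "x \<in> carrier A" "y \<in> carrier A" "w \<in> carrier B" "v \<in> carrier B" for x y w v
    using that z ez
    by (simp add: AM.mult_l_distr AM.mult_r_distr AG.mult_l_distr AG.mult_r_distr A_closed B_closed
        embed_add embed_closed a_minus_def[of A] AM.A.M.minus_add AM.A.M.a_ac)
  have smult: "?D (c \<odot>\<^bsub>A\<^esub> x) (c \<odot>\<^bsub>B\<^esub> w) = c \<odot>\<^bsub>A\<^esub> ?D x w"
    if "c \<in> carrier K" "x \<in> carrier A" "w \<in> carrier B" for c x w
    using that z ez
    by (simp add: AM.mult_smult AG.mult_smult A_closed B_closed
        embed_smult embed_closed a_minus_def[of A] AM.A.smult_r_distr AM.A.smult_r_minus)
  have "x \<in> ?N"
  proof (rule AM.algebra_induct[OF x])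
    have "\<zero>\<^bsub>B\<^esub> \<in> carrier B" "?D \<zero>\<^bsub>A\<^esub> \<zero>\<^bsub>B\<^esub> \<in> AM.supported_on Y"
      unfolding zero by (simp_all add: B_closed Yc)
    then show "\<zero>\<^bsub>A\<^esub> \<in> ?N" using AM.alg_zero_closed by blast
    show "x \<oplus>\<^bsub>A\<^esub> y \<in> ?N" if xy: "x \<in> ?N" "y \<in> ?N" for x y
    proof -
      obtain w v where wv: "w \<in> carrier B" "v \<in> carrier B" "?D x w \<in> AM.supported_on Y" "?D y v \<in> AM.supported_on Y"
        using xy by blast
      then have "?D (x \<oplus>\<^bsub>A\<^esub> y) (w \<oplus>\<^bsub>B\<^esub> v) \<in> AM.supported_on Y" using xy by (simp add: add Yc)
      then show ?thesis using xy AG.alg_add_closed[OF wv(1,2)] AM.alg_add_closed by blast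
    qed
    show "c \<odot>\<^bsub>A\<^esub> x \<in> ?N" if cx: "c \<in> carrier K" "x \<in> ?N" for c x
    proof -
      obtain w where w: "w \<in> carrier B" "?D x w \<in> AM.supported_on Y" using cx by blast
      then have "?D (c \<odot>\<^bsub>A\<^esub> x) (c \<odot>\<^bsub>B\<^esub> w) \<in> AM.supported_on Y" using cx by (simp add: smult Yc)
      then show ?thesis using cx AG.alg_smult_closed[OF cx(1) w(1)] AM.alg_smult_closed by blast
    qed
    show "AM.delta m \<in> ?N" if m: "m \<in> carrier M" for m
    proof -
      let ?u = "e \<otimes>\<^bsub>M\<^esub> m \<otimes>\<^bsub>M\<^esub> e"
      have u: "?u \<in> carrier M" using m e_closed by simp
      have "embed z \<otimes>\<^bsub>A\<^esub> AM.delta m \<otimes>\<^bsub>A\<^esub> embed z =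
          (embed z \<otimes>\<^bsub>A\<^esub> AM.delta e) \<otimes>\<^bsub>A\<^esub> AM.delta m \<otimes>\<^bsub>A\<^esub> (AM.delta e \<otimes>\<^bsub>A\<^esub> embed z)"
        by (simp add: embed_e z)
      also have "\<dots> = embed z \<otimes>\<^bsub>A\<^esub> AM.delta ?u \<otimes>\<^bsub>A\<^esub> embed z"
        using m e_closed ez by (simp add: AM.mult_assoc A_closed AM.delta_mult[symmetric])
      finally have eq: "embed z \<otimes>\<^bsub>A\<^esub> AM.delta m \<otimes>\<^bsub>A\<^esub> embed z = embed z \<otimes>\<^bsub>A\<^esub> AM.delta ?u \<otimes>\<^bsub>A\<^esub> embed z" .
      from corner_sandwich[OF m] consider "?u \<in> Y" | g where "g \<in> carrier G" "?u = j g" by blast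
      then show ?thesis
      proof cases
        case 1
        then have "AM.delta ?u \<in> AM.supported_on Y" using u by (intro AM.delta_supported_on)
        then have "embed z \<otimes>\<^bsub>A\<^esub> AM.delta ?u \<otimes>\<^bsub>A\<^esub> embed z \<in> AM.supported_on Y"
          using ez by (intro ideal.I_r_closed[OF idY] ideal.I_l_closed[OF idY])
        then have "?D (AM.delta m) \<zero>\<^bsub>B\<^esub> \<in> AM.supported_on Y"
          unfolding eq using AM.supported_on_closed(2)[of Y]
          by (simp add: AG.mult_zero z embed_zero a_minus_def[of A] subset_iff)
        then show ?thesis using AM.delta_closed[OF m] AG.alg_zero_closed by blast
      next
        case 2
        have "?D (AM.delta m) (AG.delta g) = \<zero>\<^bsub>A\<^esub>"
          unfolding eq 2(2) using z ez 2(1) j_closed[OF 2(1)]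
          by (simp add: embed_mult embed_delta B_closed A_closed AM.A.M.minus_eq_zero_iff)
        then have "?D (AM.delta m) (AG.delta g) \<in> AM.supported_on Y" using Yc(1) by simp
        then show ?thesis using AM.delta_closed[OF m] AG.delta_closed[OF 2(1)] by blast
      qed
    qed
  qed blast
  then show ?thesis by blast
qed

text \<open>
  The idempotent \<open>x\<close> of the layer of \<open>k[G]\<close> is kept, and each generator \<open>u\<close> is replaced by the generators \<open>a u\<close>, one for
  every row \<open>a\<close>. The corner at \<open>x\<close> does not grow, by \<open>corner_in_embed\<close>. The rows are independent, and in
  row \<open>a\<close> a relation between the \<open>a u\<close> is, column by column, a relation between the \<open>u\<close> in \<open>k[G]\<close>.
\<close>

theorem heredity_layer_lift:
  assumes "heredity_layer B I J"
  shows "heredity_layer A (lift I) (lift J)"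
proof -
  obtain x U where gen: "heredity_generators B I J x U" using assms by (auto simp: heredity_layer_def)
  note g = heredity_generatorsD[OF gen]
  interpret I: ideal I B by (rule g(1))
  interpret J: ideal J B by (rule g(2))
  have Jc: "z \<in> carrier B" if "z \<in> J" for z using that J.a_subset by blast
  have Ic: "I \<subseteq> carrier B" using I.a_subset .
  note xc = Jc[OF g(4)]
  have Uc: "u \<in> carrier B" if "u \<in> U" for u using Jc g(9) that by blast
  note YI = Y_sub_lift[OF I.zero_closed]
  have idI: "ideal (lift I) A" and idJ: "ideal (lift J) A" by (rule ideal_lift[OF g(1)], rule ideal_lift[OF g(2)])
  let ?x = "embed x"
  have ex: "?x \<in> carrier A" by (rule embed_closed[OF xc])
  have embed_lift: "embed z \<in> lift N" if "ideal N B" "z \<in> N" for z N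
  proof -
    interpret N: ideal N B by fact
    have "z \<in> carrier B" using that N.a_subset by blast
    then show ?thesis using spread_lift[OF N.zero_closed N.a_subset e_P e_Q that(2)] by (simp add: spread_e_e)
  qed
  define v where "v p = AM.delta (fst p) \<otimes>\<^bsub>A\<^esub> embed (snd p)" for p
  let ?V = "v ` (P \<times> U)"
  have v_spread: "v (a, u) = spread a u e" if "a \<in> P" "u \<in> carrier B" for a u
    using that by (simp add: v_def spread_e P_closed)
  have vc: "v p \<in> carrier A" if "p \<in> P \<times> U" for p
    using that Uc by (auto simp: v_def A_closed P_closed embed_closed)
  have U_nonzero: "u \<noteq> \<zero>\<^bsub>B\<^esub>" if u: "u \<in> U" for u
  proof
    assume u0: "u = \<zero>\<^bsub>B\<^esub>"
    let ?b = "\<lambda>w. if w = u then \<one>\<^bsub>B\<^esub> else \<zero>\<^bsub>B\<^esub>"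
    have "w \<otimes>\<^bsub>B\<^esub> ?b w = \<zero>\<^bsub>B\<^esub>" if "w \<in> U" for w using that u0 Uc by (simp add: AG.mult_zero AG.A.A.one_closed)
    then have "(\<Oplus>\<^bsub>B\<^esub>w\<in>U. w \<otimes>\<^bsub>B\<^esub> ?b w) = \<zero>\<^bsub>B\<^esub>" by (intro AG.A.M.finsum_all_zero)
    then have "x \<otimes>\<^bsub>B\<^esub> ?b u \<in> I" using u I.zero_closed by (intro g(12)) auto
    then show False using g(5) xc by simp
  qed
  have v_inj: "inj_on v (P \<times> U)"
  proof (rule inj_onI)
    fix p q assume p: "p \<in> P \<times> U" and q: "q \<in> P \<times> U" and eq: "v p = v q"
    obtain a u a' u' where pq: "p = (a, u)" "q = (a', u')" by (cases p, cases q) auto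
    have au: "a \<in> P" "u \<in> U" "a' \<in> P" "u' \<in> U" using p q pq by auto
    have "block a e (v p) = u" using au e_Q by (simp add: pq v_spread Uc block_spread)
    moreover have "block a e (v q) = (if a = a' then u' else \<zero>\<^bsub>B\<^esub>)"
      using au e_Q by (simp add: pq v_spread Uc block_spread)
    ultimately show "p = q" using eq U_nonzero[OF au(2)] pq by (simp split: if_splits)
  qed
  have "heredity_generators A (lift I) (lift J) ?x ?V"
    unfolding heredity_generators_def
  proof (intro conjI ballI allI impI; (elim conjE)?)
    show "ideal (lift I) A" "ideal (lift J) A" by fact+
    show "lift I \<subseteq> lift J" by (rule lift_mono[OF g(3)])
    show "?x \<in> lift J" by (rule embed_lift[OF g(2,4)])
    have "block e e ?x = x" using block_spread[OF e_P e_Q e_P e_Q xc] by (simp add: spread_e_e xc)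
    moreover have "block e e ?x \<in> I" if "?x \<in> lift I" using that e_P e_Q unfolding lift_def by blast
    ultimately show "?x \<notin> lift I" using g(5) by auto
    have "?x \<otimes>\<^bsub>A\<^esub> ?x \<ominus>\<^bsub>A\<^esub> ?x = embed (x \<otimes>\<^bsub>B\<^esub> x \<ominus>\<^bsub>B\<^esub> x)"
      by (simp add: embed_minus embed_mult xc B_closed)
    then show "?x \<otimes>\<^bsub>A\<^esub> ?x \<ominus>\<^bsub>A\<^esub> ?x \<in> lift I" using embed_lift[OF g(1) g(6)] by simp
    show "finite ?V" using finite_PQ g(8) by simp
    show "?V \<subseteq> lift J"
    proof
      fix w assume "w \<in> ?V"
      then obtain a u where "a \<in> P" "u \<in> U" "w = v (a, u)" by auto
      then show "w \<in> lift J"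
        using spread_lift[OF J.zero_closed J.a_subset _ e_Q, of a u] g(9) Uc by (auto simp: v_spread)
    qed
    show "w \<otimes>\<^bsub>A\<^esub> ?x \<ominus>\<^bsub>A\<^esub> w \<in> lift I" if "w \<in> ?V" for w
    proof -
      obtain a u where au: "a \<in> P" "u \<in> U" "w = v (a, u)" using \<open>w \<in> ?V\<close> by auto
      note c = P_closed[OF au(1)] Uc[OF au(2)]
      let ?d = "u \<otimes>\<^bsub>B\<^esub> x \<ominus>\<^bsub>B\<^esub> u"
      have dI: "?d \<in> I" by (rule g(10)[OF au(2)])
      have dc: "?d \<in> carrier B" using dI Ic by blast
      have "w \<otimes>\<^bsub>A\<^esub> ?x \<ominus>\<^bsub>A\<^esub> w = AM.delta a \<otimes>\<^bsub>A\<^esub> embed ?d"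
        using c xc by (simp add: au(3) v_def embed_minus embed_mult B_closed A_closed embed_closed
            a_minus_def[of A] AM.mult_r_distr AM.mult_assoc AM.A.A.r_minus)
      also have "\<dots> = spread a ?d e" using c dc by (simp add: spread_e)
      also have "\<dots> \<in> lift I" by (rule spread_lift[OF I.zero_closed Ic au(1) e_Q dI])
      finally show ?thesis .
    qed
  next
    fix y assume y: "y \<in> carrier A"
    obtain w where w: "w \<in> carrier B"
      and "?x \<otimes>\<^bsub>A\<^esub> y \<otimes>\<^bsub>A\<^esub> ?x \<ominus>\<^bsub>A\<^esub> embed (x \<otimes>\<^bsub>B\<^esub> w \<otimes>\<^bsub>B\<^esub> x) \<in> AM.supported_on Y"
      using corner_in_embed[OF xc y] by blast
    then have diff: "?x \<otimes>\<^bsub>A\<^esub> y \<otimes>\<^bsub>A\<^esub> ?x \<ominus>\<^bsub>A\<^esub> embed (x \<otimes>\<^bsub>B\<^esub> w \<otimes>\<^bsub>B\<^esub> x) \<in> lift I" using YI by blast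
    let ?z = "x \<otimes>\<^bsub>B\<^esub> w \<otimes>\<^bsub>B\<^esub> x"
    have zc: "?z \<in> carrier B" using xc w by (simp add: B_closed)
    have xyx: "?x \<otimes>\<^bsub>A\<^esub> y \<otimes>\<^bsub>A\<^esub> ?x \<in> carrier A" using ex y by (simp add: A_closed)
    from g(7)[OF w] show "?x \<otimes>\<^bsub>A\<^esub> y \<otimes>\<^bsub>A\<^esub> ?x \<in> lift I \<or>
      (\<exists>t\<in>carrier A. ?x \<otimes>\<^bsub>A\<^esub> y \<otimes>\<^bsub>A\<^esub> ?x \<otimes>\<^bsub>A\<^esub> t \<otimes>\<^bsub>A\<^esub> ?x \<ominus>\<^bsub>A\<^esub> ?x \<in> lift I)"
    proof
      assume "?z \<in> I"
      then have "embed ?z \<in> lift I" by (rule embed_lift[OF g(1)])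
      then have "(?x \<otimes>\<^bsub>A\<^esub> y \<otimes>\<^bsub>A\<^esub> ?x \<ominus>\<^bsub>A\<^esub> embed ?z) \<oplus>\<^bsub>A\<^esub> embed ?z \<in> lift I"
        using lift_closed(2)[OF g(1)] diff by blast
      also have "(?x \<otimes>\<^bsub>A\<^esub> y \<otimes>\<^bsub>A\<^esub> ?x \<ominus>\<^bsub>A\<^esub> embed ?z) \<oplus>\<^bsub>A\<^esub> embed ?z = ?x \<otimes>\<^bsub>A\<^esub> y \<otimes>\<^bsub>A\<^esub> ?x"
        using xyx embed_closed[OF zc] by (simp add: a_minus_def[of A] AM.A.M.a_assoc AM.A.M.l_neg)
      finally show ?thesis ..
    next
      assume "\<exists>t\<in>carrier B. ?z \<otimes>\<^bsub>B\<^esub> t \<otimes>\<^bsub>B\<^esub> x \<ominus>\<^bsub>B\<^esub> x \<in> I"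
      then obtain t where t: "t \<in> carrier B" "?z \<otimes>\<^bsub>B\<^esub> t \<otimes>\<^bsub>B\<^esub> x \<ominus>\<^bsub>B\<^esub> x \<in> I" ..
      let ?t = "embed t"
      have tc: "?t \<in> carrier A" "embed ?z \<in> carrier A" by (rule embed_closed[OF t(1)], rule embed_closed[OF zc])
      have "(?x \<otimes>\<^bsub>A\<^esub> y \<otimes>\<^bsub>A\<^esub> ?x \<ominus>\<^bsub>A\<^esub> embed ?z) \<otimes>\<^bsub>A\<^esub> (?t \<otimes>\<^bsub>A\<^esub> ?x) \<in> lift I"
        using ideal.I_r_closed[OF idI diff] AM.alg_mult_closed[OF tc(1) ex] by blast
      also have "(?x \<otimes>\<^bsub>A\<^esub> y \<otimes>\<^bsub>A\<^esub> ?x \<ominus>\<^bsub>A\<^esub> embed ?z) \<otimes>\<^bsub>A\<^esub> (?t \<otimes>\<^bsub>A\<^esub> ?x) =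
          ?x \<otimes>\<^bsub>A\<^esub> y \<otimes>\<^bsub>A\<^esub> ?x \<otimes>\<^bsub>A\<^esub> ?t \<otimes>\<^bsub>A\<^esub> ?x \<ominus>\<^bsub>A\<^esub> embed ?z \<otimes>\<^bsub>A\<^esub> ?t \<otimes>\<^bsub>A\<^esub> ?x"
      proof -
        have "(p \<ominus>\<^bsub>A\<^esub> q) \<otimes>\<^bsub>A\<^esub> (?t \<otimes>\<^bsub>A\<^esub> ?x) = p \<otimes>\<^bsub>A\<^esub> ?t \<otimes>\<^bsub>A\<^esub> ?x \<ominus>\<^bsub>A\<^esub> q \<otimes>\<^bsub>A\<^esub> ?t \<otimes>\<^bsub>A\<^esub> ?x"
          if "p \<in> carrier A" "q \<in> carrier A" for p q
          using that tc(1) ex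
          by (simp add: a_minus_def[of A] AM.mult_l_distr AM.mult_assoc A_closed AM.A.A.l_minus)
        then show ?thesis using xyx tc(2) by blast
      qed
      finally have d1: "?x \<otimes>\<^bsub>A\<^esub> y \<otimes>\<^bsub>A\<^esub> ?x \<otimes>\<^bsub>A\<^esub> ?t \<otimes>\<^bsub>A\<^esub> ?x \<ominus>\<^bsub>A\<^esub> embed ?z \<otimes>\<^bsub>A\<^esub> ?t \<otimes>\<^bsub>A\<^esub> ?x \<in> lift I" .
      have "embed (?z \<otimes>\<^bsub>B\<^esub> t \<otimes>\<^bsub>B\<^esub> x \<ominus>\<^bsub>B\<^esub> x) = embed ?z \<otimes>\<^bsub>A\<^esub> ?t \<otimes>\<^bsub>A\<^esub> ?x \<ominus>\<^bsub>A\<^esub> ?x"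
        using embed_mult[OF AG.alg_mult_closed[OF zc t(1)] xc] embed_mult[OF zc t(1)]
          embed_minus[OF AG.alg_mult_closed[OF AG.alg_mult_closed[OF zc t(1)] xc] xc] by (simp only:)
      then have d2: "embed ?z \<otimes>\<^bsub>A\<^esub> ?t \<otimes>\<^bsub>A\<^esub> ?x \<ominus>\<^bsub>A\<^esub> ?x \<in> lift I" using embed_lift[OF g(1) t(2)] by simp
      have "?x \<otimes>\<^bsub>A\<^esub> y \<otimes>\<^bsub>A\<^esub> ?x \<otimes>\<^bsub>A\<^esub> ?t \<otimes>\<^bsub>A\<^esub> ?x \<ominus>\<^bsub>A\<^esub> ?x \<in> lift I"
        by (rule ideal_minus_trans[OF idI _ _ ex d1 d2]) (use xyx tc ex in \<open>simp_all add: A_closed\<close>)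
      then show ?thesis using tc(1) by blast
    qed
  next
    fix N assume N: "right_ideal N A" "lift I \<subseteq> N" "?V \<subseteq> N"
    note Nd = right_idealD[OF N(1) AM.ring_A]
    show "lift J \<subseteq> N"
    proof
      fix f assume f: "f \<in> lift J"
      have fW: "f \<in> AM.supported_on W" and blocks: "\<And>a b. \<lbrakk>a \<in> P; b \<in> Q\<rbrakk> \<Longrightarrow> block a b f \<in> J"
        using f by (auto simp: lift_def)
      show "f \<in> N"
      proof (rule supported_on_W_induct[OF fW _ Nd(1,3)])
        show "AM.supported_on Y \<subseteq> N" using YI N(2) by blast
        fix a b assume ab: "a \<in> P" "b \<in> Q"
        note c = P_closed[OF ab(1)] Q_closed[OF ab(2)]
        \<comment> \<open>The entries that \<open>N\<close> admits in row \<open>a\<close> and column \<open>e\<close> form a right ideal of \<open>k[G]\<close> containing \<open>I\<close>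
          and \<open>U\<close>, hence \<open>J\<close>; right multiplication by \<open>b\<close> moves them to column \<open>b\<close>.\<close>
        let ?N = "{z \<in> carrier B. AM.delta a \<otimes>\<^bsub>A\<^esub> embed z \<in> N}"
        have "right_ideal ?N B"
        proof (rule right_idealI[OF AG.ring_A])
          show "\<zero>\<^bsub>B\<^esub> \<in> ?N" using Nd(2) c by (simp add: B_closed embed_zero AM.mult_zero A_closed)
          fix z assume z: "z \<in> ?N"
          then have zc: "z \<in> carrier B" by simp
          { fix z' assume z': "z' \<in> ?N"
            show "z \<oplus>\<^bsub>B\<^esub> z' \<in> ?N"
              using z z' Nd(3) c by (simp add: B_closed embed_add AM.mult_r_distr A_closed embed_closed) }
          fix t assume t: "t \<in> carrier B"
          have "AM.delta a \<otimes>\<^bsub>A\<^esub> embed (z \<otimes>\<^bsub>B\<^esub> t) = (AM.delta a \<otimes>\<^bsub>A\<^esub> embed z) \<otimes>\<^bsub>A\<^esub> embed t"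
            using c zc t by (simp add: embed_mult AM.mult_assoc A_closed embed_closed)
          then show "z \<otimes>\<^bsub>B\<^esub> t \<in> ?N" using z t Nd(5) by (simp add: B_closed embed_closed)
        qed blast
        moreover have "I \<subseteq> ?N"
        proof
          fix i assume i: "i \<in> I"
          then have ic: "i \<in> carrier B" using Ic by blast
          show "i \<in> ?N" using spread_lift[OF I.zero_closed Ic ab(1) e_Q i] N(2) ic c by (auto simp: spread_e)
        qed
        moreover have "U \<subseteq> ?N" using N(3) Uc ab(1) by (auto simp: v_def image_subset_iff)
        ultimately have "J \<subseteq> ?N" by (rule g(11))
        then have "AM.delta a \<otimes>\<^bsub>A\<^esub> embed (block a b f) \<in> N" using blocks[OF ab] by blast
        then show "spread a (block a b f) b \<in> N"
          unfolding spread_def by (rule Nd(5)) (rule AM.delta_closed[OF c(2)])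
      qed
    qed
  next
    fix b w assume b: "b \<in> ?V \<rightarrow> carrier A"
      and sum: "(\<Oplus>\<^bsub>A\<^esub>w\<in>?V. w \<otimes>\<^bsub>A\<^esub> b w) \<in> lift I" and "w \<in> ?V"
    then obtain a u where au: "a \<in> P" "u \<in> U" "w = v (a, u)" by auto
    have bc: "b (v p) \<in> carrier A" if "p \<in> P \<times> U" for p using b that by blast
    have tc: "(\<lambda>p. v p \<otimes>\<^bsub>A\<^esub> b (v p)) \<in> P \<times> U \<rightarrow> carrier A" using vc bc AM.alg_mult_closed by blast
    have "(\<Oplus>\<^bsub>A\<^esub>w\<in>?V. w \<otimes>\<^bsub>A\<^esub> b w) = (\<Oplus>\<^bsub>A\<^esub>p\<in>P \<times> U. v p \<otimes>\<^bsub>A\<^esub> b (v p))"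
      using v_inj tc by (intro AM.A.M.finsum_reindex) auto
    then have sum': "(\<Oplus>\<^bsub>A\<^esub>p\<in>P \<times> U. v p \<otimes>\<^bsub>A\<^esub> b (v p)) \<in> lift I" using sum by simp
    have bw: "b w \<in> carrier A" using bc au by auto
    have key: "x \<otimes>\<^bsub>B\<^esub> right_part q (b w) \<in> I" if q: "q \<in> Q" for q
    proof -
      let ?r = "\<lambda>u'. right_part q (b (v (a, u')))"
      have rc: "?r u' \<in> carrier B" if "u' \<in> U" for u' using right_part_closed bc au(1) that by simp
      have bt: "block a q (v p \<otimes>\<^bsub>A\<^esub> b (v p)) = (if a = fst p then snd p \<otimes>\<^bsub>B\<^esub> right_part q (b (v p)) else \<zero>\<^bsub>B\<^esub>)"
        if p: "p \<in> P \<times> U" for p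
      proof -
        have "fst p \<in> P" "snd p \<in> carrier B" using p Uc by auto
        then show ?thesis
          using block_left_factor[OF au(1) _ q _ bc[OF p], of "fst p" "snd p"] by (simp add: v_def)
      qed
      have btc: "block a q (v p \<otimes>\<^bsub>A\<^esub> b (v p)) \<in> carrier B" if "p \<in> P \<times> U" for p
        using block_closed tc that by blast
      have "block a q (\<Oplus>\<^bsub>A\<^esub>p\<in>P \<times> U. v p \<otimes>\<^bsub>A\<^esub> b (v p)) = (\<Oplus>\<^bsub>B\<^esub>p\<in>P \<times> U. block a q (v p \<otimes>\<^bsub>A\<^esub> b (v p)))"
        by (rule block_finsum[OF tc])
      also have "\<dots> = (\<Oplus>\<^bsub>B\<^esub>p\<in>Pair a ` U. block a q (v p \<otimes>\<^bsub>A\<^esub> b (v p)))"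
        using finite_PQ g(8) btc bt au(1)
        by (intro AG.A.M.add.finprod_mono_neutral_cong_right) auto
      also have "\<dots> = (\<Oplus>\<^bsub>B\<^esub>u'\<in>U. block a q (v (a, u') \<otimes>\<^bsub>A\<^esub> b (v (a, u'))))"
        using btc au(1) by (intro AG.A.M.finsum_reindex) (auto simp: inj_on_def)
      also have "\<dots> = (\<Oplus>\<^bsub>B\<^esub>u'\<in>U. u' \<otimes>\<^bsub>B\<^esub> ?r u')"
        using bt au(1) rc Uc AG.alg_mult_closed by (intro AG.A.M.finsum_cong') auto
      finally have "block a q (\<Oplus>\<^bsub>A\<^esub>p\<in>P \<times> U. v p \<otimes>\<^bsub>A\<^esub> b (v p)) = (\<Oplus>\<^bsub>B\<^esub>u'\<in>U. u' \<otimes>\<^bsub>B\<^esub> ?r u')" .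
      moreover have "block a q (\<Oplus>\<^bsub>A\<^esub>p\<in>P \<times> U. v p \<otimes>\<^bsub>A\<^esub> b (v p)) \<in> I"
        using sum' au(1) q unfolding lift_def by blast
      ultimately have "(\<Oplus>\<^bsub>B\<^esub>u'\<in>U. u' \<otimes>\<^bsub>B\<^esub> ?r u') \<in> I" by simp
      then have "x \<otimes>\<^bsub>B\<^esub> ?r u \<in> I" using rc au(2) by (intro g(12)) auto
      then show ?thesis using au(3) by simp
    qed
    have "?x \<otimes>\<^bsub>A\<^esub> b w \<in> lift J" using ideal.I_r_closed[OF idJ embed_lift[OF g(2,4)] bw] .
    then have W: "?x \<otimes>\<^bsub>A\<^esub> b w \<in> AM.supported_on W" by (simp add: lift_def)
    have "block a'' q (?x \<otimes>\<^bsub>A\<^esub> b w) \<in> I" if "a'' \<in> P" "q \<in> Q" for a'' q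
      using block_left_factor[OF that(1) e_P that(2) xc bw] key[OF that(2)] I.zero_closed
      by (simp add: embed_e xc)
    then show "?x \<otimes>\<^bsub>A\<^esub> b w \<in> lift I" using W by (simp add: lift_def)
  qed
  then show ?thesis by (auto simp: heredity_layer_def)
qed

lemma heredity_chain_lift:
  assumes "(heredity_layer B)\<^sup>*\<^sup>* {\<zero>\<^bsub>B\<^esub>} (carrier B)"
  shows "(heredity_layer A)\<^sup>*\<^sup>* (AM.supported_on Y) (AM.supported_on W)"
proof -
  have "(heredity_layer A)\<^sup>*\<^sup>* (lift I) (lift J)" if "(heredity_layer B)\<^sup>*\<^sup>* I J" for I J
    using that
  proof induction
    case (step J' J'')
    then show ?case using heredity_layer_lift by (meson rtranclp.rtrancl_into_rtrancl)
  qed simp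
  from this[OF assms] show ?thesis by (simp only: lift_zero lift_carrier)
qed

end

section \<open>Green's relations on a finite monoid\<close>

context monoid
begin

lemma green_L_iff: "(x, y) \<in> green_L G \<longleftrightarrow> x \<in> carrier G \<and> y \<in> carrier G \<and>
    (\<exists>u\<in>carrier G. x = u \<otimes> y) \<and> (\<exists>u\<in>carrier G. y = u \<otimes> x)"
proof -
  have "carrier G #> x = carrier G #> y \<longleftrightarrow> (\<exists>u\<in>carrier G. x = u \<otimes> y) \<and> (\<exists>u\<in>carrier G. y = u \<otimes> x)"
    if xy: "x \<in> carrier G" "y \<in> carrier G"
  proof
    assume "carrier G #> x = carrier G #> y"
    moreover have "x \<in> carrier G #> x" "y \<in> carrier G #> y"
      using xy by (auto simp: r_coset_def intro!: bexI[of _ \<one>])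
    ultimately show "(\<exists>u\<in>carrier G. x = u \<otimes> y) \<and> (\<exists>u\<in>carrier G. y = u \<otimes> x)"
      by (auto simp: r_coset_def)
  next
    assume "(\<exists>u\<in>carrier G. x = u \<otimes> y) \<and> (\<exists>u\<in>carrier G. y = u \<otimes> x)"
    then obtain u v where u: "u \<in> carrier G" "x = u \<otimes> y" and v: "v \<in> carrier G" "y = v \<otimes> x" by auto
    have "w \<otimes> x \<in> carrier G #> y" if "w \<in> carrier G" for w
    proof -
      have "w \<otimes> x = (w \<otimes> u) \<otimes> y" using that u xy by (simp add: m_assoc)
      then show ?thesis using that u(1) by (auto simp: r_coset_def)
    qed
    moreover have "w \<otimes> y \<in> carrier G #> x" if "w \<in> carrier G" for w
    proof -
      have "w \<otimes> y = (w \<otimes> v) \<otimes> x" using that v xy by (simp add: m_assoc)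
      then show ?thesis using that v(1) by (auto simp: r_coset_def)
    qed
    ultimately show "carrier G #> x = carrier G #> y" unfolding r_coset_def by blast
  qed
  then show ?thesis by (auto simp: green_L_def)
qed

lemma green_R_iff: "(x, y) \<in> green_R G \<longleftrightarrow> x \<in> carrier G \<and> y \<in> carrier G \<and>
    (\<exists>u\<in>carrier G. x = y \<otimes> u) \<and> (\<exists>u\<in>carrier G. y = x \<otimes> u)"
proof -
  have "x <# carrier G = y <# carrier G \<longleftrightarrow> (\<exists>u\<in>carrier G. x = y \<otimes> u) \<and> (\<exists>u\<in>carrier G. y = x \<otimes> u)"
    if xy: "x \<in> carrier G" "y \<in> carrier G"
  proof
    assume "x <# carrier G = y <# carrier G"
    moreover have "x \<in> x <# carrier G" "y \<in> y <# carrier G"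
      using xy by (auto simp: l_coset_def intro!: bexI[of _ \<one>])
    ultimately show "(\<exists>u\<in>carrier G. x = y \<otimes> u) \<and> (\<exists>u\<in>carrier G. y = x \<otimes> u)"
      by (auto simp: l_coset_def)
  next
    assume "(\<exists>u\<in>carrier G. x = y \<otimes> u) \<and> (\<exists>u\<in>carrier G. y = x \<otimes> u)"
    then obtain u v where u: "u \<in> carrier G" "x = y \<otimes> u" and v: "v \<in> carrier G" "y = x \<otimes> v" by auto
    have "x \<otimes> w \<in> y <# carrier G" if "w \<in> carrier G" for w
    proof -
      have "x \<otimes> w = y \<otimes> (u \<otimes> w)" using that u xy by (simp add: m_assoc)
      then show ?thesis using that u(1) by (auto simp: l_coset_def)
    qed
    moreover have "y \<otimes> w \<in> x <# carrier G" if "w \<in> carrier G" for w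
    proof -
      have "y \<otimes> w = x \<otimes> (v \<otimes> w)" using that v xy by (simp add: m_assoc)
      then show ?thesis using that v(1) by (auto simp: l_coset_def)
    qed
    ultimately show "x <# carrier G = y <# carrier G" unfolding l_coset_def by blast
  qed
  then show ?thesis by (auto simp: green_R_def)
qed

lemma green_L_sym: "(x, y) \<in> green_L G \<Longrightarrow> (y, x) \<in> green_L G"
  and green_L_trans: "(x, y) \<in> green_L G \<Longrightarrow> (y, z) \<in> green_L G \<Longrightarrow> (x, z) \<in> green_L G"
  and green_R_sym: "(x, y) \<in> green_R G \<Longrightarrow> (y, x) \<in> green_R G"
  and green_R_trans: "(x, y) \<in> green_R G \<Longrightarrow> (y, z) \<in> green_R G \<Longrightarrow> (x, z) \<in> green_R G"
  and green_H_iff: "(x, y) \<in> green_H G \<longleftrightarrow> (x, y) \<in> green_L G \<and> (x, y) \<in> green_R G"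
  and green_H_refl: "x \<in> carrier G \<Longrightarrow> (x, x) \<in> green_H G"
  by (auto simp: green_L_def green_R_def green_H_def)

text \<open>
  Green's J-preorder, \<open>M x M \<subseteq> M y M\<close>.
\<close>

definition J_le :: "'a \<Rightarrow> 'a \<Rightarrow> bool" where
  "J_le x y \<longleftrightarrow> (\<exists>u\<in>carrier G. \<exists>v\<in>carrier G. x = u \<otimes> y \<otimes> v)"

lemma J_leI: "\<lbrakk>u \<in> carrier G; v \<in> carrier G; x = u \<otimes> y \<otimes> v\<rbrakk> \<Longrightarrow> J_le x y"
  by (auto simp: J_le_def)

lemma J_le_refl: "x \<in> carrier G \<Longrightarrow> J_le x x"
  by (rule J_leI[of \<one> \<one>]) auto

lemma J_le_trans:
  assumes "z \<in> carrier G" "J_le x y" "J_le y z"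
  shows "J_le x z"
proof -
  obtain u v u' v' where c: "u \<in> carrier G" "v \<in> carrier G" "u' \<in> carrier G" "v' \<in> carrier G"
    and "x = u \<otimes> y \<otimes> v" "y = u' \<otimes> z \<otimes> v'"
    using assms by (auto simp: J_le_def)
  then have "x = (u \<otimes> u') \<otimes> z \<otimes> (v' \<otimes> v)" using assms(1) by (simp add: m_assoc)
  then show ?thesis using c by (intro J_leI) auto
qed

lemma J_le_mult: "\<lbrakk>x \<in> carrier G; y \<in> carrier G\<rbrakk> \<Longrightarrow> J_le (x \<otimes> y) y"
  "\<lbrakk>x \<in> carrier G; y \<in> carrier G\<rbrakk> \<Longrightarrow> J_le (x \<otimes> y) x"
  by (rule J_leI[of x \<one>]; simp) (rule J_leI[of \<one> y]; simp)

lemma J_le_if_L: "(x, y) \<in> green_L G \<Longrightarrow> J_le x y"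
  and J_le_if_R: "(x, y) \<in> green_R G \<Longrightarrow> J_le x y"
  using J_le_mult by (auto simp: green_L_iff green_R_iff)

end

locale finite_monoid = monoid M for M (structure) +
  assumes finite_carrier: "finite (carrier M)"
begin

text \<open>
  A counting argument: \<open>M x a\<close> is contained in \<open>M a\<close>, while \<open>a = u (x a) v\<close> makes \<open>M a\<close> contained in the
  translate \<open>(M x a) v\<close>, which has at most as many elements as \<open>M x a\<close>.
\<close>

lemma left_stability:
  assumes "x \<in> carrier M" "a \<in> carrier M" "J_le a (x \<otimes> a)"
  shows "(x \<otimes> a, a) \<in> green_L M"
proof -
  obtain u v where uv: "u \<in> carrier M" "v \<in> carrier M" "a = u \<otimes> (x \<otimes> a) \<otimes> v"
    using assms(3) by (auto simp: J_le_def)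
  let ?Ma = "(\<lambda>m. m \<otimes> a) ` carrier M" and ?Mxa = "(\<lambda>m. m \<otimes> (x \<otimes> a)) ` carrier M"
  have fin: "finite ?Ma" "finite ?Mxa" using finite_carrier by auto
  have sub: "?Mxa \<subseteq> ?Ma"
  proof
    fix w assume "w \<in> ?Mxa"
    then obtain m where "m \<in> carrier M" "w = m \<otimes> (x \<otimes> a)" by auto
    then have "m \<otimes> x \<in> carrier M" "w = (m \<otimes> x) \<otimes> a" using assms by (auto simp: m_assoc)
    then show "w \<in> ?Ma" by blast
  qed
  have "?Ma \<subseteq> (\<lambda>w. w \<otimes> v) ` ?Mxa"
  proof
    fix w assume "w \<in> ?Ma"
    then obtain m where m: "m \<in> carrier M" "w = m \<otimes> a" by auto
    have "w = m \<otimes> (u \<otimes> (x \<otimes> a) \<otimes> v)" using m(2) uv(3) by simp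
    also have "\<dots> = ((m \<otimes> u) \<otimes> (x \<otimes> a)) \<otimes> v" using m(1) uv(1,2) assms by (simp add: m_assoc)
    finally show "w \<in> (\<lambda>w. w \<otimes> v) ` ?Mxa" using m(1) uv(1) by blast
  qed
  then have "card ?Ma \<le> card ?Mxa"
    using fin by (meson card_image_le card_mono finite_imageI le_trans)
  then have "?Mxa = ?Ma" using sub fin by (intro card_seteq) auto
  moreover have "a \<in> ?Ma" using assms(2) by (intro image_eqI[of _ _ \<one>]) auto
  ultimately obtain w where "w \<in> carrier M" "a = w \<otimes> (x \<otimes> a)" by auto
  then show ?thesis using assms by (auto simp: green_L_iff)
qed

lemma right_stability:
  assumes "x \<in> carrier M" "a \<in> carrier M" "J_le a (a \<otimes> x)"
  shows "(a \<otimes> x, a) \<in> green_R M"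
proof -
  obtain u v where uv: "u \<in> carrier M" "v \<in> carrier M" "a = u \<otimes> (a \<otimes> x) \<otimes> v"
    using assms(3) by (auto simp: J_le_def)
  let ?aM = "(\<lambda>m. a \<otimes> m) ` carrier M" and ?axM = "(\<lambda>m. (a \<otimes> x) \<otimes> m) ` carrier M"
  have fin: "finite ?aM" "finite ?axM" using finite_carrier by auto
  have sub: "?axM \<subseteq> ?aM"
  proof
    fix w assume "w \<in> ?axM"
    then obtain m where "m \<in> carrier M" "w = (a \<otimes> x) \<otimes> m" by auto
    then have "x \<otimes> m \<in> carrier M" "w = a \<otimes> (x \<otimes> m)" using assms by (auto simp: m_assoc)
    then show "w \<in> ?aM" by blast
  qed
  have "?aM \<subseteq> (\<lambda>w. u \<otimes> w) ` ?axM"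
  proof
    fix w assume "w \<in> ?aM"
    then obtain m where m: "m \<in> carrier M" "w = a \<otimes> m" by auto
    have "w = (u \<otimes> (a \<otimes> x) \<otimes> v) \<otimes> m" using m(2) uv(3) by simp
    also have "\<dots> = u \<otimes> ((a \<otimes> x) \<otimes> (v \<otimes> m))" using m(1) uv(1,2) assms by (simp add: m_assoc)
    finally show "w \<in> (\<lambda>w. u \<otimes> w) ` ?axM" using m(1) uv(2) by blast
  qed
  then have "card ?aM \<le> card ?axM"
    using fin by (meson card_image_le card_mono finite_imageI le_trans)
  then have "?axM = ?aM" using sub fin by (intro card_seteq) auto
  moreover have "a \<in> ?aM" using assms(2) by (intro image_eqI[of _ _ \<one>]) auto
  ultimately obtain w where "w \<in> carrier M" "a = (a \<otimes> x) \<otimes> w" by auto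
  then show ?thesis using assms by (auto simp: green_R_iff)
qed

text \<open>
  In a finite monoid D and J agree: if \<open>y = u x v\<close> is J-equivalent to \<open>x\<close>, so is \<open>u x\<close>, and by stability
  \<open>u x\<close> is L-related to \<open>x\<close> and R-related to \<open>y\<close>.
\<close>

lemma green_D_iff: "(x, y) \<in> green_D M \<longleftrightarrow> x \<in> carrier M \<and> y \<in> carrier M \<and> J_le x y \<and> J_le y x"
proof
  assume "(x, y) \<in> green_D M"
  then obtain c where c: "(x, c) \<in> green_L M" "(c, y) \<in> green_R M" by (auto simp: green_D_def)
  then have car: "x \<in> carrier M" "y \<in> carrier M" by (auto simp: green_L_iff green_R_iff)
  have "J_le x y" using J_le_trans[OF car(2) J_le_if_L[OF c(1)] J_le_if_R[OF c(2)]] .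
  moreover have "J_le y x"
    using J_le_trans[OF car(1) J_le_if_R[OF green_R_sym[OF c(2)]] J_le_if_L[OF green_L_sym[OF c(1)]]] .
  ultimately show "x \<in> carrier M \<and> y \<in> carrier M \<and> J_le x y \<and> J_le y x" using car by simp
next
  assume H: "x \<in> carrier M \<and> y \<in> carrier M \<and> J_le x y \<and> J_le y x"
  then obtain u v where uv: "u \<in> carrier M" "v \<in> carrier M" "y = u \<otimes> x \<otimes> v" by (auto simp: J_le_def)
  have ux: "u \<otimes> x \<in> carrier M" using uv H by simp
  have "J_le y (u \<otimes> x)" using J_le_mult(2)[OF ux uv(2)] uv(3) by simp
  then have "J_le x (u \<otimes> x)" using J_le_trans[OF ux] H by blast
  then have L: "(x, u \<otimes> x) \<in> green_L M" using left_stability uv(1) H by (blast intro: green_L_sym)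
  have "J_le (u \<otimes> x) y" using J_le_trans[of y "u \<otimes> x" x] J_le_mult(1)[OF uv(1)] H by blast
  then have "(y, u \<otimes> x) \<in> green_R M" using right_stability[OF uv(2) ux] uv(3) by simp
  then show "(x, y) \<in> green_D M" using L unfolding green_D_def by (blast intro: green_R_sym)
qed

end

section \<open>Coordinates of a regular D-class\<close>

text \<open>
  The H-class \<open>H\<close> of \<open>h\<close> need not be a group. Its L-class, however, contains the idempotent \<open>e = y h\<close>, and the H-class
  of \<open>e\<close> is a group. The map \<open>unit_of\<close> below identifies it with the Schutzenberger group of \<open>H\<close>: it takes the translation by
  \<open>m\<close>, which is determined by its value \<open>h m\<close>, to \<open>y h m = e m\<close>.
\<close>

locale regular_element = finite_monoid M for M (structure) +
  fixes h y :: 'a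
  assumes h: "h \<in> carrier M" and y: "y \<in> carrier M" and hyh: "h \<otimes> y \<otimes> h = h"
begin

definition e where "e = y \<otimes> h"

definition H where "H = green_H M `` {h}"

abbreviation S where "S \<equiv> schutzenberger_group M H"

definition unit_of :: "('a \<Rightarrow> 'a) \<Rightarrow> 'a" where "unit_of f = y \<otimes> f h"

definition H_e where "H_e = {g. (g, e) \<in> green_H M}"

lemma e_closed: "e \<in> carrier M" and he: "h \<otimes> e = h" and ee: "e \<otimes> e = e"
  using h y hyh by (auto simp: e_def m_assoc)

lemma e_L_h: "(e, h) \<in> green_L M"
proof -
  have "\<exists>u\<in>carrier M. e = u \<otimes> h" using y by (auto simp: e_def)
  moreover have "\<exists>u\<in>carrier M. h = u \<otimes> e" using he h by metis
  ultimately show ?thesis using e_closed h by (simp add: green_L_iff)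
qed

lemma L_e_iff: "(a, e) \<in> green_L M \<longleftrightarrow> a \<in> carrier M \<and> a \<otimes> e = a \<and> (\<exists>p\<in>carrier M. p \<otimes> a = e)"
proof
  assume L: "(a, e) \<in> green_L M"
  then obtain u where u: "u \<in> carrier M" "a = u \<otimes> e" by (auto simp: green_L_iff)
  have "u \<otimes> e \<otimes> e = u \<otimes> e" using u(1) e_closed ee by (simp add: m_assoc)
  then have "a \<otimes> e = a" unfolding u(2) .
  moreover have "\<exists>p\<in>carrier M. p \<otimes> a = e" using L unfolding green_L_iff by metis
  ultimately show "a \<in> carrier M \<and> a \<otimes> e = a \<and> (\<exists>p\<in>carrier M. p \<otimes> a = e)"
    using L by (simp add: green_L_iff)
next
  assume "a \<in> carrier M \<and> a \<otimes> e = a \<and> (\<exists>p\<in>carrier M. p \<otimes> a = e)"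
  then show "(a, e) \<in> green_L M" using e_closed unfolding green_L_iff by metis
qed

lemma R_e_iff: "(b, e) \<in> green_R M \<longleftrightarrow> b \<in> carrier M \<and> e \<otimes> b = b \<and> (\<exists>p\<in>carrier M. b \<otimes> p = e)"
proof
  assume R: "(b, e) \<in> green_R M"
  then obtain u where u: "u \<in> carrier M" "b = e \<otimes> u" by (auto simp: green_R_iff)
  have "e \<otimes> (e \<otimes> u) = e \<otimes> u" using u(1) e_closed ee by (simp add: m_assoc[symmetric])
  then have "e \<otimes> b = b" unfolding u(2) .
  moreover have "\<exists>p\<in>carrier M. b \<otimes> p = e" using R unfolding green_R_iff by metis
  ultimately show "b \<in> carrier M \<and> e \<otimes> b = b \<and> (\<exists>p\<in>carrier M. b \<otimes> p = e)"
    using R by (simp add: green_R_iff)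
next
  assume "b \<in> carrier M \<and> e \<otimes> b = b \<and> (\<exists>p\<in>carrier M. b \<otimes> p = e)"
  then show "(b, e) \<in> green_R M" using e_closed unfolding green_R_iff by metis
qed

lemma H_e_iff: "g \<in> H_e \<longleftrightarrow> (g, e) \<in> green_L M \<and> (g, e) \<in> green_R M"
  by (simp add: H_e_def green_H_iff)

lemma H_eI:
  assumes "g \<in> carrier M" "g \<otimes> e = g" "e \<otimes> g = g" "p \<in> carrier M" "p \<otimes> g = e" "q \<in> carrier M" "g \<otimes> q = e"
  shows "g \<in> H_e"
  unfolding H_e_iff L_e_iff R_e_iff using assms by blast

lemma H_eE:
  assumes "g \<in> H_e"
  obtains p q where "g \<in> carrier M" "g \<otimes> e = g" "e \<otimes> g = g" "p \<in> carrier M" "p \<otimes> g = e"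
    "q \<in> carrier M" "g \<otimes> q = e"
  using assms unfolding H_e_iff L_e_iff R_e_iff by blast

lemma H_carrier: "h' \<in> H \<Longrightarrow> h' \<in> carrier M"
  and H_iff: "h' \<in> H \<longleftrightarrow> (h, h') \<in> green_L M \<and> (h, h') \<in> green_R M"
  and h_in_H: "h \<in> H"
  using green_H_refl[OF h] by (auto simp: H_def green_H_iff green_L_iff)

lemma H_mult_e:
  assumes "h' \<in> H"
  shows "h' \<otimes> e = h'"
proof -
  have "(h', h) \<in> green_L M" using assms by (simp add: H_iff green_L_sym)
  then have "(h', e) \<in> green_L M" using green_L_sym[OF e_L_h] by (rule green_L_trans)
  then show ?thesis by (simp add: L_e_iff)
qed

lemma stabilizer_carrier: "m \<in> right_stabilizer M H \<Longrightarrow> m \<in> carrier M"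
  and stabilizer_mult: "\<lbrakk>m \<in> right_stabilizer M H; h' \<in> H\<rbrakk> \<Longrightarrow> h' \<otimes> m \<in> H"
  by (auto simp: right_stabilizer_def r_coset_def)

lemma stabilizer_H_e:
  assumes m: "m \<in> right_stabilizer M H"
  shows "e \<otimes> m \<in> H_e"
proof -
  note mc = stabilizer_carrier[OF m]
  have hm: "h \<otimes> m \<in> H" by (rule stabilizer_mult[OF m h_in_H])
  obtain p where p: "p \<in> carrier M" "h = p \<otimes> (h \<otimes> m)" using hm by (auto simp: H_iff green_L_iff)
  obtain q where q: "q \<in> carrier M" "h = (h \<otimes> m) \<otimes> q" using hm by (auto simp: H_iff green_R_iff)
  have em: "e \<otimes> m = y \<otimes> (h \<otimes> m)" using h y mc by (simp add: e_def m_assoc)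
  show ?thesis
  proof (rule H_eI)
    show "e \<otimes> m \<in> carrier M" using e_closed mc by simp
    show "e \<otimes> m \<otimes> e = e \<otimes> m"
      unfolding em using H_mult_e[OF hm] h y mc e_closed by (simp add: m_assoc)
    show "e \<otimes> (e \<otimes> m) = e \<otimes> m" using e_closed mc ee by (simp add: m_assoc[symmetric])
    have "y \<otimes> p \<otimes> h \<otimes> (e \<otimes> m) = y \<otimes> (p \<otimes> (h \<otimes> e \<otimes> m))"
      using p(1) h y e_closed mc by (simp add: m_assoc)
    also have "\<dots> = y \<otimes> (p \<otimes> (h \<otimes> m))" by (simp add: he)
    also have "\<dots> = e" unfolding p(2)[symmetric] by (simp add: e_def)
    finally show "y \<otimes> p \<otimes> h \<otimes> (e \<otimes> m) = e" .
    have "e \<otimes> m \<otimes> q = y \<otimes> (h \<otimes> m \<otimes> q)" using q(1) h y mc by (simp add: e_def m_assoc)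
    then show "e \<otimes> m \<otimes> q = e" unfolding q(2)[symmetric] by (simp add: e_def)
  qed (use p q h y in auto)
qed

lemma H_e_stabilizer:
  assumes g: "g \<in> H_e"
  shows "g \<in> right_stabilizer M H"
proof -
  obtain p q where gc: "g \<in> carrier M" and ge: "g \<otimes> e = g" and eg: "e \<otimes> g = g"
    and p: "p \<in> carrier M" "p \<otimes> g = e" and q: "q \<in> carrier M" "g \<otimes> q = e"
    using H_eE[OF g] .
  have "h' \<otimes> g \<in> H" if h': "h' \<in> H" for h'
  proof -
    note c = H_carrier[OF h']
    obtain w where w: "w \<in> carrier M" "h = w \<otimes> h'" using h' by (auto simp: H_iff green_L_iff)
    have "y \<otimes> (w \<otimes> h') = e" unfolding w(2)[symmetric] by (simp add: e_def)
    then have g_eq: "y \<otimes> (w \<otimes> h') \<otimes> g = g" using eg by simp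
    have "h = h \<otimes> (p \<otimes> g)" using he p by simp
    also have "\<dots> = h \<otimes> p \<otimes> (y \<otimes> (w \<otimes> h') \<otimes> g)" unfolding g_eq using h p(1) gc by (simp add: m_assoc)
    also have "\<dots> = (h \<otimes> p \<otimes> y \<otimes> w) \<otimes> (h' \<otimes> g)" using h p(1) gc y w(1) c by (simp add: m_assoc)
    finally have 1: "h = (h \<otimes> p \<otimes> y \<otimes> w) \<otimes> (h' \<otimes> g)" .
    have "h' \<otimes> g = h' \<otimes> (g \<otimes> e)" using ge by simp
    also have "\<dots> = (h' \<otimes> g \<otimes> y) \<otimes> h" using gc c y h by (simp add: e_def m_assoc)
    finally have "h' \<otimes> g = (h' \<otimes> g \<otimes> y) \<otimes> h" .
    then have "(h, h' \<otimes> g) \<in> green_L M"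
      using 1 h p(1) y w(1) gc c unfolding green_L_iff by (metis m_closed)
    moreover have "(h' \<otimes> g) \<otimes> q = h'" using q gc c H_mult_e[OF h'] by (simp add: m_assoc)
    then have "(h', h' \<otimes> g) \<in> green_R M" using q(1) gc c unfolding green_R_iff by (metis m_closed)
    then have "(h, h' \<otimes> g) \<in> green_R M" using h' green_R_trans by (auto simp: H_iff)
    ultimately show ?thesis by (simp add: H_iff)
  qed
  then show ?thesis using gc by (auto simp: right_stabilizer_def r_coset_def)
qed

lemma one_stabilizer: "\<one> \<in> right_stabilizer M H"
  using H_carrier by (auto simp: right_stabilizer_def r_coset_def)

lemma S_carrier: "carrier S = right_translation M H ` right_stabilizer M H"
  by (simp add: schutzenberger_group_def)

lemma S_one: "\<one>\<^bsub>S\<^esub> = right_translation M H \<one>"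
  using H_carrier by (auto simp: schutzenberger_group_def right_translation_def intro!: restrict_ext)

lemmas S_mult = schutzenberger_mult[OF monoid_axioms subsetI[OF H_carrier]]

lemma monoid_S: "monoid S"
proof (rule monoidI)
  fix f f' assume "f \<in> carrier S" "f' \<in> carrier S"
  then show "f \<otimes>\<^bsub>S\<^esub> f' \<in> carrier S" using S_mult by (auto simp: S_carrier)
next
  fix f f' f'' assume "f \<in> carrier S" "f' \<in> carrier S" "f'' \<in> carrier S"
  then obtain m n p where r: "m \<in> right_stabilizer M H" "n \<in> right_stabilizer M H" "p \<in> right_stabilizer M H"
    and "f = right_translation M H m" "f' = right_translation M H n" "f'' = right_translation M H p"
    by (auto simp: S_carrier)
  then show "f \<otimes>\<^bsub>S\<^esub> f' \<otimes>\<^bsub>S\<^esub> f'' = f \<otimes>\<^bsub>S\<^esub> (f' \<otimes>\<^bsub>S\<^esub> f'')"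
    using stabilizer_carrier by (simp add: S_mult m_assoc)
next
  show "\<one>\<^bsub>S\<^esub> \<in> carrier S" unfolding S_one S_carrier using one_stabilizer by auto
next
  fix f assume "f \<in> carrier S"
  then obtain m where m: "m \<in> right_stabilizer M H" "f = right_translation M H m" by (auto simp: S_carrier)
  then show "\<one>\<^bsub>S\<^esub> \<otimes>\<^bsub>S\<^esub> f = f" "f \<otimes>\<^bsub>S\<^esub> \<one>\<^bsub>S\<^esub> = f"
    using one_stabilizer stabilizer_carrier[OF m(1)] by (simp_all add: S_one S_mult)
qed

lemma finite_S: "finite (carrier S)"
proof -
  have "right_stabilizer M H \<subseteq> carrier M" using stabilizer_carrier by auto
  then show ?thesis unfolding S_carrier using finite_carrier by (meson finite_imageI finite_subset)
qed

lemma unit_of_translation: "m \<in> right_stabilizer M H \<Longrightarrow> unit_of (right_translation M H m) = e \<otimes> m"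
  using h y h_in_H stabilizer_carrier by (simp add: unit_of_def right_translation_def e_def m_assoc)

lemma unit_of_H_e: "f \<in> carrier S \<Longrightarrow> unit_of f \<in> H_e"
  by (auto simp: S_carrier unit_of_translation stabilizer_H_e)

lemma unit_of_surj:
  assumes "g \<in> H_e"
  obtains f where "f \<in> carrier S" "unit_of f = g"
proof (rule that)
  have g: "g \<in> right_stabilizer M H" by (rule H_e_stabilizer[OF assms])
  then show "right_translation M H g \<in> carrier S" by (auto simp: S_carrier)
  show "unit_of (right_translation M H g) = g"
    using assms unit_of_translation[OF g] by (auto elim: H_eE)
qed

lemma unit_of_mult:
  assumes "f \<in> carrier S" "f' \<in> carrier S"
  shows "unit_of (f \<otimes>\<^bsub>S\<^esub> f') = unit_of f \<otimes> unit_of f'"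
proof -
  obtain m n where r: "m \<in> right_stabilizer M H" "n \<in> right_stabilizer M H"
    and f: "f = right_translation M H m" "f' = right_translation M H n"
    using assms by (auto simp: S_carrier)
  note c = stabilizer_carrier[OF r(1)] stabilizer_carrier[OF r(2)] e_closed
  have "(e \<otimes> m) \<otimes> (e \<otimes> n) = (e \<otimes> m \<otimes> e) \<otimes> n" using c by (simp add: m_assoc)
  also have "e \<otimes> m \<otimes> e = e \<otimes> m" using stabilizer_H_e[OF r(1)] by (auto elim: H_eE)
  finally show ?thesis using c r by (simp add: f S_mult unit_of_translation m_assoc)
qed

lemma unit_of_one: "unit_of \<one>\<^bsub>S\<^esub> = e"
  using e_closed by (simp add: S_one unit_of_translation one_stabilizer)

lemma unit_of_inj:
  assumes "f \<in> carrier S" "f' \<in> carrier S" "unit_of f = unit_of f'"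
  shows "f = f'"
proof -
  obtain m n where r: "m \<in> right_stabilizer M H" "n \<in> right_stabilizer M H"
    and f: "f = right_translation M H m" "f' = right_translation M H n"
    using assms by (auto simp: S_carrier)
  note c = stabilizer_carrier[OF r(1)] stabilizer_carrier[OF r(2)] e_closed
  have em: "e \<otimes> m = e \<otimes> n" using assms(3) r by (simp add: f unit_of_translation)
  have "h' \<otimes> m = h' \<otimes> n" if h': "h' \<in> H" for h'
  proof -
    have "h' \<otimes> m = h' \<otimes> (e \<otimes> m)" using H_mult_e[OF h'] H_carrier[OF h'] c by (simp add: m_assoc[symmetric])
    also have "\<dots> = h' \<otimes> n" unfolding em using H_mult_e[OF h'] H_carrier[OF h'] c by (simp add: m_assoc[symmetric])
    finally show ?thesis .
  qed
  then show ?thesis unfolding f right_translation_def by (intro restrict_ext)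
qed

subsection \<open>Transversals\<close>

text \<open>
  Representatives of the H-classes. The one of the class of \<open>e\<close> has to be \<open>e\<close> itself, so that \<open>e\<close> serves both as
  a row and as a column index.
\<close>

definition rep :: "'a \<Rightarrow> 'a" where
  "rep x = (if (x, e) \<in> green_H M then e else (SOME z. (x, z) \<in> green_H M))"

lemma rep_H: "x \<in> carrier M \<Longrightarrow> (x, rep x) \<in> green_H M"
  unfolding rep_def using green_H_refl[of x] by (auto intro: someI)

lemma H_sym: "(x, z) \<in> green_H M \<Longrightarrow> (z, x) \<in> green_H M"
  and H_trans: "(x, z) \<in> green_H M \<Longrightarrow> (z, w) \<in> green_H M \<Longrightarrow> (x, w) \<in> green_H M"
  by (auto simp: green_H_def green_L_def green_R_def)

lemma rep_eq: 
  assumes "(x, z) \<in> green_H M"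
  shows "rep x = rep z"
proof -
  have "(x, w) \<in> green_H M \<longleftrightarrow> (z, w) \<in> green_H M" for w
    using assms H_sym H_trans by blast
  then show ?thesis by (simp add: rep_def)
qed

lemma rep_e: "rep e = e"
  using green_H_refl[OF e_closed] by (simp add: rep_def)

definition rows where "rows = rep ` {a. (a, e) \<in> green_L M}"
definition cols where "cols = rep ` {b. (b, e) \<in> green_R M}"

lemma rows_L: "a \<in> rows \<Longrightarrow> (a, e) \<in> green_L M"
  and cols_R: "b \<in> cols \<Longrightarrow> (b, e) \<in> green_R M"
proof -
  show "(a, e) \<in> green_L M" if a: "a \<in> rows"
  proof -
    obtain x where x: "(x, e) \<in> green_L M" "a = rep x" using a by (auto simp: rows_def)
    then have "(x, a) \<in> green_L M" using rep_H[of x] by (simp add: green_H_iff green_L_iff)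
    then show ?thesis using x(1) green_L_sym green_L_trans by blast
  qed
  show "(b, e) \<in> green_R M" if b: "b \<in> cols"
  proof -
    obtain x where x: "(x, e) \<in> green_R M" "b = rep x" using b by (auto simp: cols_def)
    then have "(x, b) \<in> green_R M" using rep_H[of x] by (simp add: green_H_iff green_R_iff)
    then show ?thesis using x(1) green_R_sym green_R_trans by blast
  qed
qed

lemma e_rows: "e \<in> rows" and e_cols: "e \<in> cols"
  using rep_e e_closed ee unfolding rows_def cols_def
  by (auto simp: L_e_iff R_e_iff intro!: image_eqI[of e rep e])

lemma rep_rows: "a \<in> rows \<Longrightarrow> rep a = a" and rep_cols: "b \<in> cols \<Longrightarrow> rep b = b"
  using rep_eq[OF rep_H] by (auto simp: rows_def cols_def L_e_iff R_e_iff)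

text \<open>
  From \<open>c = a u\<close> one gets \<open>c = a (e u)\<close>. If \<open>z a = e\<close>, then \<open>e u = z c\<close>, from which \<open>e u\<close> is seen to be H-related to \<open>e\<close>.
\<close>

lemma left_factor:
  assumes L: "(c, e) \<in> green_L M" "(a, e) \<in> green_L M" and R: "(c, a) \<in> green_R M"
  shows "\<exists>g\<in>H_e. c = a \<otimes> g"
proof -
  obtain p where cc: "c \<in> carrier M" "c \<otimes> e = c" and p: "p \<in> carrier M" "p \<otimes> c = e" using L(1) unfolding L_e_iff by blast
  obtain z where ac: "a \<in> carrier M" "a \<otimes> e = a" and z: "z \<in> carrier M" "z \<otimes> a = e" using L(2) unfolding L_e_iff by blast
  obtain u v where u: "u \<in> carrier M" "c = a \<otimes> u" and v: "v \<in> carrier M" "a = c \<otimes> v"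
    using R by (auto simp: green_R_iff)
  let ?g = "e \<otimes> u"
  have ag: "a \<otimes> ?g = c" using ac u e_closed by (simp add: m_assoc[symmetric])
  have zc: "z \<otimes> c = ?g" using z ac(1) u by (simp add: m_assoc[symmetric])
  have "?g \<in> H_e"
  proof (rule H_eI)
    show gc: "?g \<in> carrier M" using e_closed u by simp
    show "?g \<otimes> e = ?g" unfolding zc[symmetric] using cc z e_closed by (simp add: m_assoc)
    show "e \<otimes> ?g = ?g" using ee e_closed u by (simp add: m_assoc[symmetric])
    show "(p \<otimes> a) \<otimes> ?g = e" using ag p ac gc by (simp add: m_assoc)
    have "?g \<otimes> v = z \<otimes> (c \<otimes> v)" unfolding zc[symmetric] using z cc v by (simp add: m_assoc)
    then show "?g \<otimes> v = e" using v z by simp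
  qed (use p ac v in auto)
  then show ?thesis using ag by blast
qed

lemma right_factor:
  assumes R: "(c, e) \<in> green_R M" "(b, e) \<in> green_R M" and L: "(c, b) \<in> green_L M"
  shows "\<exists>g\<in>H_e. c = g \<otimes> b"
proof -
  obtain p where cc: "c \<in> carrier M" "e \<otimes> c = c" and p: "p \<in> carrier M" "c \<otimes> p = e" using R(1) unfolding R_e_iff by blast
  obtain z where bc: "b \<in> carrier M" "e \<otimes> b = b" and z: "z \<in> carrier M" "b \<otimes> z = e" using R(2) unfolding R_e_iff by blast
  obtain u v where u: "u \<in> carrier M" "c = u \<otimes> b" and v: "v \<in> carrier M" "b = v \<otimes> c"
    using L by (auto simp: green_L_iff)
  let ?g = "u \<otimes> e"
  have gb: "?g \<otimes> b = c" using bc u e_closed by (simp add: m_assoc)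
  have cz: "c \<otimes> z = ?g" using z bc(1) u by (simp add: m_assoc)
  have "?g \<in> H_e"
  proof (rule H_eI)
    show gc: "?g \<in> carrier M" using e_closed u by simp
    show "?g \<otimes> e = ?g" using ee e_closed u by (simp add: m_assoc)
    show "e \<otimes> ?g = ?g" unfolding cz[symmetric] using cc z e_closed by (simp add: m_assoc[symmetric])
    have "v \<otimes> ?g = (v \<otimes> c) \<otimes> z" unfolding cz[symmetric] using z cc v by (simp add: m_assoc)
    then show "v \<otimes> ?g = e" using v z by simp
    show "?g \<otimes> (b \<otimes> p) = e" using gb p bc gc by (simp add: m_assoc[symmetric])
  qed (use p bc v in auto)
  then show ?thesis using gb by blast
qed

lemma L_rep: "(a, e) \<in> green_L M \<Longrightarrow> \<exists>a'\<in>rows. \<exists>g\<in>H_e. a = a' \<otimes> g"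
proof -
  assume a: "(a, e) \<in> green_L M"
  then have r: "rep a \<in> rows" "(a, rep a) \<in> green_H M" using rep_H[of a] by (auto simp: rows_def L_e_iff)
  then show ?thesis using left_factor[OF a rows_L[OF r(1)]] by (auto simp: green_H_iff)
qed

lemma R_rep: "(b, e) \<in> green_R M \<Longrightarrow> \<exists>b'\<in>cols. \<exists>g\<in>H_e. b = g \<otimes> b'"
proof -
  assume b: "(b, e) \<in> green_R M"
  then have r: "rep b \<in> cols" "(b, rep b) \<in> green_H M" using rep_H[of b] by (auto simp: cols_def R_e_iff)
  then show ?thesis using right_factor[OF b cols_R[OF r(1)]] by (auto simp: green_H_iff)
qed

lemma triple_R_L:
  assumes a: "(a, e) \<in> green_L M" and g: "g \<in> H_e" and b: "(b, e) \<in> green_R M"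
  shows "(a \<otimes> g \<otimes> b, a) \<in> green_R M" "(a \<otimes> g \<otimes> b, b) \<in> green_L M"
proof -
  obtain p q where gc: "g \<in> carrier M" and ge: "g \<otimes> e = g" and eg: "e \<otimes> g = g"
    and p: "p \<in> carrier M" "p \<otimes> g = e" and q: "q \<in> carrier M" "g \<otimes> q = e"
    using H_eE[OF g] .
  obtain z where ac: "a \<in> carrier M" "a \<otimes> e = a" and z: "z \<in> carrier M" "z \<otimes> a = e" using a unfolding L_e_iff by blast
  obtain w where bc: "b \<in> carrier M" "e \<otimes> b = b" and w: "w \<in> carrier M" "b \<otimes> w = e" using b unfolding R_e_iff by blast
  have "(a \<otimes> g \<otimes> b) \<otimes> (w \<otimes> q) = a \<otimes> (g \<otimes> (b \<otimes> w) \<otimes> q)" using ac gc bc w(1) q(1) by (simp add: m_assoc)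
  also have "\<dots> = a" using w ge q ac by simp
  finally have "a = (a \<otimes> g \<otimes> b) \<otimes> (w \<otimes> q)" ..
  moreover have "a \<otimes> g \<otimes> b = a \<otimes> (g \<otimes> b)" using ac gc bc by (simp add: m_assoc)
  ultimately show "(a \<otimes> g \<otimes> b, a) \<in> green_R M"
    using ac gc bc w(1) q(1) unfolding green_R_iff by (metis m_closed)
  have "(p \<otimes> z) \<otimes> (a \<otimes> g \<otimes> b) = p \<otimes> ((z \<otimes> a) \<otimes> g) \<otimes> b" using ac gc bc z(1) p(1) by (simp add: m_assoc)
  also have "\<dots> = b" using z eg p bc by simp
  finally have "b = (p \<otimes> z) \<otimes> (a \<otimes> g \<otimes> b)" ..
  then show "(a \<otimes> g \<otimes> b, b) \<in> green_L M"
    using ac gc bc z(1) p(1) unfolding green_L_iff by (metis m_closed)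
qed

text \<open>
  The product determines \<open>a\<close> through its R-class and \<open>b\<close> through its L-class; then \<open>g\<close> is recovered by
  multiplying with a left inverse of \<open>a\<close> and a right inverse of \<open>b\<close> relative to \<open>e\<close>.
\<close>

lemma triple_inj:
  assumes a: "a \<in> rows" "a' \<in> rows" and b: "b \<in> cols" "b' \<in> cols" and g: "g \<in> H_e" "g' \<in> H_e"
    and eq: "a \<otimes> g \<otimes> b = a' \<otimes> g' \<otimes> b'"
  shows "a = a' \<and> g = g' \<and> b = b'"
proof -
  note L = rows_L[OF a(1)] rows_L[OF a(2)] and R = cols_R[OF b(1)] cols_R[OF b(2)]
  have "(a, a') \<in> green_R M"
    by (rule green_R_trans[OF green_R_sym[OF triple_R_L(1)[OF L(1) g(1) R(1)], unfolded eq]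
          triple_R_L(1)[OF L(2) g(2) R(2)]])
  moreover have "(a, a') \<in> green_L M" by (rule green_L_trans[OF L(1) green_L_sym[OF L(2)]])
  ultimately have "rep a = rep a'" by (intro rep_eq) (simp add: green_H_iff)
  then have aa: "a = a'" unfolding rep_rows[OF a(1)] rep_rows[OF a(2)] .
  have "(b, b') \<in> green_L M"
    by (rule green_L_trans[OF green_L_sym[OF triple_R_L(2)[OF L(1) g(1) R(1)], unfolded eq]
          triple_R_L(2)[OF L(2) g(2) R(2)]])
  moreover have "(b, b') \<in> green_R M" by (rule green_R_trans[OF R(1) green_R_sym[OF R(2)]])
  ultimately have "rep b = rep b'" by (intro rep_eq) (simp add: green_H_iff)
  then have bb: "b = b'" unfolding rep_cols[OF b(1)] rep_cols[OF b(2)] .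
  obtain z where ac: "a \<in> carrier M" and z: "z \<in> carrier M" "z \<otimes> a = e" using L(1) unfolding L_e_iff by blast
  obtain w where bc: "b \<in> carrier M" and w: "w \<in> carrier M" "b \<otimes> w = e" using R(1) unfolding R_e_iff by blast
  have recover: "z \<otimes> (a \<otimes> k \<otimes> b) \<otimes> w = k" if k: "k \<in> H_e" for k
  proof -
    have kc: "k \<in> carrier M" "e \<otimes> k = k" "k \<otimes> e = k" using k by (auto elim: H_eE)
    have "z \<otimes> (a \<otimes> k \<otimes> b) \<otimes> w = (z \<otimes> a) \<otimes> k \<otimes> (b \<otimes> w)" using ac bc z(1) w(1) kc(1) by (simp add: m_assoc)
    then show ?thesis using z w kc by simp
  qed
  have "a \<otimes> g \<otimes> b = a \<otimes> g' \<otimes> b" using eq unfolding aa bb .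
  then have "z \<otimes> (a \<otimes> g \<otimes> b) \<otimes> w = z \<otimes> (a \<otimes> g' \<otimes> b) \<otimes> w" by (rule arg_cong)
  then have "g = g'" unfolding recover[OF g(1)] recover[OF g(2)] .
  then show ?thesis using aa bb by simp
qed

definition D where "D = green_D M `` {h}"

lemma D_iff: "d \<in> D \<longleftrightarrow> d \<in> carrier M \<and> J_le d e \<and> J_le e d"
proof -
  have eh: "J_le e h" "J_le h e" by (rule J_le_if_L[OF e_L_h], rule J_le_if_L[OF green_L_sym[OF e_L_h]])
  have "J_le d h \<longleftrightarrow> J_le d e" "J_le h d \<longleftrightarrow> J_le e d" if "d \<in> carrier M"
    using J_le_trans[OF e_closed _ eh(2), of d] J_le_trans[OF h _ eh(1), of d]
      J_le_trans[OF that eh(1)] J_le_trans[OF that eh(2)] by blast+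
  then show ?thesis unfolding D_def using h by (auto simp: green_D_iff)
qed

lemma L_D:
  assumes "(a, e) \<in> green_L M"
  shows "a \<in> D"
  using assms J_le_if_L[OF assms] J_le_if_L[OF green_L_sym[OF assms]] unfolding D_iff L_e_iff by blast

lemma R_D:
  assumes "(b, e) \<in> green_R M"
  shows "b \<in> D"
  using assms J_le_if_R[OF assms] J_le_if_R[OF green_R_sym[OF assms]] unfolding D_iff R_e_iff by blast

lemma triple_D: "\<lbrakk>a \<in> rows; g \<in> H_e; b \<in> cols\<rbrakk> \<Longrightarrow> a \<otimes> g \<otimes> b \<in> D"
proof -
  assume H: "a \<in> rows" "g \<in> H_e" "b \<in> cols"
  note R = triple_R_L(1)[OF rows_L[OF H(1)] H(2) cols_R[OF H(3)]]
  have a: "a \<in> D" by (rule L_D[OF rows_L[OF H(1)]])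
  have c: "a \<in> carrier M" "a \<otimes> g \<otimes> b \<in> carrier M" using R by (auto simp: green_R_iff)
  have "J_le (a \<otimes> g \<otimes> b) e" using J_le_trans[OF e_closed J_le_if_R[OF R]] a by (simp add: D_iff)
  moreover have "J_le e (a \<otimes> g \<otimes> b)"
    using J_le_trans[OF c(2) _ J_le_if_R[OF green_R_sym[OF R]]] a by (simp add: D_iff)
  ultimately show ?thesis using c(2) by (simp add: D_iff)
qed

text \<open>
  Choose \<open>a\<close> in the L-class of \<open>e\<close> and the R-class of \<open>d\<close>. Then \<open>d = a (e w)\<close> for some \<open>w\<close>, where \<open>e w\<close> lies in the R-class
  of \<open>e\<close> and hence factors as \<open>g b\<close>.
\<close>

lemma D_triple:
  assumes d: "d \<in> D"
  shows "\<exists>a\<in>rows. \<exists>g\<in>H_e. \<exists>b\<in>cols. d = a \<otimes> g \<otimes> b"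
proof -
  have dc: "d \<in> carrier M" and "(e, d) \<in> green_D M" using d e_closed by (auto simp: D_iff green_D_iff)
  then obtain c where c: "(e, c) \<in> green_L M" "(c, d) \<in> green_R M" by (auto simp: green_D_def)
  have cL: "(c, e) \<in> green_L M" by (rule green_L_sym[OF c(1)])
  then have cc: "c \<in> carrier M" by (simp add: green_L_iff)
  let ?a = "rep c"
  have a: "?a \<in> rows" using cL by (auto simp: rows_def)
  have "(c, ?a) \<in> green_R M" using rep_H[OF cc] by (simp add: green_H_iff)
  then have R: "(d, ?a) \<in> green_R M" by (rule green_R_trans[OF green_R_sym[OF c(2)]])
  then obtain w v where w: "w \<in> carrier M" "d = ?a \<otimes> w" and v: "v \<in> carrier M" "?a = d \<otimes> v"
    by (auto simp: green_R_iff)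
  obtain z where ac: "?a \<in> carrier M" "?a \<otimes> e = ?a" and z: "z \<in> carrier M" "z \<otimes> ?a = e"
    using rows_L[OF a] unfolding L_e_iff by blast
  let ?b = "e \<otimes> w"
  have ab: "?a \<otimes> ?b = d" using ac w e_closed by (simp add: m_assoc[symmetric])
  have "e = z \<otimes> (?a \<otimes> ?b \<otimes> v)" using z v ab by simp
  also have "\<dots> = (z \<otimes> ?a) \<otimes> ?b \<otimes> v" using z(1) ac(1) e_closed w(1) v(1) by (simp add: m_assoc)
  also have "\<dots> = ?b \<otimes> v" using z ee e_closed w by (simp add: m_assoc[symmetric])
  finally have "?b \<otimes> v = e" ..
  then have "(?b, e) \<in> green_R M"
    unfolding R_e_iff using e_closed w(1) v(1) ee by (auto simp: m_assoc[symmetric])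
  then obtain b g where b: "b \<in> cols" "g \<in> H_e" "?b = g \<otimes> b" using R_rep by blast
  have "g \<in> carrier M" "b \<in> carrier M" using b cols_R by (auto elim: H_eE simp: R_e_iff)
  then have "d = ?a \<otimes> g \<otimes> b" using ab b(3) ac(1) by (simp add: m_assoc)
  then show ?thesis using a b by blast
qed

text \<open>
  If a product of an element of \<open>D\<close> with an element of \<open>M\<close> avoids \<open>Y\<close>, it stays in \<open>D\<close>; by stability it
  then remains in the same L-class or R-class, where it can be factored.
\<close>

lemma rees_layer_D:
  assumes K: "field K"
    and Y: "\<And>y x. \<lbrakk>y \<in> Y; x \<in> carrier M\<rbrakk> \<Longrightarrow> x \<otimes> y \<in> Y \<and> y \<otimes> x \<in> Y" "Y \<subseteq> carrier M"
    and disj: "Y \<inter> D = {}"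
    and YD: "\<And>d x. \<lbrakk>d \<in> D; x \<in> carrier M\<rbrakk> \<Longrightarrow> x \<otimes> d \<in> Y \<union> D \<and> d \<otimes> x \<in> Y \<union> D"
  shows "rees_layer K M S Y rows cols unit_of"
    and "rees_layer.W M S Y rows cols unit_of = Y \<union> D"
proof -
  interpret AM: finite_monoid_algebra K M
    by (intro finite_monoid_algebra.intro finite_monoid_algebra_axioms.intro K monoid_axioms finite_carrier)
  interpret AG: finite_monoid_algebra K S
    by (intro finite_monoid_algebra.intro finite_monoid_algebra_axioms.intro K monoid_S finite_S)
  have DJ: "J_le d d'" if "d \<in> D" "d' \<in> D" for d d'
    using that J_le_trans[of d' d e] by (simp add: D_iff)
  have rc: "a \<in> carrier M" if "a \<in> rows" for a using rows_L[OF that] by (simp add: L_e_iff)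
  have cc: "b \<in> carrier M" if "b \<in> cols" for b using cols_R[OF that] by (simp add: R_e_iff)
  have xa: "(x \<otimes> a, a) \<in> green_L M" if "x \<in> carrier M" "a \<in> D" "x \<otimes> a \<notin> Y" for x a
  proof (rule left_stability[OF that(1)])
    show "a \<in> carrier M" using that(2) by (simp add: D_iff)
    have "x \<otimes> a \<in> D" using YD[OF that(2,1)] that(3) by blast
    then show "J_le a (x \<otimes> a)" by (rule DJ[OF that(2)])
  qed
  have bx: "(b \<otimes> x, b) \<in> green_R M" if "x \<in> carrier M" "b \<in> D" "b \<otimes> x \<notin> Y" for x b
  proof (rule right_stability[OF that(1)])
    show "b \<in> carrier M" using that(2) by (simp add: D_iff)
    have "b \<otimes> x \<in> D" using YD[OF that(2,1)] that(3) by blast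
    then show "J_le b (b \<otimes> x)" by (rule DJ[OF that(2)])
  qed
  show layer: "rees_layer K M S Y rows cols unit_of"
  proof (unfold_locales)
    show "AM.monoid_ideal Y" using Y by (auto simp: AM.monoid_ideal_def)
    show "rows \<subseteq> carrier M" "cols \<subseteq> carrier M" using rc cc by auto
    show "unit_of g \<in> carrier M" if "g \<in> carrier S" for g using unit_of_H_e[OF that] by (auto elim: H_eE)
    show "unit_of \<one>\<^bsub>S\<^esub> \<in> rows" "unit_of \<one>\<^bsub>S\<^esub> \<in> cols" by (simp_all add: unit_of_one e_rows e_cols)
    show "a = a' \<and> g = g' \<and> b = b'"
      if "a \<in> rows" "a' \<in> rows" "b \<in> cols" "b' \<in> cols" "g \<in> carrier S" "g' \<in> carrier S"
        "a \<otimes> unit_of g \<otimes> b = a' \<otimes> unit_of g' \<otimes> b'" for a a' b b' g g'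
      using triple_inj[OF that(1-4) unit_of_H_e[OF that(5)] unit_of_H_e[OF that(6)] that(7)]
        unit_of_inj[OF that(5,6)] by blast
    show "a \<otimes> unit_of g \<otimes> b \<notin> Y" if "a \<in> rows" "b \<in> cols" "g \<in> carrier S" for a b g
      using triple_D[OF that(1) unit_of_H_e[OF that(3)] that(2)] disj by blast
    show "\<exists>a'\<in>rows. \<exists>g\<in>carrier S. x \<otimes> a = a' \<otimes> unit_of g"
      if x: "x \<in> carrier M" "a \<in> rows" "x \<otimes> a \<notin> Y" for x a
    proof -
      note L = rows_L[OF x(2)]
      have "(x \<otimes> a, e) \<in> green_L M" by (rule green_L_trans[OF xa[OF x(1) L_D[OF L] x(3)] L])
      then obtain a' g where "a' \<in> rows" "g \<in> H_e" "x \<otimes> a = a' \<otimes> g" using L_rep by blast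
      then show ?thesis using unit_of_surj[of g] by metis
    qed
    show "\<exists>b'\<in>cols. \<exists>g\<in>carrier S. b \<otimes> x = unit_of g \<otimes> b'"
      if x: "x \<in> carrier M" "b \<in> cols" "b \<otimes> x \<notin> Y" for x b
    proof -
      note R = cols_R[OF x(2)]
      have "(b \<otimes> x, e) \<in> green_R M" by (rule green_R_trans[OF bx[OF x(1) R_D[OF R] x(3)] R])
      then obtain b' g where "b' \<in> cols" "g \<in> H_e" "b \<otimes> x = g \<otimes> b'" using R_rep by blast
      then show ?thesis using unit_of_surj[of g] by metis
    qed
    show "\<exists>g\<in>carrier S. b \<otimes> a = unit_of g"
      if x: "b \<in> cols" "a \<in> rows" "b \<otimes> a \<notin> Y" for a b
    proof -
      note R = cols_R[OF x(1)] and L = rows_L[OF x(2)]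
      have "(b \<otimes> a, e) \<in> green_L M" by (rule green_L_trans[OF xa[OF cc[OF x(1)] L_D[OF L] x(3)] L])
      moreover have "(b \<otimes> a, e) \<in> green_R M" by (rule green_R_trans[OF bx[OF rc[OF x(2)] R_D[OF R] x(3)] R])
      ultimately have "b \<otimes> a \<in> H_e" by (simp add: H_e_iff)
      then show ?thesis using unit_of_surj[of "b \<otimes> a"] by metis
    qed
  qed (simp add: unit_of_mult)
  interpret layer: rees_layer K M S Y rows cols unit_of by (rule layer)
  have "{layer.rees a g b | a g b. a \<in> rows \<and> g \<in> carrier S \<and> b \<in> cols} = D"
  proof (intro equalityI subsetI)
    fix d assume "d \<in> {layer.rees a g b | a g b. a \<in> rows \<and> g \<in> carrier S \<and> b \<in> cols}"
    then show "d \<in> D" using triple_D unit_of_H_e by (auto simp: layer.rees_def)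
  next
    fix d assume "d \<in> D"
    then obtain a g b where abg: "a \<in> rows" "g \<in> H_e" "b \<in> cols" "d = a \<otimes> g \<otimes> b" using D_triple by blast
    obtain f where "f \<in> carrier S" "unit_of f = g" using unit_of_surj[OF abg(2)] .
    then have "d = layer.rees a f b" using abg(4) by (simp add: layer.rees_def)
    then show "d \<in> {layer.rees a g b | a g b. a \<in> rows \<and> g \<in> carrier S \<and> b \<in> cols}"
      using abg(1,3) \<open>f \<in> carrier S\<close> by blast
  qed
  then show "layer.W = Y \<union> D" by (simp add: layer.W_def)
qed

end

section \<open>The algebra of a finite regular monoid\<close>

lemma heredity_chain_D_class:
  fixes M (structure)
  assumes K: "field K" and fin: "finite (carrier M)" and regular: "regular_monoid M"
    and D: "D \<in> D_classes M" and H: "H \<in> H_classes M" "H \<subseteq> D"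
    and cell: "cell_algebra K (monoid_algebra K (schutzenberger_group M H)) X"
    and nonzero: "cell_poset_0 K (monoid_algebra K (schutzenberger_group M H)) X = cell_poset X"
    and Y: "\<And>y x. \<lbrakk>y \<in> Y; x \<in> carrier M\<rbrakk> \<Longrightarrow> x \<otimes> y \<in> Y \<and> y \<otimes> x \<in> Y" "Y \<subseteq> carrier M"
    and disj: "Y \<inter> D = {}"
    and YD: "\<And>d x. \<lbrakk>d \<in> D; x \<in> carrier M\<rbrakk> \<Longrightarrow> x \<otimes> d \<in> Y \<union> D \<and> d \<otimes> x \<in> Y \<union> D"
  shows "(heredity_layer (monoid_algebra K M))\<^sup>*\<^sup>*
    (finite_monoid_algebra.supported_on K M Y) (finite_monoid_algebra.supported_on K M (Y \<union> D))"
proof -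
  have "monoid M" using regular by (simp add: regular_monoid_def)
  then interpret finite_monoid M by (intro finite_monoid.intro finite_monoid_axioms.intro fin)
  obtain h where h: "h \<in> carrier M" "H = green_H M `` {h}"
    using H(1) by (auto simp: H_classes_def quotient_def)
  then obtain y where y: "y \<in> carrier M" "h \<otimes> y \<otimes> h = h"
    using regular by (auto simp: regular_monoid_def)
  interpret E: regular_element M h y by unfold_locales (use h y in auto)
  have H_eq: "H = E.H" by (simp add: h(2) E.H_def)
  have "h \<in> D" using E.h_in_H H(2) by (auto simp: H_eq)
  have D_eq: "D = E.D"
  proof -
    obtain x where x: "x \<in> carrier M" "D = green_D M `` {x}"
      using D by (auto simp: D_classes_def quotient_def)
    have xh: "(x, h) \<in> green_D M" using \<open>h \<in> D\<close> x(2) by simp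
    then have J: "J_le x h" "J_le h x" by (auto simp: green_D_iff)
    have "(x, d) \<in> green_D M \<longleftrightarrow> (h, d) \<in> green_D M" for d
    proof -
      have "J_le x d \<longleftrightarrow> J_le h d" "J_le d x \<longleftrightarrow> J_le d h" if "d \<in> carrier M"
        using J_le_trans[OF that J(1)] J_le_trans[OF that J(2)]
          J_le_trans[OF x(1) _ J(2), of d] J_le_trans[OF h(1) _ J(1), of d] by blast+
      then show ?thesis using x(1) h(1) by (auto simp: green_D_iff)
    qed
    then show ?thesis unfolding x(2) E.D_def by auto
  qed
  have layer: "rees_layer K M E.S Y E.rows E.cols E.unit_of"
    and W: "rees_layer.W M E.S Y E.rows E.cols E.unit_of = Y \<union> D"
    using E.rees_layer_D[OF K Y] disj YD unfolding D_eq by blast+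
  interpret layer: rees_layer K M E.S Y E.rows E.cols E.unit_of by (rule layer)
  show ?thesis
    using layer.heredity_chain_lift cell_algebra_heredity_chain[OF cell nonzero] W
    by (simp add: H_eq)
qed

theorem corollary4p4:
  fixes K :: "('k, 'x) ring_scheme"
    and M :: "('m, 'y) monoid_scheme"
    and H :: "'m set \<Rightarrow> 'm set"
    and X :: "'m set \<Rightarrow> ('l, 's, 't, ('m \<Rightarrow> 'm) \<Rightarrow> 'k) cell_datum"
  assumes field: "field K"
    and finite: "finite (carrier M)"
    and regular: "regular_monoid M"
    and H_class: "\<And>D. D \<in> D_classes M \<Longrightarrow> H D \<in> H_classes M \<and> H D \<subseteq> D"
    and cell: "\<And>D. D \<in> D_classes M \<Longrightarrow>
      cell_algebra K (monoid_algebra K (schutzenberger_group M (H D))) (X D)"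
    and nonzero_forms: "\<And>D. D \<in> D_classes M \<Longrightarrow>
      cell_poset_0 K (monoid_algebra K (schutzenberger_group M (H D))) (X D) = cell_poset (X D)"
  shows "quasi_hereditary (monoid_algebra K M)"
proof -
  have monoid: "monoid M" using regular by (simp add: regular_monoid_def)
  interpret finite_monoid M by (intro finite_monoid.intro finite_monoid_axioms.intro monoid finite)
  interpret AM: finite_monoid_algebra K M
    by (intro finite_monoid_algebra.intro finite_monoid_algebra_axioms.intro field monoid finite)
  let ?A = "monoid_algebra K M"
  have "(heredity_layer ?A)\<^sup>*\<^sup>* (AM.supported_on Y) (carrier ?A)" if "AM.monoid_ideal Y" for Y
    using that
  proof (induction "card (carrier M - Y)" arbitrary: Y rule: less_induct)
    case less
    have Yc: "Y \<subseteq> carrier M"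
      and Y: "\<And>y x. \<lbrakk>y \<in> Y; x \<in> carrier M\<rbrakk> \<Longrightarrow> x \<otimes>\<^bsub>M\<^esub> y \<in> Y \<and> y \<otimes>\<^bsub>M\<^esub> x \<in> Y"
      using less.prems by (auto simp: AM.monoid_ideal_def)
    show ?case
    proof (cases "Y = carrier M")
      case True
      then show ?thesis by (simp add: AM.supported_on_carrier)
    next
      case False
      \<comment> \<open>Among the elements outside \<open>Y\<close>, one that generates a smallest ideal is chosen; everything
        below it and outside \<open>Y\<close> is then J-equivalent to it, so that its D-class can be added to \<open>Y\<close>.\<close>
      define below where "below x = {z \<in> carrier M. J_le z x}" for x
      obtain x where x: "x \<in> carrier M - Y"
        and min: "\<And>z. z \<in> carrier M - Y \<Longrightarrow> card (below x) \<le> card (below z)"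
        using False Yc ex_has_least_nat[of "\<lambda>x. x \<in> carrier M - Y" _ "\<lambda>x. card (below x)"] by blast
      let ?D = "green_D M `` {x}"
      have D: "?D \<in> D_classes M" using x by (auto simp: D_classes_def quotient_def)
      have D_iff: "d \<in> ?D \<longleftrightarrow> d \<in> carrier M \<and> J_le x d \<and> J_le d x" for d
        using x by (auto simp: green_D_iff)
      have outside: "d \<in> ?D" if d: "d \<in> carrier M" "d \<notin> Y" "J_le d x" for d
      proof -
        have "below d \<subseteq> below x"
          unfolding below_def using J_le_trans[of x _ d] d(3) x by blast
        moreover have "finite (below x)" unfolding below_def using finite by simp
        ultimately have "below d = below x" using min[of d] d by (intro card_seteq) auto
        then have "J_le x d" using J_le_refl[of x] x unfolding below_def by blast
        then show ?thesis unfolding D_iff using d by blast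
      qed
      have in_Y: "z \<in> Y" if z: "J_le z w" "w \<in> Y" for z w
      proof -
        obtain u v where uv: "u \<in> carrier M" "v \<in> carrier M" "z = u \<otimes>\<^bsub>M\<^esub> w \<otimes>\<^bsub>M\<^esub> v" using z(1) by (auto simp: J_le_def)
        then show ?thesis using Y z(2) by simp
      qed
      have disj: "Y \<inter> ?D = {}" using in_Y x D_iff by blast
      have YD: "m \<otimes>\<^bsub>M\<^esub> d \<in> Y \<union> ?D \<and> d \<otimes>\<^bsub>M\<^esub> m \<in> Y \<union> ?D" if "d \<in> ?D" "m \<in> carrier M" for d m
      proof -
        have d: "d \<in> carrier M" "J_le d x" using that(1) unfolding D_iff by blast+
        have "J_le (m \<otimes>\<^bsub>M\<^esub> d) x" "J_le (d \<otimes>\<^bsub>M\<^esub> m) x"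
          using J_le_trans[OF _ J_le_mult(1)[OF that(2) d(1)] d(2)] J_le_trans[OF _ J_le_mult(2)[OF d(1) that(2)] d(2)] x
          by auto
        then show ?thesis using outside d(1) that(2) by blast
      qed
      have "(heredity_layer ?A)\<^sup>*\<^sup>* (AM.supported_on Y) (AM.supported_on (Y \<union> ?D))"
        using H_class[OF D] cell[OF D] nonzero_forms[OF D]
        by (intro heredity_chain_D_class[OF field finite regular D _ _ _ _ Y Yc disj YD]) auto
      moreover have "AM.monoid_ideal (Y \<union> ?D)"
        unfolding AM.monoid_ideal_def using Yc Y YD D_iff by blast
      moreover have "card (carrier M - (Y \<union> ?D)) < card (carrier M - Y)"
        using finite x D_iff[of x] J_le_refl[of x] by (intro psubset_card_mono) auto
      ultimately show ?thesis using less.hyps[of "Y \<union> ?D"] by (meson rtranclp_trans)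
    qed
  qed
  from this[of "{}"] have "(heredity_layer ?A)\<^sup>*\<^sup>* {\<zero>\<^bsub>?A\<^esub>} (carrier ?A)"
    by (simp add: AM.monoid_ideal_def AM.supported_on_empty)
  then show ?thesis by (rule quasi_hereditary_if_layers[OF AM.ring_A])
qed

end
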